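(* Let $n\geq 3$ be an integer, $m=1-n$, let $\lambda,\mu\in\mathbb{R}$ and $\delta=\mu-\lambda$. Put $$I_\delta=\bigcup_{d=0}^{\infty}\Big\{\tfrac{2c-j}{2}\ :\ 0\leq j\leq 2d-1,\ 0\leq c\leq d\Big\},\qquad \mathsf{C}=\bigcup_{k\in\mathbb{N}}\mathfrak{C}'_k,\qquad \mathfrak{C}'_k=\Big\{\tfrac{2k-i+m}{2}\ :\ i=1,\dots,k\Big\}$$ ($c,j,d$ integers). If $\delta\notin I_\delta\cup\mathsf{C}$ and if $Q^{\mathfrak{sl}}:\mathcal{S}_\delta(S^{1|n})\to\mathcal{D}_{\lambda\mu}(S^{1|n})$ is the $\mathfrak{pgl}(2|n)$-equivariant quantization, then the map $$Q=Q^{\mathfrak{sl}}\circ\mathcal{SQ}:\ \mathcal{P}_\delta(S^{1|n})=\bigoplus_{d\in\frac12\mathbb{N}}\mathcal{P}^d_\delta(S^{1|n})\longrightarrow\mathcal{D}_{\lambda\mu}(S^{1|n})$$ is a fine $\mathfrak{spo}(2|n)$-equivariant quantization, where $\mathcal{SQ}:\mathcal{P}_\delta(S^{1|n})\to\mathcal{S}_\delta(S^{1|n})$ is the linear map given, on elements $S$ homogeneous of degree $c$ in $\zeta$, by $$\mathcal{SQ}(S)=\Big(\sum_{a=0}^\infty \Delta^a\,\frac{1}{2^a a!}\prod_{j=0}^{a-1}\frac{1}{c-\delta-\frac12 j}\Big)S ,\qquad \Delta=\sum_{i=1}^n\gamma_i\overline{D}_i\partial_\zeta .$$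
   Context: Superfunctions and contact fields. $C^\infty(S^{1|n})$ is the supercommutative superalgebra of $f=\sum_I f_I(x)\theta_I$, with $x$ an even (affine) coordinate, $\theta_1,\dots,\theta_n$ odd anticommuting coordinates; $S^{1|n}$ is identified with $\mathbb{R}^{1|n}$ through the affine coordinate. $\tilde{\ }$ denotes parity, $f'=\partial_x f$. Put $\overline{D}_i=\partial_{\theta_i}-\theta_i\partial_x$. For homogeneous $f$, $X_f=f\partial_x-(-1)^{\tilde f}\frac12\sum_{i}\overline{D}_i(f)\overline{D}_i$. $\mathfrak{spo}(2|n)$ is the Lie superalgebra spanned by the $X_f$ with $f\in\{1,x,x^2,\theta_i,x\theta_i,\theta_i\theta_j\ (i<j)\}$. $\mathfrak{pgl}(2|n)$ is the Lie superalgebra of projective vector fields, spanned by $\partial_{y^j}$, $y^i\partial_{y^j}$ and $y^j\mathcal{E}$, where $(y^1,\dots,y^{n+1})=(x,\theta_1,\dots,\theta_n)$ and $\mathcal{E}=\sum_j y^j\partial_{y^j}$. Densities and operators. $\mathcal{F}_\lambda$ is $C^\infty(S^{1|n})$ with the action $L^\lambda_{X_f}(g)=X_f(g)+\lambda f'g$. For a general vector field $X=f\partial_x+\sum g^i\partial_{\theta_i}$ the action on $\mathcal{F}_\lambda$ is $L^\lambda_X(g)=X(g)+\frac{2\lambda}{m+1}\mathrm{div}(X)g$, $\mathrm{div}(X)=\partial_xf+\sum_i(-1)^{\widetilde{g^i}}\partial_{\theta_i}g^i$ (this agrees with the previous formula for $X=X_f$). $\mathcal{D}_{\lambda\mu}$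 is the space of differential operators $\mathcal{F}_\lambda\to\mathcal{F}_\mu$, with action $\mathcal{L}^{\lambda\mu}_XD=L^\mu_X\circ D-(-1)^{\tilde X\tilde D}D\circ L^\lambda_X$. Each $D\in\mathcal{D}_{\lambda\mu}$ is a unique finite sum $\sum_{c,K}A_{cK}\partial_x^c\overline{D}^K$, $c\in\mathbb{N}$, $K\in\{0,1\}^n$, $\overline{D}^K=\overline{D}_1^{i_1}\cdots\overline{D}_n^{i_n}$. $D$ has order $\leq k$ (space $\mathcal{D}^k_{\lambda\mu}$) if $c+|K|\leq k$ in all terms, and Heisenberg order $\leq d\in\frac12\mathbb{N}$ (space $\mathcal{H}^d_{\lambda\mu}$) if $c+\frac12|K|\leq d$ in all terms. Symbols. $\mathcal{S}_\delta=\bigoplus_k\mathcal{S}^k_\delta$, $\mathcal{S}^k_\delta=\mathcal{D}^k_{\lambda\mu}/\mathcal{D}^{k-1}_{\lambda\mu}$, and $\mathcal{P}_\delta=\bigoplus_{d}\mathcal{P}_\delta^d$, $\mathcal{P}^d_\delta=\mathcal{H}^d_{\lambda\mu}/\mathcal{H}^{d-1/2}_{\lambda\mu}$, with the induced actions; $\sigma_k$ and $\mathrm{h}\sigma^d$ are the canonical projections onto $\mathcal{S}_\delta^k$ and $\mathcal{P}_\delta^d$. Both spaces are identified with polynomials $\sum A_{cK}\alpha^\delta\zeta^c\gamma^K$ ($\zeta$ even, $\gamma_1,\dots,\gamma_n$ odd, anticommuting with each other and with odd superfunctions; $\alpha^\delta$ is a formal density symbol): the class of $\sum A_{cK}\partial_x^c\overline{D}^K$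 goes to the sum of the terms $A_{cK}\alpha^\delta\zeta^c\gamma^K$ with $c+|K|=k$ (for $\mathcal{S}^k_\delta$), resp. $c+\frac12|K|=d$ (for $\mathcal{P}^d_\delta$). In $\Delta$, $\overline{D}_i$ acts on the coefficients only (with Koszul signs), and the empty product is $1$. $\mathfrak{pgl}(2|n)$-equivariant quantization. It is the unique linear map $Q^{\mathfrak{sl}}:\mathcal{S}_\delta\to\mathcal{D}_{\lambda\mu}$ commuting with the actions of $\mathfrak{pgl}(2|n)$ and such that $\sigma_k(Q^{\mathfrak{sl}}(S))=S$ for $S\in\mathcal{S}^k_\delta$ (it exists and is unique for $\delta\notin\mathsf{C}$, a known result of Mathonet and Radoux). Explicitly, for $S\in\mathcal{S}_\delta^k$, $Q^{\mathfrak{sl}}(S)=\sum_{r=0}^kC_{k,r}Q_{\mathrm{Aff}}(\mathrm{div}^rS)$, $C_{k,0}=1$, $C_{k,r}=\frac{\prod_{j=1}^r(2\lambda+k-j)}{r!\prod_{j=1}^r(m+2k-j-2\delta)}$; here symbols are written in the canonical moments $\zeta,\eta_i$ with $\gamma_i=\eta_i-\theta_i\zeta$, $Q_{\mathrm{Aff}}(A\zeta^c\eta^I)=A\partial_x^c\partial_\theta^I$, and $\mathrm{div}=\partial_x\partial_\zeta-\sum_i\partial_{\eta_i}\partial_{\theta_i}$ (derivatives in the canonical coordinates $x,\theta,\zeta,\eta$, odd ones with Koszul signs). Fine quantization. A fine $\mathfrak{spo}(2|n)$-equivariant quantization is a linear bijection $Q:\mathcal{P}_\delta\to\mathcal{D}_{\lambda\mu}$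 such that, for every $d\in\frac12\mathbb{N}$, $Q(\mathcal{P}^d_\delta)\subset\mathcal{H}^d_{\lambda\mu}$ and $\mathrm{h}\sigma^d\circ Q|_{\mathcal{P}^d_\delta}=\mathrm{Id}$, and such that $\mathcal{L}^{\lambda\mu}_{X}\circ Q=Q\circ L^{\mathcal{P}}_{X}$ for all $X\in\mathfrak{spo}(2|n)$, where $L^{\mathcal{P}}$ is the induced action on $\mathcal{P}_\delta$. *)

theory Defs
  imports "HOL-Analysis.Analysis" "HOL-Analysis.Finite_Function_Topology"
begin

section \<open>Superfunctions\<close>

definition smooth_real :: "(real \<Rightarrow> real) \<Rightarrow> bool" where
  "smooth_real f \<longleftrightarrow> (\<forall>k x. (deriv ^^ k) f differentiable (at x))"

lemma smooth_real_unfold: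
  "smooth_real f \<longleftrightarrow> (\<forall>x. f differentiable (at x)) \<and> smooth_real (deriv f)"
proof
  assume f: "smooth_real f"
  have "(deriv ^^ k) (deriv f) differentiable (at x)" for k x
    using f[unfolded smooth_real_def, rule_format, of "Suc k" x] by (simp add: funpow_swap1)
  moreover have "f differentiable (at x)" for x
    using f[unfolded smooth_real_def, rule_format, of 0 x] by simp
  ultimately show "(\<forall>x. f differentiable (at x)) \<and> smooth_real (deriv f)"
    by (simp add: smooth_real_def)
next
  assume f: "(\<forall>x. f differentiable (at x)) \<and> smooth_real (deriv f)"
  have "(deriv ^^ k) f differentiable (at x)" for k x
    using f by (cases k) (simp_all add: smooth_real_def funpow_swap1)
  then show "smooth_real f" by (simp add: smooth_real_def)
qed

lemma smooth_real_coinduct: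
  assumes "P f" and "\<And>f x. P f \<Longrightarrow> f differentiable (at x)" and "\<And>f. P f \<Longrightarrow> P (deriv f)"
  shows "smooth_real f"
proof -
  have "P ((deriv ^^ k) f)" for k
    by (induction k) (simp_all add: assms)
  then show ?thesis by (simp add: smooth_real_def assms)
qed

lemma differentiable_imp_deriv:
  fixes f :: "real \<Rightarrow> real"
  assumes "f differentiable (at x)"
  shows "(f has_field_derivative deriv f x) (at x)"
  using assms by (metis DERIV_deriv_iff_real_differentiable)

lemma smooth_real_const [simp]: "smooth_real (\<lambda>x. c)"
  by (rule smooth_real_coinduct[where P = "\<lambda>f. \<exists>c. f = (\<lambda>x. c)"]) auto

lemma smooth_real_ident [simp]: "smooth_real (\<lambda>x. x)"
  by (subst smooth_real_unfold) (simp add: deriv_ident)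

lemma smooth_real_deriv: "smooth_real f \<Longrightarrow> smooth_real (deriv f)"
  by (simp add: smooth_real_unfold[of f])

lemma smooth_real_add:
  assumes "smooth_real f" "smooth_real g"
  shows "smooth_real (\<lambda>x. f x + g x)"
proof (rule smooth_real_coinduct[where
      P = "\<lambda>h. \<exists>f g. smooth_real f \<and> smooth_real g \<and> h = (\<lambda>x. f x + g x)"])
  fix h assume "\<exists>f g. smooth_real f \<and> smooth_real g \<and> h = (\<lambda>x. f x + g x)"
  then obtain f g where h: "h = (\<lambda>x. f x + g x)" and s: "smooth_real f" "smooth_real g" by blast
  then have d: "f differentiable (at x)" "g differentiable (at x)" for x
    using smooth_real_unfold by blast+
  show "h differentiable (at x)" for x
    using d by (simp add: h)
  have "deriv h = (\<lambda>x. deriv f x + deriv g x)"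
    unfolding h
    by (intro ext DERIV_imp_deriv derivative_intros) (simp_all add: d differentiable_imp_deriv)
  then show "\<exists>f g. smooth_real f \<and> smooth_real g \<and> deriv h = (\<lambda>x. f x + g x)"
    using s smooth_real_deriv by blast
qed (use assms in blast)

lemma smooth_real_sum:
  "finite A \<Longrightarrow> (\<And>a. a \<in> A \<Longrightarrow> smooth_real (f a)) \<Longrightarrow> smooth_real (\<lambda>x. \<Sum>a\<in>A. f a x)"
  by (induction A rule: finite_induct) (auto intro: smooth_real_add)

inductive smooth_prods :: "(real \<Rightarrow> real) \<Rightarrow> bool" where
  "smooth_real f \<Longrightarrow> smooth_real g \<Longrightarrow> smooth_prods (\<lambda>x. f x * g x)"
| "smooth_prods f \<Longrightarrow> smooth_prods g \<Longrightarrow> smooth_prods (\<lambda>x. f x + g x)"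

lemma smooth_prods_deriv:
  "smooth_prods h \<Longrightarrow> (\<forall>x. h differentiable (at x)) \<and> smooth_prods (deriv h)"
proof (induction rule: smooth_prods.induct)
  case (1 f g)
  then have d: "f differentiable (at x)" "g differentiable (at x)" for x
    using smooth_real_unfold by blast+
  have eq: "deriv (\<lambda>x. f x * g x) = (\<lambda>x. deriv f x * g x + f x * deriv g x)"
  proof
    fix x
    have "((\<lambda>x. f x * g x) has_field_derivative (deriv f x * g x + f x * deriv g x)) (at x)"
      using DERIV_mult'[OF differentiable_imp_deriv[OF d(1)] differentiable_imp_deriv[OF d(2)]]
      by (simp add: add.commute)
    then show "deriv (\<lambda>x. f x * g x) x = deriv f x * g x + f x * deriv g x"
      by (rule DERIV_imp_deriv)
  qed
  have "smooth_prods (\<lambda>x. deriv f x * g x + f x * deriv g x)"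
    using 1 by (intro smooth_prods.intros smooth_real_deriv)
  then show ?case using d by (simp add: eq)
next
  case (2 f g)
  have "deriv (\<lambda>x. f x + g x) = (\<lambda>x. deriv f x + deriv g x)"
    by (intro ext DERIV_imp_deriv derivative_intros) (simp_all add: 2 differentiable_imp_deriv)
  then show ?case using 2 by (simp add: smooth_prods.intros)
qed

lemma smooth_real_mult:
  "smooth_real f \<Longrightarrow> smooth_real g \<Longrightarrow> smooth_real (\<lambda>x. f x * g x)"
  by (rule smooth_real_coinduct[where P = smooth_prods])
    (use smooth_prods_deriv in \<open>auto intro: smooth_prods.intros\<close>)

text \<open>
  The odd coordinates \<open>\<theta>\<^sub>i\<close> are indexed by a finite linearly ordered type \<open>'n\<close>, so that
  \<open>n = CARD('n)\<close>. A superfunction \<open>\<Sum>\<^sub>I f\<^sub>I(x) \<theta>\<^sub>I\<close> is the family of its real-valued smooth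
  coefficients \<open>f\<^sub>I\<close> on the affine line, where \<open>\<theta>\<^sub>I\<close> is the product of the \<open>\<theta>\<^sub>i\<close>,
  \<open>i \<in> I\<close>, in increasing order.
\<close>

typedef 'n superfun = "{f :: 'n set \<Rightarrow> real \<Rightarrow> real. \<forall>I. smooth_real (f I)}"
  morphisms coeff Superfun
  by (rule exI[of _ "\<lambda>I x. 0"]) simp

setup_lifting type_definition_superfun

lemma superfun_eqI: "(\<And>I x. coeff f I x = coeff g I x) \<Longrightarrow> f = g"
  by (auto simp flip: coeff_inject)

lemma smooth_coeff: "smooth_real (coeff f I)"
  using coeff[of f] by simp

text \<open>
  \<open>\<theta>\<^sub>J \<theta>\<^sub>K = koszul J K \<cdot> \<theta>\<^sub>(\<^sub>J \<^sub>\<union> \<^sub>K\<^sub>)\<close> for disjoint \<open>J\<close> and \<open>K\<close>.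
\<close>

definition koszul :: "'n::linorder set \<Rightarrow> 'n set \<Rightarrow> real" where
  "koszul J K = (-1) ^ card {(j, k). j \<in> J \<and> k \<in> K \<and> k < j}"

instantiation superfun :: (type) real_vector
begin

lift_definition zero_superfun :: "'a superfun" is "\<lambda>I x. 0" by simp

lift_definition plus_superfun :: "'a superfun \<Rightarrow> 'a superfun \<Rightarrow> 'a superfun"
  is "\<lambda>f g I x. f I x + g I x" by (simp add: smooth_real_add)

lift_definition scaleR_superfun :: "real \<Rightarrow> 'a superfun \<Rightarrow> 'a superfun"
  is "\<lambda>r f I x. r * f I x" by (simp add: smooth_real_mult)

lift_definition uminus_superfun :: "'a superfun \<Rightarrow> 'a superfun"
  is "\<lambda>f I x. - f I x"
  subgoal for f by (use smooth_real_mult[of "\<lambda>x. -1"] in auto)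
  done

lift_definition minus_superfun :: "'a superfun \<Rightarrow> 'a superfun \<Rightarrow> 'a superfun"
  is "\<lambda>f g I x. f I x - g I x"
  subgoal for f g
    using smooth_real_add[OF _ smooth_real_mult[of "\<lambda>x. -1"], of "f _" "g _"] by simp
  done

instance
  by standard (transfer; simp add: fun_eq_iff algebra_simps)+

end

lemma koszul_empty [simp]: "koszul {} K = 1" "koszul J {} = 1"
  by (simp_all add: koszul_def)

lemma koszul_Un_left:
  fixes J K L :: "'n::{finite,linorder} set"
  assumes "J \<inter> K = {}"
  shows "koszul (J \<union> K) L = koszul J L * koszul K L"
proof -
  have "{(j, k). j \<in> J \<union> K \<and> k \<in> L \<and> k < j} =
      {(j, k). j \<in> J \<and> k \<in> L \<and> k < j} \<union> {(j, k). j \<in> K \<and> k \<in> L \<and> k < j}" by auto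
  then show ?thesis
    using assms by (auto simp: koszul_def power_add[symmetric] intro!: card_Un_disjoint arg_cong[where f = "\<lambda>n. (-1) ^ n"])
qed

lemma koszul_Un_right:
  fixes J K L :: "'n::{finite,linorder} set"
  assumes "K \<inter> L = {}"
  shows "koszul J (K \<union> L) = koszul J K * koszul J L"
proof -
  have "{(j, k). j \<in> J \<and> k \<in> K \<union> L \<and> k < j} =
      {(j, k). j \<in> J \<and> k \<in> K \<and> k < j} \<union> {(j, k). j \<in> J \<and> k \<in> L \<and> k < j}" by auto
  then show ?thesis
    using assms by (auto simp: koszul_def power_add[symmetric] intro!: card_Un_disjoint arg_cong[where f = "\<lambda>n. (-1) ^ n"])
qed

instantiation superfun :: ("{finite,linorder}") real_algebra_1
begin

lift_definition one_superfun :: "'a superfun" is "\<lambda>I x. if I = {} then 1 else 0" by simp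

lift_definition times_superfun :: "'a superfun \<Rightarrow> 'a superfun \<Rightarrow> 'a superfun"
  is "\<lambda>f g I x. \<Sum>J\<in>Pow I. koszul J (I - J) * f J x * g (I - J) x"
  by (intro allI smooth_real_sum smooth_real_mult) simp_all

instance
proof
  fix a b c :: "'a superfun" and r :: real
  show "a * b * c = a * (b * c)"
  proof (rule superfun_eqI)
    fix I :: "'a set" and x :: real
    let ?t = "\<lambda>J K L. koszul J K * koszul J L * koszul K L * coeff a J x * coeff b K x * coeff c L x"
    have "coeff (a * b * c) I x =
        (\<Sum>M\<in>Pow I. \<Sum>J\<in>Pow M. ?t J (M - J) (I - M))"
    proof (simp only: times_superfun.rep_eq sum_distrib_left sum_distrib_right, intro sum.cong refl)
      fix M J assume "M \<in> Pow I" "J \<in> Pow M"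
      then have "koszul M (I - M) = koszul J (I - M) * koszul (M - J) (I - M)"
        using koszul_Un_left[of J "M - J" "I - M"] by (simp add: Un_absorb1)
      then show "koszul M (I - M) * (koszul J (M - J) * coeff a J x * coeff b (M - J) x) *
          coeff c (I - M) x = ?t J (M - J) (I - M)" by simp
    qed
    also have "\<dots> = (\<Sum>(M, J)\<in>Sigma (Pow I) Pow. ?t J (M - J) (I - M))"
      by (rule sum.Sigma) simp_all
    also have "\<dots> = (\<Sum>(J, K)\<in>Sigma (Pow I) (\<lambda>J. Pow (I - J)). ?t J K (I - J - K))"
      by (rule sum.reindex_bij_witness[of _ "\<lambda>(J, K). (J \<union> K, J)" "\<lambda>(M, J). (J, M - J)"])
        (auto simp: Diff_Un Un_absorb1 Diff_Int_distrib set_diff_eq intro!: arg_cong[where f = "\<lambda>(J, K, L). ?t J K L"] arg_cong2[where f = "(*)"] arg_cong[where f = "\<lambda>L. coeff c L x"] arg_cong[where f = "koszul _"])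
    also have "\<dots> = (\<Sum>J\<in>Pow I. \<Sum>K\<in>Pow (I - J). ?t J K (I - J - K))"
      by (rule sum.Sigma[symmetric]) simp_all
    also have "\<dots> = coeff (a * (b * c)) I x"
    proof (simp only: times_superfun.rep_eq sum_distrib_left sum_distrib_right, intro sum.cong refl)
      fix J K assume "J \<in> Pow I" "K \<in> Pow (I - J)"
      then have "koszul J (I - J) = koszul J K * koszul J (I - J - K)"
        using koszul_Un_right[of K "I - J - K" J] by (simp add: Un_absorb1)
      then show "?t J K (I - J - K) = koszul J (I - J) * coeff a J x *
          (koszul K (I - J - K) * coeff b K x * coeff c (I - J - K) x)" by simp
    qed
    finally show "coeff (a * b * c) I x = coeff (a * (b * c)) I x" .
  qed
  show "1 * a = a"
  proof (rule superfun_eqI)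
    fix I x
    have "coeff (1 * a) I x = (\<Sum>J\<in>Pow I. if J = {} then coeff a I x else 0)"
      unfolding times_superfun.rep_eq one_superfun.rep_eq by (intro sum.cong) auto
    then show "coeff (1 * a) I x = coeff a I x" by (simp add: sum.delta')
  qed
  show "a * 1 = a"
  proof (rule superfun_eqI)
    fix I x
    have "coeff (a * 1) I x = (\<Sum>J\<in>Pow I. if J = I then coeff a I x else 0)"
      unfolding times_superfun.rep_eq one_superfun.rep_eq by (intro sum.cong) auto
    then show "coeff (a * 1) I x = coeff a I x" by (simp add: sum.delta')
  qed
  show "(a + b) * c = a * c + b * c" "a * (b + c) = a * b + a * c"
    by (transfer; simp add: fun_eq_iff algebra_simps sum.distrib)+
  show "r *\<^sub>R a * b = r *\<^sub>R (a * b)" "a * r *\<^sub>R b = r *\<^sub>R (a * b)"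
    by (transfer; simp add: fun_eq_iff sum_distrib_left algebra_simps)+
  show "(0::'a superfun) \<noteq> 1"
    by transfer (auto simp: fun_eq_iff)
qed

end

lift_definition x_coord :: "'n superfun" is "\<lambda>I x. if I = {} then x else 0"
  subgoal for I by (cases "I = {}") simp_all
  done

lift_definition theta :: "'n \<Rightarrow> 'n superfun" is "\<lambda>i I x. if I = {i} then 1 else 0"
  by simp

lift_definition d_x :: "'n superfun \<Rightarrow> 'n superfun" is "\<lambda>f I. deriv (f I)"
  by (simp add: smooth_real_deriv)

lift_definition d_theta :: "'n::linorder \<Rightarrow> 'n superfun \<Rightarrow> 'n superfun"
  is "\<lambda>i f I x. if i \<in> I then 0 else (-1) ^ card {j \<in> I. j < i} * f (insert i I) x"
  subgoal for i f I by (cases "i \<in> I") (simp_all add: smooth_real_mult)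
  done

text \<open>
  The parity automorphism \<open>f \<mapsto> (-1)\<^sup>|\<^sup>f\<^sup>| f\<close>. Every formula stated for homogeneous
  elements is extended linearly by replacing a sign \<open>(-1)\<^sup>|\<^sup>f\<^sup>| f\<close> by \<open>parity_inv f\<close>.
\<close>

lift_definition parity_inv :: "'n superfun \<Rightarrow> 'n superfun"
  is "\<lambda>f I x. (-1) ^ card I * f I x"
  by (simp add: smooth_real_mult)


section \<open>Vector fields\<close>

text \<open>
  The pair \<open>(f, g)\<close> stands for \<open>f \<partial>\<^sub>x + \<Sum>\<^sub>i g\<^sub>i \<partial>\<^bsub>\<theta>\<^sub>i\<^esub>\<close>.
\<close>

type_synonym 'n vfield = "'n superfun \<times> ('n superfun, 'n) vec"

definition vf_apply :: "'n::{finite,linorder} vfield \<Rightarrow> 'n superfun \<Rightarrow> 'n superfun" where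
  "vf_apply X h = fst X * d_x h + (\<Sum>i\<in>UNIV. snd X $ i * d_theta i h)"

definition vf_mult :: "'n::{finite,linorder} superfun \<Rightarrow> 'n vfield \<Rightarrow> 'n vfield" where
  "vf_mult h X = (h * fst X, \<chi> i. h * snd X $ i)"

text \<open>The coordinates \<open>y\<^sup>j\<close>: \<open>None\<close> is the index of \<open>x\<close>, \<open>Some i\<close> that of \<open>\<theta>\<^sub>i\<close>.\<close>

fun y_coord :: "'n option \<Rightarrow> 'n superfun" where
  "y_coord None = x_coord"
| "y_coord (Some i) = theta i"

fun y_field :: "'n::{finite,linorder} option \<Rightarrow> 'n vfield" where
  "y_field None = (1, 0)"
| "y_field (Some i) = (0, axis i 1)"

definition euler_field :: "'n::{finite,linorder} vfield" where
  "euler_field = (\<Sum>j\<in>UNIV. vf_mult (y_coord j) (y_field j))"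

definition pgl :: "'n::{finite,linorder} vfield set" where
  "pgl = span (range y_field \<union> {vf_mult (y_coord i) (y_field j) | i j. True}
     \<union> {vf_mult (y_coord j) euler_field | j. True})"

definition Dbar_field :: "'n::{finite,linorder} \<Rightarrow> 'n vfield" where
  "Dbar_field i = y_field (Some i) - vf_mult (theta i) (y_field None)"

definition Dbar :: "'n::{finite,linorder} \<Rightarrow> 'n superfun \<Rightarrow> 'n superfun" where
  "Dbar i = vf_apply (Dbar_field i)"

definition contact_field :: "'n::{finite,linorder} superfun \<Rightarrow> 'n vfield" where
  "contact_field f = vf_mult f (y_field None)
     - (1 / 2) *\<^sub>R (\<Sum>i\<in>UNIV. vf_mult (Dbar i (parity_inv f)) (Dbar_field i))"

definition spo :: "'n::{finite,linorder} vfield set" where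
  "spo = span (contact_field ` ({1, x_coord, x_coord * x_coord}
     \<union> range theta \<union> {x_coord * theta i | i. True} \<union> {theta i * theta j | i j. i < j}))"

definition superdim :: "'n::finite itself \<Rightarrow> real" where
  "superdim _ = 1 - real CARD('n)"

definition divergence :: "'n::{finite,linorder} vfield \<Rightarrow> 'n superfun" where
  "divergence X = d_x (fst X) + (\<Sum>i\<in>UNIV. d_theta i (parity_inv (snd X $ i)))"

text \<open>The action on \<open>\<lambda>\<close>-densities; for \<open>X = contact_field f\<close> the divergence term is \<open>\<lambda> f' g\<close>.\<close>

definition lie_density ::
  "real \<Rightarrow> 'n::{finite,linorder} vfield \<Rightarrow> 'n superfun \<Rightarrow> 'n superfun" where
  "lie_density l X g = vf_apply X g + (2 * l / (superdim TYPE('n) + 1)) *\<^sub>R (divergence X * g)"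

definition vf_parity_inv :: "'n::finite vfield \<Rightarrow> 'n vfield" where
  "vf_parity_inv X = (parity_inv (fst X), \<chi> i. - parity_inv (snd X $ i))"

definition vf_even :: "'n::finite vfield \<Rightarrow> 'n vfield" where
  "vf_even X = (1 / 2) *\<^sub>R (X + vf_parity_inv X)"

definition vf_odd :: "'n::finite vfield \<Rightarrow> 'n vfield" where
  "vf_odd X = (1 / 2) *\<^sub>R (X - vf_parity_inv X)"


section \<open>Differential operators\<close>

type_synonym 'n operator = "'n superfun \<Rightarrow> 'n superfun"

text \<open>
  The polynomial \<open>\<Sum> A\<^sub>c\<^sub>K \<alpha>\<^sup>\<delta> \<zeta>\<^sup>c \<gamma>\<^sup>K\<close> is the finitely supported map \<open>(c, K) \<mapsto> A\<^sub>c\<^sub>K\<close>, with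
  \<open>K \<in> {0,1}\<^sup>n\<close> given as a subset of the index type; the formal density symbol \<open>\<alpha>\<^sup>\<delta>\<close> is dropped.
  This type is the underlying space of both \<open>S\<^sub>\<delta>\<close> and \<open>P\<^sub>\<delta>\<close>.
\<close>

type_synonym 'n symb = "(nat \<times> 'n set, 'n superfun) poly_mapping"

definition Dbar_power :: "'n::{finite,linorder} set \<Rightarrow> 'n operator" where
  "Dbar_power K = foldr Dbar (sorted_list_of_set K)"

definition normal_op :: "'n::{finite,linorder} symb \<Rightarrow> 'n operator" where
  "normal_op s g = (\<Sum>(c, K)\<in>Poly_Mapping.keys s.
     Poly_Mapping.lookup s (c, K) * (d_x ^^ c) (Dbar_power K g))"

definition diff_ops :: "'n::{finite,linorder} operator set" where
  "diff_ops = range normal_op"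

definition full_symbol :: "'n::{finite,linorder} operator \<Rightarrow> 'n symb" where
  "full_symbol D = (THE s. normal_op s = D)"

definition ord_deg :: "nat \<times> 'n set \<Rightarrow> nat" where
  "ord_deg = (\<lambda>(c, K). c + card K)"

definition heis_deg :: "nat \<times> 'n set \<Rightarrow> real" where
  "heis_deg = (\<lambda>(c, K). real c + real (card K) / 2)"

definition ops_order :: "nat \<Rightarrow> 'n::{finite,linorder} operator set" where
  "ops_order k = normal_op ` {s. \<forall>u\<in>Poly_Mapping.keys s. ord_deg u \<le> k}"

definition ops_heis :: "real \<Rightarrow> 'n::{finite,linorder} operator set" where
  "ops_heis d = normal_op ` {s. \<forall>u\<in>Poly_Mapping.keys s. heis_deg u \<le> d}"

text \<open>
  \<open>X \<cdot> D = L\<^sup>\<mu>\<^sub>X \<circ> D - (-1)\<^sup>|\<^sup>X\<^sup>|\<^sup>|\<^sup>D\<^sup>| D \<circ> L\<^sup>\<lambda>\<^sub>X\<close>, extended bilinearly to all \<open>X\<close> and \<open>D\<close>: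
  conjugating a homogeneous \<open>D\<close> by \<open>parity_inv\<close> multiplies it by \<open>(-1)\<^sup>|\<^sup>D\<^sup>|\<close>.
\<close>

definition lie_op ::
  "real \<Rightarrow> real \<Rightarrow> 'n::{finite,linorder} vfield \<Rightarrow> 'n operator \<Rightarrow> 'n operator" where
  "lie_op l m X D = (\<lambda>g. lie_density m X (D g)
     - D (lie_density l (vf_even X) g)
     - parity_inv (D (parity_inv (lie_density l (vf_odd X) g))))"


section \<open>Symbols\<close>

definition homog :: "(nat \<times> 'n set \<Rightarrow> 'd) \<Rightarrow> 'd \<Rightarrow> 'n symb set" where
  "homog deg d = {s. \<forall>u\<in>Poly_Mapping.keys s. deg u = d}"

definition homog_part :: "(nat \<times> 'n set \<Rightarrow> 'd) \<Rightarrow> 'd \<Rightarrow> 'n symb \<Rightarrow> 'n symb" where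
  "homog_part deg d s =
     (\<Sum>u | u \<in> Poly_Mapping.keys s \<and> deg u = d. Poly_Mapping.single u (Poly_Mapping.lookup s u))"

abbreviation S_comp :: "nat \<Rightarrow> 'n symb set" where
  "S_comp \<equiv> homog ord_deg"

abbreviation P_comp :: "real \<Rightarrow> 'n symb set" where
  "P_comp \<equiv> homog heis_deg"

text \<open>
  The projections from \<open>ops_order k\<close> and \<open>ops_heis d\<close> onto the quotients by the next smaller
  filtration space, composed with the identification of the quotients with homogeneous polynomials.
\<close>

definition sigma :: "nat \<Rightarrow> 'n::{finite,linorder} operator \<Rightarrow> 'n symb" where
  "sigma k D = homog_part ord_deg k (full_symbol D)"

definition hsigma :: "real \<Rightarrow> 'n::{finite,linorder} operator \<Rightarrow> 'n symb" where
  "hsigma d D = homog_part heis_deg d (full_symbol D)"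

text \<open>
  The induced actions: on a homogeneous component, lift the symbol to the operator
  \<open>normal_op S\<close> representing its class, act, and project to the quotient again.
\<close>

definition lie_S ::
  "real \<Rightarrow> real \<Rightarrow> 'n::{finite,linorder} vfield \<Rightarrow> 'n symb \<Rightarrow> 'n symb" where
  "lie_S l m X s = (\<Sum>k\<in>ord_deg ` Poly_Mapping.keys s.
     sigma k (lie_op l m X (normal_op (homog_part ord_deg k s))))"

definition lie_P ::
  "real \<Rightarrow> real \<Rightarrow> 'n::{finite,linorder} vfield \<Rightarrow> 'n symb \<Rightarrow> 'n symb" where
  "lie_P l m X s = (\<Sum>d\<in>heis_deg ` Poly_Mapping.keys s.
     hsigma d (lie_op l m X (normal_op (homog_part heis_deg d s))))"


section \<open>Quantizations\<close>

text \<open>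
  Operators are plain functions, which form no instance of \<^class>\<open>real_vector\<close>; linearity of a
  map into operators is linearity of all its evaluations.
\<close>

definition linear_to_ops :: "('n symb \<Rightarrow> 'n operator) \<Rightarrow> bool" where
  "linear_to_ops Q \<longleftrightarrow> (\<forall>g. linear (\<lambda>s. Q s g))"

definition pgl_equivariant_quantization ::
  "real \<Rightarrow> real \<Rightarrow> ('n::{finite,linorder} symb \<Rightarrow> 'n operator) \<Rightarrow> bool" where
  "pgl_equivariant_quantization l m Q \<longleftrightarrow>
     linear_to_ops Q \<and> range Q \<subseteq> diff_ops
     \<and> (\<forall>X\<in>pgl. \<forall>S. lie_op l m X (Q S) = Q (lie_S l m X S))
     \<and> (\<forall>k. \<forall>S\<in>S_comp k. Q S \<in> ops_order k \<and> sigma k (Q S) = S)"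

definition fine_spo_equivariant_quantization ::
  "real \<Rightarrow> real \<Rightarrow> ('n::{finite,linorder} symb \<Rightarrow> 'n operator) \<Rightarrow> bool" where
  "fine_spo_equivariant_quantization l m Q \<longleftrightarrow>
     linear_to_ops Q \<and> bij_betw Q UNIV diff_ops
     \<and> (\<forall>d\<in>range (\<lambda>e::nat. real e / 2).
          Q ` P_comp d \<subseteq> ops_heis d \<and> (\<forall>S\<in>P_comp d. hsigma d (Q S) = S))
     \<and> (\<forall>X\<in>spo. \<forall>S. lie_op l m X (Q S) = Q (lie_P l m X S))"


section \<open>The map from fine symbols to symbols\<close>

definition d_zeta :: "'n::{finite,linorder} symb \<Rightarrow> 'n symb" where
  "d_zeta s = (\<Sum>(c, K)\<in>Poly_Mapping.keys s.
     Poly_Mapping.single (c - 1, K) (real c *\<^sub>R Poly_Mapping.lookup s (c, K)))"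

definition Dbar_coeffs :: "'n::{finite,linorder} \<Rightarrow> 'n symb \<Rightarrow> 'n symb" where
  "Dbar_coeffs i s = (\<Sum>u\<in>Poly_Mapping.keys s.
     Poly_Mapping.single u (Dbar i (Poly_Mapping.lookup s u)))"

text \<open>
  Left multiplication by \<open>\<gamma>\<^sub>i\<close>: moving \<open>\<gamma>\<^sub>i\<close> to the right of the coefficient \<open>A\<close> gives
  \<open>parity_inv A\<close>, and \<open>\<gamma>\<^sub>i \<gamma>\<^sup>K\<close> is \<open>0\<close> if \<open>i \<in> K\<close>.
\<close>

definition gamma_mult :: "'n::{finite,linorder} \<Rightarrow> 'n symb \<Rightarrow> 'n symb" where
  "gamma_mult i s = (\<Sum>(c, K) | (c, K) \<in> Poly_Mapping.keys s \<and> i \<notin> K.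
     Poly_Mapping.single (c, insert i K)
       (koszul {i} K *\<^sub>R parity_inv (Poly_Mapping.lookup s (c, K))))"

definition Delta :: "'n::{finite,linorder} symb \<Rightarrow> 'n symb" where
  "Delta s = (\<Sum>i\<in>UNIV. gamma_mult i (Dbar_coeffs i (d_zeta s)))"

text \<open>
  On the part of \<open>\<zeta>\<close>-degree \<open>c\<close>, only the terms with \<open>a \<le> c\<close> of the series are nonzero,
  so it is the finitely supported sum \<^const>\<open>Sum_any\<close>.
\<close>

definition SQ :: "real \<Rightarrow> 'n::{finite,linorder} symb \<Rightarrow> 'n symb" where
  "SQ \<delta> s = (\<Sum>c\<in>fst ` Poly_Mapping.keys s. Sum_any (\<lambda>a::nat.
     (1 / (2 ^ a * fact a) * (\<Prod>j<a. 1 / (real c - \<delta> - real j / 2)))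
       *\<^sub>R (Delta ^^ a) (homog_part fst c s)))"

definition I_crit :: "real set" where
  "I_crit = (\<Union>d::nat. {real_of_int (2 * c - j) / 2 | c j :: int.
     0 \<le> j \<and> j \<le> 2 * int d - 1 \<and> 0 \<le> c \<and> c \<le> int d})"

definition C_crit :: "real \<Rightarrow> real set" where
  "C_crit m = (\<Union>k::nat. {(2 * real k - real i + m) / 2 | i :: nat. 1 \<le> i \<and> i \<le> k})"

end

theory Submission
  imports Defs
begin

text \<open>
  Composing an operator with \<open>x\<close>, \<open>\<partial>\<^sub>x\<close>, \<open>\<theta>\<^sub>i\<close>, \<open>Dbar i\<close> on either side is given on full symbols by a polynomial in the
  operators \<open>\<zeta>\<close>, \<open>\<partial>\<^sub>\<zeta>\<close>, \<open>\<gamma>\<^sub>i\<close>, \<open>\<partial>\<^bsub>\<gamma>\<^sub>i\<^esub>\<close> and coefficient operators, so every Lie derivative is an explicit operator on symbols.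

  The odd fields \<open>X\<^bsub>\<theta>\<^sub>j\<^esub>\<close> and \<open>X\<^bsub>x \<theta>\<^sub>j\<^esub>\<close> generate \<open>spo(2|n)\<close>, so only these matter. For the second one the action on \<open>S\<^sub>\<delta>\<close>
  is \<open>L - \<onehalf> \<gamma>\<^sub>j \<partial>\<^sub>\<zeta>\<close>, where \<open>L\<close> is the action on \<open>P\<^sub>\<delta>\<close>, and \<open>[L, \<Delta>] = \<gamma>\<^sub>j \<partial>\<^sub>\<zeta> (\<zeta> \<partial>\<^sub>\<zeta> - \<delta>)\<close>; the coefficients of
  \<open>SQ\<close> solve the resulting recursion, whose denominators do not vanish because \<open>I_crit\<close> consists of all multiples of \<open>\<onehalf>\<close>.

  It remains to see that \<open>Qsl\<close> respects the Heisenberg filtration, for which its equivariance under affine fields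
  suffices. Equivariance under \<open>\<partial>\<^sub>x\<close>, \<open>x \<partial>\<^sub>x\<close>, \<open>\<theta>\<^sub>i \<partial>\<^bsub>\<theta>\<^sub>i\<^esub>\<close> shows that \<open>Qsl\<close> creates no \<open>\<gamma>\<close>-free terms of higher degree in \<open>\<zeta>\<close>, at
  first at \<open>\<theta> = 0\<close> and then everywhere by equivariance under \<open>X\<^bsub>\<theta>\<^sub>j\<^esub>\<close>. Equivariance under \<open>\<theta>\<^sub>j \<partial>\<^sub>x\<close>, which acts as
  \<open>\<theta>\<^sub>j \<partial>\<^sub>x + \<zeta> \<partial>\<^bsub>\<gamma>\<^sub>j\<^esub>\<close>, reduces the terms containing \<open>\<gamma>\<close>'s to these.
\<close>

section \<open>Calculus of superfunctions\<close>

text \<open>\<open>Qsl\<close> is known only through its characterising properties, and on symbols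
  it is merely a linear map: neither locality nor continuity in the coefficients is given.
  Injectivity of \<open>normal_op\<close> turns it into a map \<open>T\<close> of symbols with
  \<open>Qsl s = normal_op (T s)\<close>. Equivariance then becomes a list of commutation relations
  for \<open>T\<close>, and vanishing results about \<open>T\<close> are obtained algebraically,
  from weights and Hadamard's lemma. The obstacle is that two filtrations compete. Replacing a gamma
  by a zeta keeps the order but raises the Heisenberg order by 1/2, and projective fields may do
  exactly this. So compatibility of \<open>T\<close> with the order alone says nothing about the
  Heisenberg order. Conversely, gamma_j d_zeta keeps the order and lowers the Heisenberg order: it
  is part of the action on S_delta but invisible in P_delta. Compensating this term is the purpose
  of \<open>SQ\<close>. The shifts j/2 in its denominators come from averaging the zeta-degrees met
  while Delta lowers them one by one.\<close>

lemma koszul_singleton: "koszul {i} K = (-1) ^ card {k \<in> K. k < i}"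
proof -
  have "{(j, k). j \<in> {i} \<and> k \<in> K \<and> k < j} = Pair i ` {k \<in> K. k < i}" by auto
  then show ?thesis by (simp add: koszul_def card_image inj_on_def)
qed

lemma koszul_singleton_singleton: "koszul {i} {j} = (if j < i then -1 else 1)"
proof -
  have "{k \<in> {j}. k < i} = (if j < i then {j} else {})" by auto
  then show ?thesis by (simp add: koszul_singleton)
qed

lemma koszul_singleton_insert:
  fixes i j :: "'n::{finite,linorder}"
  assumes "j \<notin> K"
  shows "koszul {i} (insert j K) = (if j < i then - koszul {i} K else koszul {i} K)"
  using koszul_Un_right[of "{j}" K "{i}"] assms by (simp add: koszul_singleton_singleton)

lemma koszul_singleton_remove:
  fixes i j :: "'n::{finite,linorder}"
  assumes "j \<in> K"
  shows "koszul {i} (K - {j}) = (if j < i then - koszul {i} K else koszul {i} K)"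
  using koszul_singleton_insert[of j "K - {j}" i] assms by (simp add: insert_absorb split: if_splits)

lemma koszul_singleton_insert_self [simp]: "koszul {i} (insert i K) = koszul {i} K"
proof -
  have "{k \<in> insert i K. k < i} = {k \<in> K. k < i}" by auto
  then show ?thesis by (simp only: koszul_singleton)
qed

lemma koszul_singleton_remove_self [simp]: "koszul {i} (K - {i}) = koszul {i} K"
proof -
  have "{k \<in> K - {i}. k < i} = {k \<in> K. k < i}" by auto
  then show ?thesis by (simp only: koszul_singleton)
qed

lemma koszul_singleton_square [simp]: "koszul {i} K * koszul {i} K = 1"
  "koszul {i} K * (koszul {i} K * r) = r"
  by (simp_all add: koszul_singleton flip: power_add mult.assoc)

lemma koszul_singleton_cases: "koszul {i} K = 1 \<or> koszul {i} K = -1"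
  by (simp add: koszul_singleton) (metis neg_one_even_power neg_one_odd_power)

text \<open>Moving \<open>theta i\<close> from the right end of the monomial of \<open>J\<close> to
  its left end passes every factor, whence \<open>(-1) ^ card J\<close>. In counts: the elements of
  \<open>J\<close> above \<open>i\<close> and those below \<open>i\<close> exhaust
  \<open>J\<close>.\<close>

lemma koszul_right_singleton:
  fixes J :: "'n::{finite,linorder} set"
  assumes "i \<notin> J"
  shows "koszul J {i} = (-1) ^ card J * koszul {i} J"
proof -
  have "koszul J {i} = (-1) ^ card {j \<in> J. i < j}"
  proof -
    have "{(j, k). j \<in> J \<and> k \<in> {i} \<and> k < j} = (\<lambda>j. (j, i)) ` {j \<in> J. i < j}" by auto
    then show ?thesis by (simp add: koszul_def card_image inj_on_def)
  qed
  moreover have "card J = card {j \<in> J. i < j} + card {j \<in> J. j < i}"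
  proof -
    have "J = {j \<in> J. i < j} \<union> {j \<in> J. j < i}" using assms by (auto simp: not_less order_le_less)
    then show ?thesis by (metis (no_types, lifting) card_Un_disjoint disjoint_iff finite mem_Collect_eq order_less_asym)
  qed
  ultimately show ?thesis by (simp add: koszul_singleton power_add)
qed

section \<open>Derivations of the superalgebra, coefficient by coefficient\<close>

lemma coeff_simps [simp]:
  "coeff 0 I x = 0" "coeff (f + g) I x = coeff f I x + coeff g I x"
  "coeff (f - g) I x = coeff f I x - coeff g I x" "coeff (- f) I x = - coeff f I x"
  "coeff (r *\<^sub>R f) I x = r * coeff f I x"
  "coeff (parity_inv f) I x = (-1) ^ card I * coeff f I x"
  by (simp_all add: zero_superfun.rep_eq plus_superfun.rep_eq minus_superfun.rep_eq
      uminus_superfun.rep_eq scaleR_superfun.rep_eq parity_inv.rep_eq)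

lemma coeff_sum: "coeff (\<Sum>a\<in>A. f a) I x = (\<Sum>a\<in>A. coeff (f a) I x)"
  by (induction A rule: infinite_finite_induct) simp_all

lemma coeff_d_x: "coeff (d_x f) I = deriv (coeff f I)"
  by (simp add: d_x.rep_eq)

lemma coeff_has_derivative:
  "(coeff f I has_field_derivative coeff (d_x f) I x) (at x)"
  unfolding coeff_d_x
  using smooth_coeff[of f I] smooth_real_unfold by (blast intro: differentiable_imp_deriv)

lemma coeff_d_x_eqI:
  "(coeff f I has_field_derivative D) (at x) \<Longrightarrow> coeff (d_x f) I x = D"
  using coeff_has_derivative DERIV_unique by blast

lemma coeff_d_theta:
  "coeff (d_theta i f) I x = (if i \<in> I then 0 else koszul {i} I * coeff f (insert i I) x)"
  by (simp add: d_theta.rep_eq koszul_singleton)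

lemma coeff_theta_mult:
  "coeff (theta i * f) I x = (if i \<in> I then koszul {i} I * coeff f (I - {i}) x else 0)"
proof -
  have "coeff (theta i * f) I x =
      (\<Sum>J\<in>Pow I. if J = {i} then koszul {i} (I - {i}) * coeff f (I - {i}) x else 0)"
    unfolding times_superfun.rep_eq theta.rep_eq by (intro sum.cong) auto
  then show ?thesis by (simp add: sum.delta' )
qed

lemma coeff_x_mult: "coeff (x_coord * f) I x = x * coeff f I x"
proof -
  have "coeff (x_coord * f) I x = (\<Sum>J\<in>Pow I. if J = {} then x * coeff f I x else 0)"
    unfolding times_superfun.rep_eq x_coord.rep_eq by (intro sum.cong) auto
  then show ?thesis by (simp add: sum.delta' )
qed

lemma d_x_add [simp]: "d_x (f + g) = d_x f + d_x g"
  by (rule superfun_eqI, rule coeff_d_x_eqI)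
    (simp add: plus_superfun.rep_eq DERIV_add coeff_has_derivative)

lemma d_x_scaleR [simp]: "d_x (r *\<^sub>R f) = r *\<^sub>R d_x f"
  by (rule superfun_eqI, rule coeff_d_x_eqI)
    (simp add: scaleR_superfun.rep_eq DERIV_cmult coeff_has_derivative)

lemma linear_d_x: "linear d_x"
  by (rule linearI) simp_all

lemma linear_d_theta: "linear (d_theta i)"
  by (rule linearI; rule superfun_eqI) (auto simp: coeff_d_theta algebra_simps)

lemma linear_parity_inv: "linear parity_inv"
  by (rule linearI; rule superfun_eqI) (auto simp: algebra_simps)

lemma parity_inv_parity_inv [simp]: "parity_inv (parity_inv f) = f"
  by (rule superfun_eqI) (simp flip: mult.assoc power_add)

lemma d_x_mult: "d_x (f * g) = d_x f * g + f * d_x g"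
proof (rule superfun_eqI)
  fix I x
  have "(coeff (f * g) I has_field_derivative
      (\<Sum>J\<in>Pow I. koszul J (I - J) * (coeff (d_x f) J x * coeff g (I - J) x + coeff f J x * coeff (d_x g) (I - J) x))) (at x)"
    unfolding times_superfun.rep_eq
    by (intro DERIV_sum DERIV_cong[OF DERIV_mult'[OF DERIV_cmult[OF coeff_has_derivative] coeff_has_derivative]])
      (simp add: algebra_simps)
  then show "coeff (d_x (f * g)) I x = coeff (d_x f * g + f * d_x g) I x"
    by (simp add: coeff_d_x_eqI times_superfun.rep_eq sum.distrib algebra_simps)
qed

text \<open>The content is a comparison of Koszul signs: \<open>d_theta i\<close> deletes
  \<open>i\<close> from the first or from the second of two monomials, and in the second case it has
  to pass the first one.\<close>

lemma d_theta_mult: "d_theta i (f * g) = d_theta i f * g + parity_inv f * d_theta i g"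
proof (rule superfun_eqI)
  fix I x
  let ?p = "\<lambda>J. koszul J (I - J) * coeff (d_theta i f) J x * coeff g (I - J) x"
  let ?q = "\<lambda>J. koszul J (I - J) * coeff (parity_inv f) J x * coeff (d_theta i g) (I - J) x"
  show "coeff (d_theta i (f * g)) I x = coeff (d_theta i f * g + parity_inv f * d_theta i g) I x"
  proof (cases "i \<in> I")
    \<comment> \<open>Nothing in the image of \<open>d_theta i\<close> contains \<open>i\<close>, so
      the two sums on the right must cancel: the term of \<open>J\<close> in the first is opposite
      to the term of \<open>insert i J\<close> in the second.\<close>
    case True
    have "(\<Sum>J\<in>Pow I. ?p J) =
        (\<Sum>J\<in>Pow (I - {i}). ?p J)"
      by (rule sum.mono_neutral_right) (auto simp: coeff_d_theta)
    also have "\<dots> = (\<Sum>J\<in>Pow (I - {i}). koszul J (I - J) * (koszul {i} J * coeff f (insert i J) x) * coeff g (I - J) x)"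
      by (intro sum.cong) (auto simp: coeff_d_theta)
    also have "\<dots> = - (\<Sum>J\<in>{J \<in> Pow I. i \<in> J}. ?q J)"
    proof (subst sum_negf[symmetric], rule sum.reindex_bij_witness[of _ "\<lambda>J. J - {i}" "insert i"])
      fix J assume J: "J \<in> Pow (I - {i})"
      then have i: "i \<notin> J" by auto
      have IJ: "I - J = insert i (I - insert i J)" using J True by auto
      have "koszul J (I - J) = koszul J {i} * koszul J (I - insert i J)"
        using koszul_Un_right[of "{i}" "I - insert i J" J] by (simp add: IJ[symmetric])
      moreover have "koszul (insert i J) (I - insert i J) = koszul {i} (I - insert i J) * koszul J (I - insert i J)"
        using koszul_Un_left[of "{i}" J "I - insert i J"] i by simp
      ultimately show "- (koszul (insert i J) (I - insert i J) * coeff (parity_inv f) (insert i J) x * coeff (d_theta i g) (I - insert i J) x)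
        = koszul J (I - J) * (koszul {i} J * coeff f (insert i J) x) * coeff g (I - J) x"
        using i by (simp add: koszul_right_singleton coeff_d_theta IJ[symmetric])
    qed (use True in auto)
    also have "(\<Sum>J\<in>{J \<in> Pow I. i \<in> J}. ?q J)
        = (\<Sum>J\<in>Pow I. ?q J)"
      by (rule sum.mono_neutral_left) (auto simp: True coeff_d_theta)
    finally show ?thesis using True by (simp add: coeff_d_theta times_superfun.rep_eq)
  next
    case False
    let ?t = "\<lambda>J. koszul {i} I * (koszul J (insert i I - J) * coeff f J x * coeff g (insert i I - J) x)"
    \<comment> \<open>Subsets \<open>J\<close> without \<open>i\<close> give the terms in which
      \<open>d_theta i\<close> acts on \<open>g\<close>, those containing \<open>i\<close> the terms
      in which it acts on \<open>f\<close>.\<close>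
    have "Pow (insert i I) = Pow I \<union> insert i ` Pow I" by (simp add: Pow_insert)
    then have "coeff (d_theta i (f * g)) I x = (\<Sum>J\<in>Pow I \<union> insert i ` Pow I. ?t J)"
      using False by (simp add: coeff_d_theta times_superfun.rep_eq sum_distrib_left)
    also have "\<dots> = (\<Sum>J\<in>Pow I. ?t J) + (\<Sum>J\<in>insert i ` Pow I. ?t J)"
      using False by (intro sum.union_disjoint) auto
    also have "(\<Sum>J\<in>insert i ` Pow I. ?t J) = (\<Sum>J\<in>Pow I. ?t (insert i J))"
      using False by (subst sum.reindex) (auto simp: inj_on_def o_def)
    also have "\<dots> = coeff (d_theta i f * g) I x"
      unfolding times_superfun.rep_eq
    proof (rule sum.cong[OF refl])
      fix J assume "J \<in> Pow I"
      then have J: "i \<notin> J" "insert i I - insert i J = I - J" "I = J \<union> (I - J)" using False by auto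
      have "koszul (insert i J) (I - J) = koszul {i} (I - J) * koszul J (I - J)"
        using koszul_Un_left[of "{i}" J "I - J"] J by simp
      moreover have "koszul {i} I = koszul {i} J * koszul {i} (I - J)"
        using koszul_Un_right[of J "I - J" "{i}"] J by simp
      ultimately show "?t (insert i J) = ?p J"
        using J(1) by (simp add: coeff_d_theta J(2))
    qed
    also have "(\<Sum>J\<in>Pow I. ?t J) = coeff (parity_inv f * d_theta i g) I x"
      unfolding times_superfun.rep_eq
    proof (rule sum.cong[OF refl])
      fix J assume "J \<in> Pow I"
      then have J: "i \<notin> J" "i \<notin> I - J" "insert i I - J = insert i (I - J)" "I = J \<union> (I - J)" using False by auto
      have "koszul J (insert i (I - J)) = koszul J {i} * koszul J (I - J)"
        using koszul_Un_right[of "{i}" "I - J" J] J by simp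
      moreover have "koszul {i} I = koszul {i} J * koszul {i} (I - J)"
        using koszul_Un_right[of J "I - J" "{i}"] J by simp
      ultimately show "?t J = ?q J"
        using J(1,2) by (simp add: coeff_d_theta koszul_right_singleton J(3))
    qed
    finally show ?thesis by simp
  qed
qed

lemma parity_inv_mult: "parity_inv (f * g) = parity_inv f * parity_inv g"
proof (rule superfun_eqI)
  fix I x
  have "coeff (parity_inv (f * g)) I x = (\<Sum>J\<in>Pow I. (-1) ^ card I * (koszul J (I - J) * coeff f J x * coeff g (I - J) x))"
    by (simp add: times_superfun.rep_eq sum_distrib_left)
  also have "\<dots> = coeff (parity_inv f * parity_inv g) I x"
    unfolding times_superfun.rep_eq
  proof (rule sum.cong[OF refl])
    fix J assume "J \<in> Pow I"
    then have "card I = card J + card (I - J)"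
      by (metis PowD card_Diff_subset card_mono finite le_add_diff_inverse)
    then show "(-1) ^ card I * (koszul J (I - J) * coeff f J x * coeff g (I - J) x) =
      koszul J (I - J) * coeff (parity_inv f) J x * coeff (parity_inv g) (I - J) x"
      by (simp add: power_add)
  qed
  finally show "coeff (parity_inv (f * g)) I x = coeff (parity_inv f * parity_inv g) I x" .
qed

lemma parity_inv_theta [simp]: "parity_inv (theta i) = - theta i"
  by (rule superfun_eqI) (auto simp: theta.rep_eq)

lemma parity_inv_x [simp]: "parity_inv x_coord = x_coord"
  by (rule superfun_eqI) (auto simp: x_coord.rep_eq)

lemma parity_inv_one [simp]: "parity_inv 1 = 1"
  by (rule superfun_eqI) (auto simp: one_superfun.rep_eq)

lemma parity_inv_d_x: "parity_inv (d_x f) = d_x (parity_inv f)"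
  by (rule superfun_eqI, rule coeff_d_x_eqI[symmetric])
    (simp add: parity_inv.rep_eq DERIV_cmult coeff_has_derivative)

lemma parity_inv_d_theta: "parity_inv (d_theta i f) = - d_theta i (parity_inv f)"
  for f :: "'n::{finite,linorder} superfun"
  by (rule superfun_eqI) (simp add: coeff_d_theta power_Suc)

lemma d_x_d_theta: "d_x (d_theta i f) = d_theta i (d_x f)"
proof (rule superfun_eqI, rule coeff_d_x_eqI)
  fix I x
  have "coeff (d_theta i f) I = (\<lambda>x. (if i \<in> I then 0 else koszul {i} I) * coeff f (insert i I) x)"
    by (simp add: coeff_d_theta fun_eq_iff)
  then show "(coeff (d_theta i f) I has_field_derivative coeff (d_theta i (d_x f)) I x) (at x)"
    using DERIV_cmult[OF coeff_has_derivative[of f "insert i I" x], of "if i \<in> I then 0 else koszul {i} I"]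
    by (cases "i \<in> I") (simp_all add: coeff_d_theta)
qed

lemma d_theta_anticommute: "d_theta i (d_theta j f) = - d_theta j (d_theta i f)"
  for f :: "'n::{finite,linorder} superfun"
proof (rule superfun_eqI)
  fix I x
  show "coeff (d_theta i (d_theta j f)) I x = coeff (- d_theta j (d_theta i f)) I x"
    by (cases "i = j") (auto simp: coeff_d_theta koszul_singleton_insert insert_commute[of i j])
qed

lemma d_theta_theta: "d_theta i (theta j) = (if i = j then 1 else 0)"
  by (rule superfun_eqI) (auto simp: coeff_d_theta theta.rep_eq one_superfun.rep_eq koszul_singleton)

lemma d_theta_x [simp]: "d_theta i x_coord = 0"
  by (rule superfun_eqI) (auto simp: coeff_d_theta x_coord.rep_eq)

lemma d_theta_one [simp]: "d_theta i 1 = 0"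
  by (rule superfun_eqI) (auto simp: coeff_d_theta one_superfun.rep_eq)

lemma d_x_theta [simp]: "d_x (theta i) = 0"
  by (rule superfun_eqI, rule coeff_d_x_eqI) (simp add: theta.rep_eq)

lemma d_x_one [simp]: "d_x 1 = 0"
  by (rule superfun_eqI, rule coeff_d_x_eqI) (simp add: one_superfun.rep_eq)

lemma d_x_x [simp]: "d_x x_coord = 1"
  by (rule superfun_eqI, rule coeff_d_x_eqI)
    (simp add: x_coord.rep_eq one_superfun.rep_eq)

lemma mult_theta_right: "f * theta i = theta i * parity_inv f"
proof (rule superfun_eqI)
  fix I x
  have "coeff (f * theta i) I x =
      (\<Sum>J\<in>Pow I. if J = I - {i} then (if i \<in> I then koszul (I - {i}) {i} * coeff f (I - {i}) x else 0) else 0)"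
    unfolding times_superfun.rep_eq theta.rep_eq
    by (intro sum.cong) (auto simp: double_diff)
  also have "\<dots> = (if i \<in> I then koszul (I - {i}) {i} * coeff f (I - {i}) x else 0)"
    by (subst sum.delta) auto
  finally show "coeff (f * theta i) I x = coeff (theta i * parity_inv f) I x"
    by (simp add: coeff_theta_mult koszul_right_singleton)
qed

lemma theta_theta: "theta i * theta j = - (theta j * theta i)"
  by (simp add: mult_theta_right[of "theta i" j])

lemma theta_theta_left: "theta i * (theta j * f) = - (theta j * (theta i * f))"
proof -
  have "theta i * theta j * f = - (theta j * theta i) * f" by (simp only: theta_theta[of i j])
  then show ?thesis by (simp add: mult.assoc)
qed

lemma theta_square [simp]: "theta i * theta i = 0"
proof -
  have "2 *\<^sub>R (theta i * theta i) = 0" using theta_theta[of i i] by (simp add: scaleR_2 eq_neg_iff_add_eq_0)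
  then show ?thesis by simp
qed

lemma theta_square_left [simp]: "theta i * (theta i * f) = 0"
proof -
  have "theta i * theta i * f = 0" by simp
  then show ?thesis by (simp only: mult.assoc)
qed

lemma x_commute: "f * x_coord = x_coord * f"
proof (rule superfun_eqI)
  fix I x
  have "coeff (f * x_coord) I x = (\<Sum>J\<in>Pow I. if J = I then coeff f I x * x else 0)"
    unfolding times_superfun.rep_eq x_coord.rep_eq by (intro sum.cong) auto
  then show "coeff (f * x_coord) I x = coeff (x_coord * f) I x"
    by (simp add: coeff_x_mult)
qed

lemma theta_x: "theta i * x_coord = x_coord * theta i" "theta i * (x_coord * f) = x_coord * (theta i * f)"
  by (simp_all add: x_commute[of "theta i"] flip: mult.assoc)

lemma Dbar_eq: "Dbar i f = d_theta i f - theta i * d_x f"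
  unfolding Dbar_def vf_apply_def Dbar_field_def
  by (simp add: vf_mult_def axis_def if_distrib[of "\<lambda>z. z * _"] algebra_simps cong: if_cong)

lemma linear_Dbar: "linear (Dbar i)"
  by (rule linearI) (simp_all add: Dbar_eq linear_add[OF linear_d_theta] linear_scale[OF linear_d_theta] algebra_simps)

lemma Dbar_mult: "Dbar i (f * g) = Dbar i f * g + parity_inv f * Dbar i g"
proof -
  have "theta i * (f * d_x g) = parity_inv f * (theta i * d_x g)"
    using mult_theta_right[of "parity_inv f" i] by (simp flip: mult.assoc)
  then show ?thesis
    by (simp add: Dbar_eq d_theta_mult d_x_mult algebra_simps)
qed

lemma d_x_Dbar: "d_x (Dbar i f) = Dbar i (d_x f)"
  by (simp add: Dbar_eq d_x_d_theta linear_diff[OF linear_d_x] d_x_mult)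

lemma parity_inv_Dbar: "parity_inv (Dbar i f) = - Dbar i (parity_inv f)"
  by (simp add: Dbar_eq linear_diff[OF linear_parity_inv] parity_inv_mult parity_inv_d_theta parity_inv_d_x)

lemma Dbar_theta: "Dbar i (theta j) = (if i = j then 1 else 0)"
  by (simp add: Dbar_eq d_theta_theta)

lemma Dbar_x: "Dbar i x_coord = - theta i"
  by (simp add: Dbar_eq)

text \<open>In the expansion of \<open>Dbar i (Dbar j f)\<close> everything except the
  \<open>- d_x f\<close> of the case \<open>i = j\<close> is antisymmetric in \<open>i\<close> and
  \<open>j\<close>, so it cancels against the swapped expansion.\<close>

lemma Dbar_Dbar: "Dbar i (Dbar j f) = (if i = j then -2 *\<^sub>R d_x f else 0) - Dbar j (Dbar i f)"
proof -
  have *: "Dbar i (Dbar j f) = d_theta i (d_theta j f) - (if i = j then d_x f else 0)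
       + theta j * d_theta i (d_x f) - theta i * d_theta j (d_x f) + theta i * (theta j * d_x (d_x f))" for i j
    by (auto simp: Dbar_eq linear_diff[OF linear_d_theta] linear_diff[OF linear_d_x] d_theta_mult
       d_theta_theta d_x_mult d_x_d_theta algebra_simps)
  show ?thesis
    unfolding *[of i j] *[of j i]
    using d_theta_anticommute[of i j f] theta_theta_left[of i j "d_x (d_x f)"]
    by (simp add: scaleR_2 algebra_simps)
qed

lemma Dbar_Dbar_same: "Dbar i (Dbar i f) = - d_x f"
proof -
  have "2 *\<^sub>R Dbar i (Dbar i f) = 2 *\<^sub>R (- d_x f)"
    using Dbar_Dbar[of i i f] by (simp add: scaleR_2 eq_diff_eq)
  then show ?thesis by (rule scaleR_left_imp_eq[rotated]) simp
qed

section \<open>Operators on symbols\<close>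

abbreviation "lookup \<equiv> Poly_Mapping.lookup"
abbreviation "single \<equiv> Poly_Mapping.single"
abbreviation "keys \<equiv> Poly_Mapping.keys"

lemma lookup_scaleR [simp]: "lookup (r *\<^sub>R s) u = r *\<^sub>R lookup s u"
proof -
  have "{i. r *\<^sub>R lookup s i \<noteq> 0} \<subseteq> {i. lookup s i \<noteq> 0}" by auto
  then have "finite {i. r *\<^sub>R lookup s i \<noteq> 0}" by (rule finite_subset) simp
  then show ?thesis by (simp add: scaleR_poly_mapping_def)
qed

lemma sum_single_lookup: "(\<Sum>u\<in>keys s. single u (lookup s u)) = s"
  by (rule poly_mapping_eqI)
    (simp add: lookup_sum lookup_single when_def in_keys_iff)

lemma linear_eq_on_singles:
  fixes f g :: "'n symb \<Rightarrow> 'b::real_vector"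
  assumes "linear f" "linear g" "\<And>c K A. f (single (c, K) A) = g (single (c, K) A)"
  shows "f s = g s"
proof -
  have "f (\<Sum>u\<in>keys s. single u (lookup s u)) =
    g (\<Sum>u\<in>keys s. single u (lookup s u))"
    using assms(3) by (simp add: linear_sum[OF assms(1)] linear_sum[OF assms(2)] split_paired_all)
  then show ?thesis by (simp add: sum_single_lookup)
qed

lemmas superfun_maps = linear_d_x linear_Dbar linear_parity_inv

lemmas superfun_maps_linear [simp] = superfun_maps[THEN linear_0] superfun_maps[THEN linear_neg]
  superfun_maps[THEN linear_diff] superfun_maps(2,3)[THEN linear_add] superfun_maps(2,3)[THEN linear_scale]

lemmas d_x_sum = linear_sum[OF linear_d_x]
lemmas Dbar_sum = linear_sum[OF linear_Dbar]
lemmas parity_inv_sum = linear_sum[OF linear_parity_inv]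

text \<open>\<open>Poly_Mapping.map\<close> leaves zero coefficients at zero, so this is the
  coefficientwise application of \<open>F\<close> only when \<open>F 0 = 0\<close>, which holds for
  the linear maps to which it is applied.\<close>

definition coeff_map :: "('n superfun \<Rightarrow> 'n superfun) \<Rightarrow> 'n symb \<Rightarrow> 'n symb" where
  "coeff_map F = Poly_Mapping.map F"

lemma lookup_coeff_map: "F 0 = 0 \<Longrightarrow> lookup (coeff_map F s) u = F (lookup s u)"
  by (simp add: coeff_map_def Poly_Mapping.map.rep_eq when_def)

definition zeta_mult :: "'n symb \<Rightarrow> 'n symb" where
  "zeta_mult s = (\<Sum>(c, K)\<in>keys s. single (Suc c, K) (lookup s (c, K)))"

text \<open>The left derivative with respect to \<open>\<gamma>\<^sub>i\<close>, with the sign rule of \<^const>\<open>gamma_mult\<close>.\<close>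

definition gamma_diff :: "'n::{finite,linorder} \<Rightarrow> 'n symb \<Rightarrow> 'n symb" where
  "gamma_diff i s = (\<Sum>(c, K) | (c, K) \<in> keys s \<and> i \<in> K.
     single (c, K - {i}) (koszul {i} K *\<^sub>R parity_inv (lookup s (c, K))))"

text \<open>It combines the parity of the coefficients with that of the gammas, so on operators it
  becomes conjugation by \<open>parity_inv\<close>. This is how the sign \<open>(-1)^|D|\<close> in
  the Lie derivative along an odd field is expressed.\<close>

definition symb_parity :: "'n symb \<Rightarrow> 'n symb" where
  "symb_parity s = (\<Sum>(c, K)\<in>keys s.
     single (c, K) ((-1) ^ card K *\<^sub>R parity_inv (lookup s (c, K))))"

lemma lookup_zeta_mult:
  "lookup (zeta_mult s) (c, K) = (if c = 0 then 0 else lookup s (c - 1, K))"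
proof -
  have "lookup (zeta_mult s) (c, K) =
    (\<Sum>u\<in>keys s. if u = (c - 1, K) then (if c = 0 then 0 else lookup s (c - 1, K)) else 0)"
    unfolding zeta_mult_def lookup_sum
    by (rule sum.cong[OF refl]) (auto simp: lookup_single when_def split: if_splits)
  then show ?thesis by (simp add: in_keys_iff)
qed

lemma lookup_gamma_diff:
  "lookup (gamma_diff i s) (c, K) =
    (if i \<in> K then 0 else koszul {i} K *\<^sub>R parity_inv (lookup s (c, insert i K)))" (is "_ = ?r")
proof -
  let ?A = "{(c, K). (c, K) \<in> keys s \<and> i \<in> K}"
  have fin: "finite ?A" by (rule finite_subset[of _ "keys s"]) auto
  have "lookup (gamma_diff i s) (c, K) =
    (\<Sum>u\<in>?A. if u = (c, insert i K) then ?r else 0)"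
    unfolding gamma_diff_def lookup_sum
  proof (rule sum.cong[OF refl])
    fix u assume "u \<in> ?A"
    then obtain c' K' where u: "u = (c', K')" and i: "i \<in> K'" by auto
    have "K' - {i} = K \<longleftrightarrow> i \<notin> K \<and> K' = insert i K" using i by blast
    then show "lookup (case u of (c, K) \<Rightarrow> single (c, K - {i}) (koszul {i} K *\<^sub>R parity_inv (lookup s (c, K)))) (c, K)
      = (if u = (c, insert i K) then ?r else 0)"
      by (cases "c' = c"; cases "i \<in> K"; cases "K' = insert i K") (simp_all add: u lookup_single when_def)
  qed
  then show ?thesis using fin by (cases "i \<in> K") (simp_all add: in_keys_iff)
qed

lemma lookup_symb_parity:
  "lookup (symb_parity s) (c, K) = (-1) ^ card K *\<^sub>R parity_inv (lookup s (c, K))"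
proof -
  have "lookup (symb_parity s) (c, K) =
    (\<Sum>u\<in>keys s. if u = (c, K) then (-1) ^ card K *\<^sub>R parity_inv (lookup s (c, K)) else 0)"
    unfolding symb_parity_def lookup_sum
    by (rule sum.cong[OF refl]) (auto simp: lookup_single when_def split: if_splits)
  then show ?thesis by (simp add: in_keys_iff)
qed

lemma lookup_d_zeta:
  "lookup (d_zeta s) (c, K) = real (Suc c) *\<^sub>R lookup s (Suc c, K)"
proof -
  have "lookup (d_zeta s) (c, K) =
    (\<Sum>u\<in>keys s. if u = (Suc c, K) then real (Suc c) *\<^sub>R lookup s (Suc c, K) else 0)"
    unfolding d_zeta_def lookup_sum
  proof (rule sum.cong[OF refl])
    fix u assume "u \<in> keys s"
    show "lookup (case u of (c, K) \<Rightarrow> single (c - 1, K) (real c *\<^sub>R lookup s (c, K))) (c, K)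
      = (if u = (Suc c, K) then real (Suc c) *\<^sub>R lookup s (Suc c, K) else 0)"
      by (cases u; cases "fst u") (auto simp: lookup_single when_def)
  qed
  then show ?thesis by (simp add: in_keys_iff)
qed

lemma lookup_Dbar_coeffs: "lookup (Dbar_coeffs i s) u = Dbar i (lookup s u)"
  by (simp add: Dbar_coeffs_def lookup_sum lookup_single when_def in_keys_iff)

lemma lookup_gamma_mult:
  "lookup (gamma_mult i s) (c, K) =
    (if i \<in> K then koszul {i} K *\<^sub>R parity_inv (lookup s (c, K - {i})) else 0)" (is "_ = ?r")
proof -
  let ?A = "{(c, K). (c, K) \<in> keys s \<and> i \<notin> K}"
  have fin: "finite ?A" by (rule finite_subset[of _ "keys s"]) auto
  have "lookup (gamma_mult i s) (c, K) =
    (\<Sum>u\<in>?A. if u = (c, K - {i}) then ?r else 0)"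
    unfolding gamma_mult_def lookup_sum
  proof (rule sum.cong[OF refl])
    fix u assume "u \<in> ?A"
    then obtain c' K' where u: "u = (c', K')" and i: "i \<notin> K'" by auto
    have "insert i K' = K \<longleftrightarrow> i \<in> K \<and> K' = K - {i}" using i by blast
    then show "lookup (case u of (c, K) \<Rightarrow> single (c, insert i K) (koszul {i} K *\<^sub>R parity_inv (lookup s (c, K)))) (c, K)
      = (if u = (c, K - {i}) then ?r else 0)"
      by (cases "c' = c"; cases "i \<in> K"; cases "K' = K - {i}") (simp_all add: u lookup_single when_def)
  qed
  then show ?thesis using fin by (cases "i \<in> K") (simp_all add: in_keys_iff)
qed

lemmas lookups = lookup_zeta_mult lookup_gamma_diff lookup_symb_parity lookup_d_zeta
  lookup_Dbar_coeffs lookup_gamma_mult lookup_coeff_map lookup_add lookup_minus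

lemma linear_coeff_map: "linear F \<Longrightarrow> linear (coeff_map F)"
  by (rule linearI; rule poly_mapping_eqI) (simp_all add: lookups linear_0 linear_add linear_scale)

lemma linear_mult_left: "linear ((*) (f :: 'n::{finite,linorder} superfun))"
  by (rule linearI) (simp_all add: algebra_simps)

lemmas linear_coeff_mult = linear_coeff_map[OF linear_mult_left]

lemma linear_symb_ops: "linear zeta_mult" "linear (gamma_diff i)" "linear (gamma_mult i)"
  "linear symb_parity" "linear d_zeta"
  by (rule linearI; rule poly_mapping_eqI; auto simp: lookups split_paired_all algebra_simps)+

lemma linear_Dbar_coeffs: "linear (Dbar_coeffs i)"
  by (rule linearI; rule poly_mapping_eqI) (auto simp: lookups)

lemma Dbar_coeffs_eq_coeff_map: "Dbar_coeffs i = coeff_map (Dbar i)"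
  by (rule ext, rule poly_mapping_eqI) (simp add: lookups)

section \<open>Normal ordering\<close>

lemma normal_op_superset:
  assumes "finite A" "keys s \<subseteq> A"
  shows "normal_op s g = (\<Sum>(c, K)\<in>A. lookup s (c, K) * (d_x ^^ c) (Dbar_power K g))"
  unfolding normal_op_def
  by (rule sum.mono_neutral_left[OF assms]) (auto simp: in_keys_iff)

lemma linear_normal_op: "linear (\<lambda>s. normal_op s g)"
proof (rule linearI)
  fix s t :: "'a symb" and r :: real
  let ?A = "keys s \<union> keys t"
  have fin: "finite ?A" by simp
  show "normal_op (s + t) g = normal_op s g + normal_op t g"
    using Poly_Mapping.keys_add[of s t]
    by (simp add: normal_op_superset[OF fin, of "s + t"] normal_op_superset[OF fin, of s]
        normal_op_superset[OF fin, of t] lookup_add sum.distrib[symmetric] algebra_simps case_prod_unfold)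
  have "keys (r *\<^sub>R s) \<subseteq> keys s" by (auto simp: in_keys_iff)
  then show "normal_op (r *\<^sub>R s) g = r *\<^sub>R normal_op s g"
    by (simp add: normal_op_superset[of "keys s"] scaleR_right.sum case_prod_unfold)
qed

lemmas normal_op_add = linear_add[OF linear_normal_op]
lemmas normal_op_diff = linear_diff[OF linear_normal_op]
lemmas normal_op_scaleR = linear_scale[OF linear_normal_op]
lemmas normal_op_minus = linear_neg[OF linear_normal_op]
lemmas normal_op_zero = linear_0[OF linear_normal_op]
lemmas normal_op_sum = linear_sum[OF linear_normal_op]

lemma normal_op_single [simp]:
  "normal_op (single (c, K) A) g = A * (d_x ^^ c) (Dbar_power K g)"
  by (simp add: normal_op_superset[of "{(c, K)}"] keys_single lookup_single)

lemma funpow_d_x_add: "(d_x ^^ c) (f + g) = (d_x ^^ c) f + (d_x ^^ c) g"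
  by (induction c) simp_all

lemma funpow_d_x_scaleR: "(d_x ^^ c) (r *\<^sub>R f) = r *\<^sub>R (d_x ^^ c) f"
  by (induction c) simp_all

lemma linear_funpow_d_x: "linear (d_x ^^ c)"
  by (rule linearI) (simp_all add: funpow_d_x_add funpow_d_x_scaleR)

lemma linear_foldr_Dbar: "linear (foldr Dbar is)"
proof (induction "is")
  case Nil
  show ?case by (simp add: linear_iff)
next
  case (Cons i "is")
  show ?case using linear_compose[OF Cons linear_Dbar] by (simp add: comp_def)
qed

section \<open>Ordered products of the \<open>Dbar i\<close>\<close>

lemma linear_Dbar_power: "linear (Dbar_power K)"
  by (simp add: Dbar_power_def linear_foldr_Dbar)

lemma Dbar_power_empty [simp]: "Dbar_power {} g = g"
  by (simp add: Dbar_power_def)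

lemma Dbar_power_insert_Min:
  "(\<And>k. k \<in> K \<Longrightarrow> i < k) \<Longrightarrow> Dbar_power (insert i K) g = Dbar i (Dbar_power K g)"
proof -
  assume *: "\<And>k. k \<in> K \<Longrightarrow> i < k"
  then have "i \<notin> K" by blast
  then have "sorted_list_of_set (insert i K) = insort i (sorted_list_of_set K)" by simp
  also have "\<dots> = i # sorted_list_of_set K"
    by (rule insort_is_Cons) (use * in \<open>auto intro: less_imp_le\<close>)
  finally show ?thesis by (simp add: Dbar_power_def)
qed

text \<open>Each new element lies below all present ones, hence becomes the leftmost factor of
  \<open>Dbar_power\<close>; no reordering sign arises in the induction steps.\<close>

lemma finite_set_less_induct [case_names empty insert]:
  fixes K :: "'n::{finite,linorder} set"
  assumes "P {}" "\<And>m K. (\<And>k. k \<in> K \<Longrightarrow> m < k) \<Longrightarrow> P K \<Longrightarrow> P (insert m K)"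
  shows "P K"
proof (induction "card K" arbitrary: K)
  case (Suc n)
  then have ne: "K \<noteq> {}" by auto
  let ?m = "Min K"
  have "P (insert ?m (K - {?m}))"
  proof (rule assms(2))
    show "?m < k" if "k \<in> K - {?m}" for k
      using that Min_le[of K k] by (auto simp: order_le_less)
    show "P (K - {?m})" using Suc ne by (intro Suc(1)) simp
  qed
  then show ?case using ne by (simp add: insert_absorb)
qed (use assms(1) in simp)

lemma koszul_singleton_below:
  assumes "\<And>k. k \<in> K \<Longrightarrow> i < k"
  shows "koszul {i} K = 1"
proof -
  have "{k \<in> K. k < i} = {}"
  proof (rule equals0I)
    fix k assume "k \<in> {k \<in> K. k < i}"
    then have "i < k" "k < i" using assms[of k] by simp_all
    then show False by (rule order_less_asym)
  qed
  then show ?thesis by (simp only: koszul_singleton card.empty power_0)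
qed

text \<open>\<open>Dbar i\<close> anticommutes past the factors with smaller index, which gives the
  Koszul sign. It then either takes its place in the product or meets itself, where its square is
  \<open>- d_x\<close>.\<close>

lemma Dbar_Dbar_power:
  fixes i :: "'n::{finite,linorder}"
  shows "Dbar i (Dbar_power K g) = koszul {i} K *\<^sub>R
    (if i \<in> K then - d_x (Dbar_power (K - {i}) g) else Dbar_power (insert i K) g)"
proof (induction K rule: finite_set_less_induct)
  case empty
  show ?case using Dbar_power_insert_Min[of "{}" i g] by simp
next
  case (insert m K)
  then have m: "m \<notin> K" by blast
  consider "i < m" | "i = m" | "m < i" by fastforce
  then show ?case
  proof cases
    case 1
    then have *: "\<And>k. k \<in> insert m K \<Longrightarrow> i < k" using insert(1) by (auto intro: order_less_trans)
    then have "i \<notin> insert m K" by blast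
    then show ?thesis
      by (simp only: Dbar_power_insert_Min[OF *] koszul_singleton_below[OF *] if_False scaleR_one)
  next
    case 2
    then show ?thesis using insert(1) m
      by (simp add: Dbar_power_insert_Min koszul_singleton_below Dbar_Dbar_same)
  next
    case 3
    then have "i \<noteq> m" by simp
    have "Dbar i (Dbar_power (insert m K) g) = - Dbar m (Dbar i (Dbar_power K g))"
      using \<open>i \<noteq> m\<close> insert(1) by (simp add: Dbar_power_insert_Min Dbar_Dbar[of i m])
    also have "\<dots> = - koszul {i} K *\<^sub>R (if i \<in> K then - d_x (Dbar m (Dbar_power (K - {i}) g)) else Dbar m (Dbar_power (insert i K) g))"
      by (simp add: insert(2) d_x_Dbar)
    also have "\<dots> = koszul {i} (insert m K) *\<^sub>R (if i \<in> insert m K then - d_x (Dbar_power (insert m (K - {i})) g) else Dbar_power (insert m (insert i K)) g)"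
    proof -
      have "Dbar m (Dbar_power (K - {i}) g) = Dbar_power (insert m (K - {i})) g"
        by (rule Dbar_power_insert_Min[symmetric]) (use insert(1) in auto)
      moreover have "Dbar m (Dbar_power (insert i K) g) = Dbar_power (insert m (insert i K)) g"
        by (rule Dbar_power_insert_Min[symmetric]) (use insert(1) 3 in auto)
      ultimately show ?thesis
        using 3 m \<open>i \<noteq> m\<close> by (simp add: koszul_singleton_insert)
    qed
    finally show ?thesis using \<open>i \<noteq> m\<close> by (simp add: insert_commute insert_Diff_if)
  qed
qed

text \<open>All factors with another index anticommute with \<open>Dbar j\<close>, while a factor
  \<open>Dbar j\<close> commutes with itself: this is the extra minus sign for
  \<open>j \<in> K\<close>.\<close>

lemma Dbar_power_Dbar:
  fixes j :: "'n::{finite,linorder}"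
  shows "Dbar_power K (Dbar j g) = (-1) ^ card K *\<^sub>R (if j \<in> K then - Dbar j (Dbar_power K g) else Dbar j (Dbar_power K g))"
proof (induction K rule: finite_set_less_induct)
  case (insert m K)
  then have "m \<notin> K" by blast
  with insert show ?case
    by (cases "m = j") (auto simp: Dbar_power_insert_Min Dbar_Dbar[of m j] Dbar_Dbar_same)
qed simp

lemma Dbar_power_theta_mult:
  fixes j :: "'n::{finite,linorder}"
  shows "Dbar_power K (theta j * g) = (-1) ^ card K *\<^sub>R
    (theta j * Dbar_power K g - (if j \<in> K then koszul {j} K *\<^sub>R Dbar_power (K - {j}) g else 0))"
proof (induction K rule: finite_set_less_induct)
  case (insert m K)
  then have m: "m \<notin> K" by blast
  have *: "Dbar_power (insert m K) (theta j * g) = (-1) ^ card K *\<^sub>R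
     ((if m = j then Dbar_power K g else 0) - theta j * Dbar_power (insert m K) g
       - (if j \<in> K then koszul {j} K *\<^sub>R Dbar m (Dbar_power (K - {j}) g) else 0))"
    using insert by (simp add: Dbar_power_insert_Min Dbar_mult Dbar_theta)
  show ?case
  proof (cases "j = m")
    case True
    then show ?thesis
      unfolding * using m by (simp add: koszul_singleton_below[OF insert(1)] scaleR_diff_right)
  next
    case False
    have "Dbar m (Dbar_power (K - {j}) g) = Dbar_power (insert m (K - {j})) g"
      by (rule Dbar_power_insert_Min[symmetric]) (use insert(1) in auto)
    moreover have "koszul {j} (insert m K) = - koszul {j} K" if "j \<in> K"
      using insert(1)[OF that] m by (simp add: koszul_singleton_insert)
    moreover have "insert m K - {j} = insert m (K - {j})" using False by auto
    ultimately show ?thesis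
      unfolding * using m False by (simp add: scaleR_diff_right)
  qed
qed simp

text \<open>Since \<open>Dbar i x_coord = - theta i\<close>, every factor of the product can hit
  \<open>x_coord\<close>; the factors with other indices annihilate the resulting
  \<open>theta i\<close>, so it survives and only moves to the left.\<close>

lemma Dbar_power_x_mult:
  "Dbar_power K (x_coord * g) = x_coord * Dbar_power K g
    - (\<Sum>i\<in>UNIV. if i \<in> K then koszul {i} K *\<^sub>R (theta i * Dbar_power (K - {i}) g) else 0)"
proof (induction K rule: finite_set_less_induct)
  case (insert m K)
  then have m: "m \<notin> K" by blast
  have t: "Dbar m (if i \<in> K then koszul {i} K *\<^sub>R (theta i * Dbar_power (K - {i}) g) else 0) =
     (if i \<in> insert m K then koszul {i} (insert m K) *\<^sub>R (theta i * Dbar_power (insert m K - {i}) g) else 0)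
     - (if i = m then theta m * Dbar_power K g else 0)" for i
  proof (cases "i = m")
    case True
    then show ?thesis using m insert(1) by (simp add: koszul_singleton_below)
  next
    case False
    have "Dbar m (Dbar_power (K - {i}) g) = Dbar_power (insert m (K - {i})) g"
      by (rule Dbar_power_insert_Min[symmetric]) (use insert(1) in auto)
    moreover have "koszul {i} (insert m K) = - koszul {i} K" if "i \<in> K"
      using insert(1)[OF that] m by (simp add: koszul_singleton_insert)
    moreover have "insert m K - {i} = insert m (K - {i})" using False by auto
    ultimately show ?thesis using False by (simp add: Dbar_mult Dbar_theta)
  qed
  have "Dbar_power (insert m K) (x_coord * g) = Dbar m (x_coord * Dbar_power K g)
     - (\<Sum>i\<in>UNIV. Dbar m (if i \<in> K then koszul {i} K *\<^sub>R (theta i * Dbar_power (K - {i}) g) else 0))"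
    by (simp only: Dbar_power_insert_Min[OF insert(1)] insert(2) linear_diff[OF linear_Dbar] Dbar_sum)
  also have "Dbar m (x_coord * Dbar_power K g) =
      x_coord * Dbar_power (insert m K) g - theta m * Dbar_power K g"
    by (simp add: Dbar_mult Dbar_x Dbar_power_insert_Min[OF insert(1)])
  finally show ?case
    by (simp only: t sum_subtractf) simp
qed simp

lemma coeff_map_single: "F 0 = 0 \<Longrightarrow> coeff_map F (single u A) = single u (F A)"
  by (rule poly_mapping_eqI) (simp add: lookup_coeff_map lookup_single when_def)

lemma Dbar_coeffs_single: "Dbar_coeffs i (single u A) = single u (Dbar i A)"
  by (simp add: Dbar_coeffs_eq_coeff_map coeff_map_single)

lemma zeta_mult_single: "zeta_mult (single (c, K) A) = single (Suc c, K) A"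
  by (cases "A = 0") (simp_all add: zeta_mult_def)

lemma d_zeta_single: "d_zeta (single (c, K) A) = single (c - 1, K) (real c *\<^sub>R A)"
  by (cases "A = 0") (simp_all add: d_zeta_def)

lemma symb_parity_single:
  "symb_parity (single (c, K) A) = single (c, K) ((-1) ^ card K *\<^sub>R parity_inv A)"
  by (cases "A = 0") (simp_all add: symb_parity_def)

lemma gamma_mult_single:
  "gamma_mult i (single (c, K) A) =
    (if i \<in> K then 0 else single (c, insert i K) (koszul {i} K *\<^sub>R parity_inv A))"
proof (cases "A = 0")
  case False
  have "{(c', K'). (c', K') \<in> {(c, K)} \<and> i \<notin> K'} = (if i \<in> K then {} else {(c, K)})" by auto
  then show ?thesis using False by (simp add: gamma_mult_def)
qed (simp add: gamma_mult_def)

lemma gamma_diff_single: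
  "gamma_diff i (single (c, K) A) =
    (if i \<in> K then single (c, K - {i}) (koszul {i} K *\<^sub>R parity_inv A) else 0)"
proof (cases "A = 0")
  case False
  have "{(c', K'). (c', K') \<in> {(c, K)} \<and> i \<in> K'} = (if i \<in> K then {(c, K)} else {})" by auto
  then show ?thesis using False by (simp add: gamma_diff_def)
qed (simp add: gamma_diff_def)

lemmas symb_single = coeff_map_single Dbar_coeffs_single zeta_mult_single d_zeta_single
  symb_parity_single gamma_mult_single gamma_diff_single

abbreviation theta_mult :: "'n::{finite,linorder} \<Rightarrow> 'n symb \<Rightarrow> 'n symb" where
  "theta_mult i \<equiv> coeff_map ((*) (theta i))"

abbreviation x_mult :: "'n::{finite,linorder} symb \<Rightarrow> 'n symb" where
  "x_mult \<equiv> coeff_map ((*) x_coord)"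

lemmas symb_op_maps = linear_coeff_mult linear_coeff_map[OF linear_d_x] linear_Dbar_coeffs linear_symb_ops

lemmas symb_op_add = symb_op_maps[THEN linear_add]
lemmas symb_op_diff = symb_op_maps[THEN linear_diff]
lemmas symb_op_neg = symb_op_maps[THEN linear_neg]
lemmas symb_op_scaleR = symb_op_maps[THEN linear_scale]
lemmas symb_op_sum = symb_op_maps[THEN linear_sum]
lemmas symb_op_zero = symb_op_maps[THEN linear_0]
lemmas symb_op_linear = symb_op_add symb_op_diff symb_op_neg symb_op_scaleR symb_op_sum symb_op_zero

lemmas normal_op_linear = normal_op_add normal_op_diff normal_op_scaleR normal_op_minus normal_op_zero normal_op_sum

lemma funpow_d_x_linear:
  "(d_x ^^ c) (- f) = - (d_x ^^ c) f" "(d_x ^^ c) (f - g) = (d_x ^^ c) f - (d_x ^^ c) g"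
  "(d_x ^^ c) 0 = 0" "(d_x ^^ c) (\<Sum>a\<in>A. h a) = (\<Sum>a\<in>A. (d_x ^^ c) (h a))"
  by (rule linear_neg linear_diff linear_0 linear_sum; rule linear_funpow_d_x)+

lemma funpow_d_x_d_x: "(d_x ^^ c) (d_x f) = d_x ((d_x ^^ c) f)"
  by (induction c) simp_all

lemma Dbar_funpow_d_x: "Dbar i ((d_x ^^ c) f) = (d_x ^^ c) (Dbar i f)"
  by (induction c) (simp_all flip: d_x_Dbar)

lemma funpow_d_x_theta: "(d_x ^^ c) (theta i * f) = theta i * (d_x ^^ c) f"
  by (induction c) (simp_all add: d_x_mult)

text \<open>For \<open>c = 0\<close> the truncated exponent \<open>c - 1\<close> does no harm,
  because its factor is 0. The same convention is present in \<open>d_zeta\<close>.\<close>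

lemma funpow_d_x_x: "(d_x ^^ c) (x_coord * f) = x_coord * (d_x ^^ c) f + real c *\<^sub>R (d_x ^^ (c - 1)) f"
proof (induction c)
  case (Suc c)
  then show ?case by (cases c) (simp_all add: d_x_mult algebra_simps scaleR_2)
qed simp

lemma Dbar_power_d_x: "Dbar_power K (d_x g) = d_x (Dbar_power K g)"
proof -
  have "foldr Dbar is (d_x g) = d_x (foldr Dbar is g)" for "is" :: "'a list"
    by (induction "is") (simp_all flip: d_x_Dbar)
  then show ?thesis by (simp add: Dbar_power_def)
qed

lemma Dbar_power_parity_inv:
  fixes g :: "'n::{finite,linorder} superfun"
  shows "Dbar_power K (parity_inv g) = (-1) ^ card K *\<^sub>R parity_inv (Dbar_power K g)"
proof (induction K rule: finite_set_less_induct)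
  case (insert m K)
  then have "m \<notin> K" by blast
  then show ?case by (simp add: Dbar_power_insert_Min[OF insert(1)] insert(2) parity_inv_Dbar)
qed simp

section \<open>Composition with the basic operators, read on full symbols\<close>

lemma mult_normal_op: "f * normal_op s g = normal_op (coeff_map ((*) f) s) g" (is "?L s = ?R s")
  by (rule linear_eq_on_singles[of ?L ?R], (rule linearI; simp add: symb_op_linear normal_op_linear algebra_simps)+)
    (simp_all add: symb_op_linear normal_op_linear symb_single algebra_simps)

lemma d_x_normal_op: "d_x (normal_op s g) = normal_op (coeff_map d_x s + zeta_mult s) g" (is "?L s = ?R s")
  by (rule linear_eq_on_singles[of ?L ?R], (rule linearI; simp add: symb_op_linear normal_op_linear algebra_simps)+)
    (simp_all add: symb_op_linear normal_op_linear symb_single d_x_mult algebra_simps)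

text \<open>\<open>Dbar i\<close> acts on the coefficient or joins the product of
  \<open>Dbar\<close>s. In the latter case a new index gives gamma_i, and an index already present
  gives \<open>- d_x\<close> by squaring, that is, minus zeta times the gamma-derivative.\<close>

lemma Dbar_normal_op:
  "Dbar i (normal_op s g) = normal_op (Dbar_coeffs i s + gamma_mult i s - zeta_mult (gamma_diff i s)) g" (is "?L s = ?R s")
proof (rule linear_eq_on_singles[of ?L ?R])
  show "linear ?L"
    "linear ?R"
    by (rule linearI; simp add: symb_op_linear normal_op_linear algebra_simps)+
  fix c K A
  show "?L (single (c, K) A) = ?R (single (c, K) A)"
    by (simp add: symb_op_linear normal_op_linear symb_single Dbar_mult Dbar_funpow_d_x Dbar_Dbar_power
        funpow_d_x_scaleR funpow_d_x_linear funpow_d_x_d_x)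
qed

lemma normal_op_d_x: "normal_op s (d_x g) = normal_op (zeta_mult s) g" (is "?L s = ?R s")
  by (rule linear_eq_on_singles[of ?L ?R], (rule linearI; simp add: symb_op_linear normal_op_linear algebra_simps)+)
    (simp_all add: symb_op_linear normal_op_linear symb_single Dbar_power_d_x funpow_d_x_d_x)

lemma normal_op_x_mult:
  "normal_op s (x_coord * g) =
    normal_op (x_mult s + d_zeta s - (\<Sum>i\<in>UNIV. theta_mult i (gamma_diff i s))) g" (is "?L s = ?R s")
proof (rule linear_eq_on_singles[of ?L ?R])
  show "linear ?L" by (rule linear_normal_op)
  show "linear ?R"
    by (rule linearI; simp add: symb_op_linear normal_op_linear algebra_simps sum.distrib scaleR_right.sum)
  fix c K A
  have "normal_op (single (c, K) A) (x_coord * g) =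
     A * x_coord * (d_x ^^ c) (Dbar_power K g) + real c *\<^sub>R A * (d_x ^^ (c - 1)) (Dbar_power K g)
     - (\<Sum>i\<in>UNIV. if i \<in> K then koszul {i} K *\<^sub>R (A * theta i * (d_x ^^ c) (Dbar_power (K - {i}) g)) else 0)"
    by (simp add: Dbar_power_x_mult funpow_d_x_linear funpow_d_x_x funpow_d_x_theta funpow_d_x_scaleR
        sum_distrib_left if_distrib[of "(d_x ^^ c)"] if_distrib[of "(*) A"] algebra_simps cong: if_cong)
  also have "\<dots> = ?R (single (c, K) A)"
    by (simp add: symb_single normal_op_linear mult_theta_right[of A] x_commute symb_op_zero
        if_distrib[of "coeff_map _"] if_distrib[of "\<lambda>s. normal_op s g"] cong: if_cong)
  finally show "?L (single (c, K) A) = ?R (single (c, K) A)" .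
qed

lemma normal_op_symb_parity: "normal_op (symb_parity s) g = parity_inv (normal_op s (parity_inv g))" (is "?L s = ?R s")
proof (rule linear_eq_on_singles[of ?L ?R])
  show "linear ?L" "linear ?R"
    by (rule linearI; simp add: symb_op_linear normal_op_linear)+
  fix c K A
  have "parity_inv ((d_x ^^ c) f) = (d_x ^^ c) (parity_inv f)" for f :: "'a superfun"
    by (induction c) (simp_all add: parity_inv_d_x)
  then show "?L (single (c, K) A) = ?R (single (c, K) A)"
    by (simp add: symb_single Dbar_power_parity_inv parity_inv_mult funpow_d_x_scaleR)
qed

text \<open>An odd factor composed on the right has to pass the whole operator. Stating the rule for
  \<open>symb_parity s\<close> absorbs that sign, and this is also the form in which it occurs in
  \<open>lie_op_odd\<close>.\<close>

lemma normal_op_theta_mult: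
  "normal_op (symb_parity s) (theta j * g) = normal_op (theta_mult j s - gamma_diff j s) g" (is "?L s = ?R s")
proof (rule linear_eq_on_singles[of ?L ?R])
  show "linear ?L"
    "linear ?R"
    by (rule linearI; simp add: symb_op_linear normal_op_linear algebra_simps)+
  fix c and K :: "'a set" and A
  have "parity_inv A * (theta j * h) = theta j * (A * h)" for h
    using mult_theta_right[of "parity_inv A" j] by (simp flip: mult.assoc)
  moreover have ee: "(-1) ^ card K * ((-1) ^ card K * r) = r" for r :: real
    by (simp flip: mult.assoc power_add)
  ultimately show "?L (single (c, K) A) = ?R (single (c, K) A)"
    by (simp add: symb_single normal_op_linear Dbar_power_theta_mult funpow_d_x_scaleR funpow_d_x_linear
        funpow_d_x_theta right_diff_distrib mult.assoc scaleR_diff_right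
        ee ee[of 1, simplified])
qed

text \<open>Up to parity, right and left multiplication by \<open>Dbar j\<close> agree except where
  \<open>Dbar j\<close> meets itself. There the sign is opposite to that in
  \<open>Dbar_normal_op\<close>.\<close>

lemma normal_op_Dbar:
  "normal_op (symb_parity s) (Dbar j g) = normal_op (gamma_mult j s + zeta_mult (gamma_diff j s)) g" (is "?L s = ?R s")
proof (rule linear_eq_on_singles[of ?L ?R])
  show "linear ?L"
    "linear ?R"
    by (rule linearI; simp add: symb_op_linear normal_op_linear algebra_simps)+
  fix c K A
  show "?L (single (c, K) A) = ?R (single (c, K) A)"
    by (simp add: symb_op_linear symb_single normal_op_linear Dbar_power_Dbar Dbar_Dbar_power funpow_d_x_scaleR
        funpow_d_x_linear funpow_d_x_d_x)
qed

lemma symb_parity_symb_parity [simp]: "symb_parity (symb_parity s) = s"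
  by (rule poly_mapping_eqI) (simp add: lookups split_paired_all flip: power_add)

lemma parity_inv_eq_0_iff [simp]: "parity_inv f = 0 \<longleftrightarrow> f = 0"
  by (metis parity_inv_parity_inv linear_0[OF linear_parity_inv])

text \<open>Induction on the order: commutators with the coordinates act on symbols as gamma- and
  zeta-derivatives, which have lower order and again represent the zero operator. Once all these
  derivatives vanish, only multiplication by a superfunction is left, and it is detected on the
  constant 1.\<close>

lemma normal_op_eq_0:
  assumes "\<And>g. normal_op s g = 0"
  shows "s = 0"
proof -
  have "s = 0" if "\<And>u. u \<in> keys s \<Longrightarrow> ord_deg u < N" "\<And>g. normal_op s g = 0" for N and s :: "'a symb"
    using that
  proof (induction N arbitrary: s)
    case 0
    then have "keys s = {}" by blast
    then show ?case by simp
  next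
    case (Suc N)
    have d: "lookup s (c, insert j K) = 0" if "j \<notin> K" for c j K
    proof -
      have "gamma_diff j s = 0"
      proof (rule Suc(1))
        fix u assume "u \<in> keys (gamma_diff j s)"
        then have "(fst u, insert j (snd u)) \<in> keys s" "j \<notin> snd u"
          by (cases u; auto simp: in_keys_iff lookup_gamma_diff split: if_splits)+
        then show "ord_deg u < N"
          using Suc(2)[of "(fst u, insert j (snd u))"] by (simp add: ord_deg_def case_prod_unfold)
      next
        fix g
        have "theta j * normal_op s g - normal_op (gamma_diff j s) g = normal_op (symb_parity s) (theta j * g)"
          by (simp add: normal_op_theta_mult mult_normal_op normal_op_linear)
        also have "\<dots> = 0" by (simp add: normal_op_symb_parity Suc(3))
        finally show "normal_op (gamma_diff j s) g = 0" by (simp add: Suc(3))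
      qed
      then have "lookup (gamma_diff j s) (c, K) = 0" by simp
      then show ?thesis using that koszul_singleton_cases[of j K] by (auto simp: lookup_gamma_diff)
    qed
    have g0: "gamma_diff j s = 0" for j
      by (rule poly_mapping_eqI) (simp add: split_paired_all lookup_gamma_diff d)
    \<comment> \<open>The commutator with \<open>x_coord\<close> also contains the terms
      \<open>theta_mult i (gamma_diff i s)\<close>; they are gone by \<open>g0\<close>.\<close>
    have "d_zeta s = 0"
    proof (rule Suc(1))
      fix u assume "u \<in> keys (d_zeta s)"
      then have "(Suc (fst u), snd u) \<in> keys s"
        by (cases u; auto simp: in_keys_iff lookup_d_zeta)
      then show "ord_deg u < N"
        using Suc(2)[of "(Suc (fst u), snd u)"] by (simp add: ord_deg_def case_prod_unfold)
    next
      fix g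
      have "normal_op (d_zeta s) g = normal_op s (x_coord * g) - x_coord * normal_op s g"
        by (simp add: normal_op_x_mult mult_normal_op normal_op_linear g0 symb_op_zero)
      then show "normal_op (d_zeta s) g = 0" by (simp add: Suc(3))
    qed
    then have "lookup (d_zeta s) (c, K) = 0" for c K by simp
    then have z: "lookup s (Suc c, K) = 0" for c K
      by (simp add: lookup_d_zeta del: of_nat_Suc)
    have s: "s = single (0, {}) (lookup s (0, {}))"
    proof (rule poly_mapping_eqI)
      fix u :: "nat \<times> 'a set"
      obtain c K where u: "u = (c, K)" by (cases u)
      show "lookup s u = lookup (single (0, {}) (lookup s (0, {}))) u"
      proof (cases "c = 0 \<and> K = {}")
        case False
        then have "lookup s (c, K) = 0"
        proof (cases c)
          case 0
          with False obtain j where "j \<in> K" by blast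
          then show ?thesis using d[of j "K - {j}" c] by (simp add: insert_absorb)
        qed (simp add: z)
        then show ?thesis using False by (auto simp: u lookup_single when_def)
      qed (simp add: u)
    qed
    have "normal_op (single (0, {}) (lookup s (0, {}))) 1 = 0"
      using Suc(3)[of 1] s by simp
    then have "lookup s (0, {}) = 0" by simp
    then show ?case using s by simp
  qed
  moreover have "ord_deg u < Suc (Max (ord_deg ` keys s))" if "u \<in> keys s" for u
    using that by (simp add: less_Suc_eq_le)
  ultimately show ?thesis using assms by blast
qed

lemma normal_op_inject: "normal_op s = normal_op t \<longleftrightarrow> s = t"
proof
  assume *: "normal_op s = normal_op t"
  have "normal_op (s - t) g = 0" for g by (simp add: normal_op_linear *)
  then show "s = t" using normal_op_eq_0 by fastforce
qed simp

lemma full_symbol_normal_op [simp]: "full_symbol (normal_op s) = s"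
  by (simp add: full_symbol_def normal_op_inject)

section \<open>Commutation relations of symbol operators\<close>

lemma zeta_mult_coeff_map: "F 0 = 0 \<Longrightarrow> zeta_mult (coeff_map F s) = coeff_map F (zeta_mult s)"
  by (rule poly_mapping_eqI) (simp add: lookups split_paired_all)

lemma d_zeta_coeff_map: "linear F \<Longrightarrow> d_zeta (coeff_map F s) = coeff_map F (d_zeta s)"
  by (rule poly_mapping_eqI) (simp add: lookups split_paired_all linear_0 linear_scale)

lemma even_coeff_map:
  assumes "linear F" "\<And>A. parity_inv (F A) = F (parity_inv A)"
  shows "gamma_mult i (coeff_map F s) = coeff_map F (gamma_mult i s)"
    "gamma_diff i (coeff_map F s) = coeff_map F (gamma_diff i s)"
    "symb_parity (coeff_map F s) = coeff_map F (symb_parity s)"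
  by (rule poly_mapping_eqI; simp add: lookups split_paired_all linear_0 linear_scale assms)+

lemma odd_coeff_map:
  assumes "linear F" "\<And>A. parity_inv (F A) = - F (parity_inv A)"
  shows "gamma_mult i (coeff_map F s) = - coeff_map F (gamma_mult i s)"
    "gamma_diff i (coeff_map F s) = - coeff_map F (gamma_diff i s)"
    "symb_parity (coeff_map F s) = - coeff_map F (symb_parity s)"
  by (rule poly_mapping_eqI; simp add: lookups split_paired_all linear_0 linear_scale assms)+

lemma symb_parity_zeta_mult: "symb_parity (zeta_mult s) = zeta_mult (symb_parity s)"
  by (rule poly_mapping_eqI) (simp add: lookups split_paired_all)

lemma symb_parity_d_zeta: "symb_parity (d_zeta s) = d_zeta (symb_parity s)"
  by (rule poly_mapping_eqI) (simp add: lookups split_paired_all algebra_simps)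

lemma symb_parity_gamma_mult: "symb_parity (gamma_mult i s) = - gamma_mult i (symb_parity s)"
proof (rule poly_mapping_eqI, unfold split_paired_all)
  fix c :: nat and K :: "'a set"
  show "lookup (symb_parity (gamma_mult i s)) (c, K) = lookup (- gamma_mult i (symb_parity s)) (c, K)"
  proof (cases "i \<in> K")
    case True
    then obtain n where "card K = Suc n" by (metis card.remove finite)
    then show ?thesis by (simp add: lookups True)
  qed (simp add: lookups)
qed

lemma symb_parity_gamma_diff: "symb_parity (gamma_diff i s) = - gamma_diff i (symb_parity s)"
  by (rule poly_mapping_eqI, unfold split_paired_all, rename_tac c K, case_tac "i \<in> K") (simp_all add: lookups)

lemma gamma_mult_zeta_mult: "zeta_mult (gamma_mult i s) = gamma_mult i (zeta_mult s)"
  by (rule poly_mapping_eqI) (simp add: lookups split_paired_all)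

lemma gamma_diff_zeta_mult: "zeta_mult (gamma_diff i s) = gamma_diff i (zeta_mult s)"
  by (rule poly_mapping_eqI) (simp add: lookups split_paired_all)

lemma gamma_mult_d_zeta: "d_zeta (gamma_mult i s) = gamma_mult i (d_zeta s)"
  by (rule poly_mapping_eqI) (simp add: lookups split_paired_all algebra_simps)

lemma gamma_diff_d_zeta: "d_zeta (gamma_diff i s) = gamma_diff i (d_zeta s)"
  by (rule poly_mapping_eqI) (simp add: lookups split_paired_all algebra_simps)

lemma d_zeta_zeta_mult: "d_zeta (zeta_mult s) = s + zeta_mult (d_zeta s)"
proof (rule poly_mapping_eqI, unfold split_paired_all)
  fix c :: nat and K
  show "lookup (d_zeta (zeta_mult s)) (c, K) = lookup (s + zeta_mult (d_zeta s)) (c, K)"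
    by (cases c) (simp_all add: lookups algebra_simps scaleR_2)
qed

lemma gamma_mult_gamma_mult: "gamma_mult i (gamma_mult j s) = - gamma_mult j (gamma_mult i s)"
proof (rule poly_mapping_eqI, unfold split_paired_all)
  fix c :: nat and K :: "'a set"
  have "K - {i} - {j} = K - {j} - {i}" by blast
  then show "lookup (gamma_mult i (gamma_mult j s)) (c, K) = lookup (- gamma_mult j (gamma_mult i s)) (c, K)"
    by (cases i j rule: linorder_cases; cases "i \<in> K"; cases "j \<in> K")
      (simp_all add: lookups koszul_singleton_remove
        order_less_not_sym order_less_imp_not_eq order_less_imp_not_eq2)
qed

lemma gamma_diff_gamma_diff: "gamma_diff i (gamma_diff j s) = - gamma_diff j (gamma_diff i s)"
proof (rule poly_mapping_eqI, unfold split_paired_all)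
  fix c :: nat and K :: "'a set"
  have "insert i (insert j K) = insert j (insert i K)" by blast
  then show "lookup (gamma_diff i (gamma_diff j s)) (c, K) = lookup (- gamma_diff j (gamma_diff i s)) (c, K)"
    by (cases i j rule: linorder_cases; cases "i \<in> K"; cases "j \<in> K")
      (simp_all add: lookups koszul_singleton_insert
        order_less_not_sym order_less_imp_not_eq order_less_imp_not_eq2)
qed

lemma gamma_diff_gamma_mult:
  "gamma_diff i (gamma_mult j s) = (if i = j then s else 0) - gamma_mult j (gamma_diff i s)"
proof (rule poly_mapping_eqI, unfold split_paired_all)
  fix c :: nat and K :: "'a set"
  have "insert i K - {j} = insert i (K - {j})" if "i \<noteq> j" using that by blast
  then show "lookup (gamma_diff i (gamma_mult j s)) (c, K) =
      lookup ((if i = j then s else 0) - gamma_mult j (gamma_diff i s)) (c, K)"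
    by (cases i j rule: linorder_cases; cases "i \<in> K"; cases "j \<in> K")
      (simp_all add: lookups koszul_singleton_insert koszul_singleton_remove insert_absorb
        order_less_not_sym order_less_imp_not_eq order_less_imp_not_eq2)
qed

lemma gamma_mult_square [simp]: "gamma_mult i (gamma_mult i s) = 0"
  using gamma_mult_gamma_mult[of i i s] by (metis add.right_inverse scaleR_2 scaleR_eq_0_iff zero_neq_numeral)

lemma gamma_diff_square [simp]: "gamma_diff i (gamma_diff i s) = 0"
  using gamma_diff_gamma_diff[of i i s] by (metis add.right_inverse scaleR_2 scaleR_eq_0_iff zero_neq_numeral)

lemma theta_mult_theta_mult: "theta_mult i (theta_mult j s) = - theta_mult j (theta_mult i s)"
  by (rule poly_mapping_eqI) (simp add: lookups theta_theta_left[of i j])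

lemma theta_mult_x_mult: "theta_mult i (x_mult s) = x_mult (theta_mult i s)"
  by (rule poly_mapping_eqI) (simp add: lookups theta_x)

lemma Dbar_coeffs_theta_mult:
  "Dbar_coeffs i (theta_mult j s) = (if i = j then s else 0) - theta_mult j (Dbar_coeffs i s)"
  by (rule poly_mapping_eqI) (simp add: lookups Dbar_mult Dbar_theta)

lemma Dbar_coeffs_x_mult: "Dbar_coeffs i (x_mult s) = x_mult (Dbar_coeffs i s) - theta_mult i s"
  by (rule poly_mapping_eqI) (simp add: lookups Dbar_mult Dbar_x)

lemma Dbar_coeffs_d_x: "coeff_map d_x (Dbar_coeffs i s) = Dbar_coeffs i (coeff_map d_x s)"
  by (rule poly_mapping_eqI) (simp add: lookups d_x_Dbar)

lemma d_x_theta_mult: "coeff_map d_x (theta_mult i s) = theta_mult i (coeff_map d_x s)"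
  by (rule poly_mapping_eqI) (simp add: lookups d_x_mult)

lemma Dbar_coeffs_Dbar_coeffs:
  "Dbar_coeffs i (Dbar_coeffs j s) = (if i = j then -2 *\<^sub>R coeff_map d_x s else 0) - Dbar_coeffs j (Dbar_coeffs i s)"
  by (rule poly_mapping_eqI) (simp add: lookups Dbar_Dbar[of i j])

lemma parity_inv_theta_mult: "parity_inv (theta i * f) = - (theta i * parity_inv f)"
  by (simp add: parity_inv_mult)

lemma parity_inv_x_mult: "parity_inv (x_coord * f) = x_coord * parity_inv f"
  by (simp add: parity_inv_mult)

lemmas symb_coeff_commute =
  zeta_mult_coeff_map[of "(*) (theta j)" for j, simplified]
  zeta_mult_coeff_map[of "(*) x_coord", simplified]
  zeta_mult_coeff_map[of d_x, simplified]
  zeta_mult_coeff_map[of "Dbar j" for j, simplified, folded Dbar_coeffs_eq_coeff_map]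
  d_zeta_coeff_map[OF linear_mult_left]
  d_zeta_coeff_map[OF linear_d_x]
  d_zeta_coeff_map[OF linear_Dbar, folded Dbar_coeffs_eq_coeff_map]
  odd_coeff_map(1,2)[OF linear_mult_left parity_inv_theta_mult]
  even_coeff_map(1,2)[OF linear_mult_left parity_inv_x_mult]
  even_coeff_map(1,2)[OF linear_d_x parity_inv_d_x]
  odd_coeff_map(1,2)[OF linear_Dbar parity_inv_Dbar, folded Dbar_coeffs_eq_coeff_map]

lemmas symb_parity_commute =
  odd_coeff_map(3)[OF linear_mult_left parity_inv_theta_mult]
  even_coeff_map(3)[OF linear_mult_left parity_inv_x_mult]
  symb_parity_zeta_mult symb_parity_d_zeta symb_parity_gamma_mult symb_parity_gamma_diff

lemmas symb_commute = symb_coeff_commute gamma_mult_zeta_mult gamma_diff_zeta_mult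
  gamma_mult_d_zeta gamma_diff_d_zeta d_zeta_zeta_mult gamma_diff_gamma_mult
  theta_mult_x_mult Dbar_coeffs_theta_mult Dbar_coeffs_x_mult Dbar_coeffs_d_x d_x_theta_mult

section \<open>Lie derivatives of operators\<close>

lemma vf_mult_add: "vf_mult h (X + Y) = vf_mult h X + vf_mult h Y"
  by (simp add: vf_mult_def vec_eq_iff algebra_simps)

lemma vf_mult_diff: "vf_mult h (X - Y) = vf_mult h X - vf_mult h Y"
  by (simp add: vf_mult_def vec_eq_iff algebra_simps)

lemma vf_mult_vf_mult: "vf_mult h (vf_mult k X) = vf_mult (h * k) X"
  by (simp add: vf_mult_def vec_eq_iff mult.assoc)

lemma linear_vf_apply: "linear (\<lambda>X. vf_apply X g)"
  by (rule linearI) (simp_all add: vf_apply_def algebra_simps sum.distrib scaleR_right.sum)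

lemma vf_apply_vf_mult: "vf_apply (vf_mult h X) g = h * vf_apply X g"
  by (simp add: vf_apply_def vf_mult_def distrib_left sum_distrib_left mult.assoc)

lemma vf_apply_y_field_None: "vf_apply (y_field None) g = d_x g"
  by (simp add: vf_apply_def)

lemma vf_apply_y_field_Some: "vf_apply (y_field (Some i)) g = d_theta i g"
  by (simp add: vf_apply_def axis_def if_distrib[of "\<lambda>z. z * _"] cong: if_cong)

lemma linear_divergence: "linear divergence"
  by (rule linearI)
    (simp_all add: divergence_def linear_add[OF linear_d_theta] linear_scale[OF linear_d_theta] sum.distrib
      scaleR_right.sum algebra_simps)

lemma divergence_y_field_None: "divergence (vf_mult h (y_field None)) = d_x h"
  by (simp add: divergence_def vf_mult_def linear_0[OF linear_d_theta])

lemma divergence_y_field_Some: "divergence (vf_mult h (y_field (Some i))) = d_theta i (parity_inv h)"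
  by (simp add: divergence_def vf_mult_def axis_def if_distrib[of "(*) h"] if_distrib[of "parity_inv"]
      if_distrib[of "d_theta _"] linear_0[OF linear_d_theta] cong: if_cong)

lemma vf_mult_Dbar_field:
  "vf_mult h (Dbar_field i) = vf_mult h (y_field (Some i)) - vf_mult (h * theta i) (y_field None)"
  by (simp only: Dbar_field_def vf_mult_diff vf_mult_vf_mult)

lemma vf_apply_contact_field:
  "vf_apply (contact_field f) g = f * d_x g - (1 / 2) *\<^sub>R (\<Sum>i\<in>UNIV. Dbar i (parity_inv f) * Dbar i g)"
  by (simp only: contact_field_def linear_diff[OF linear_vf_apply] linear_scale[OF linear_vf_apply]
      linear_sum[OF linear_vf_apply] vf_apply_vf_mult vf_apply_y_field_None Dbar_def)

text \<open>For each \<open>i\<close> the theta-terms of the two contributions cancel and one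
  \<open>d_x f\<close> remains. With the factor -1/2 the total is \<open>1 - n/2\<close>, which is
  \<open>(superdim + 1) / 2\<close>.\<close>

lemma divergence_contact_field:
  fixes f :: "'n::{finite,linorder} superfun"
  shows "divergence (contact_field f) = ((superdim TYPE('n) + 1) / 2) *\<^sub>R d_x f"
proof -
  have 1: "Dbar i (parity_inv (d_x f)) * theta i = - (theta i * d_theta i (d_x f))" for i
    by (simp add: mult_theta_right[of _ i] parity_inv_Dbar parity_inv_d_x Dbar_eq right_diff_distrib
        linear_diff[OF linear_parity_inv] parity_inv_d_theta parity_inv_mult)
  have 2: "d_theta i (parity_inv (Dbar i (parity_inv f))) = d_x f - theta i * d_theta i (d_x f)" for i
  proof -
    have "d_theta i (d_theta i f) = 0"
      by (rule superfun_eqI) (simp add: coeff_d_theta)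
    then show ?thesis
      by (simp add: parity_inv_Dbar Dbar_eq linear_diff[OF linear_d_theta] linear_neg[OF linear_d_theta] d_theta_mult d_theta_theta
        parity_inv_d_theta parity_inv_mult parity_inv_d_x)
  qed
  have "divergence (contact_field f) = d_x f - (1/2) *\<^sub>R (\<Sum>i\<in>UNIV. d_theta i (parity_inv (Dbar i (parity_inv f)))
      - Dbar i (parity_inv (d_x f)) * theta i)"
    by (simp only: contact_field_def linear_diff[OF linear_divergence] linear_scale[OF linear_divergence]
      linear_sum[OF linear_divergence] vf_mult_Dbar_field divergence_y_field_None divergence_y_field_Some
      d_x_mult d_x_theta mult_zero_right add_0_right d_x_Dbar parity_inv_d_x)
  also have "\<dots> = d_x f - (1/2) *\<^sub>R (\<Sum>i\<in>(UNIV :: 'n set). d_x f)"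
    by (simp add: 1 2)
  also have "\<dots> = ((superdim TYPE('n) + 1) / 2) *\<^sub>R d_x f"
    by (simp add: superdim_def sum_constant_scaleR algebra_simps diff_divide_distrib del: sum_constant)
  finally show ?thesis .
qed

lemma lie_density_contact_field:
  fixes f :: "'n::{finite,linorder} superfun"
  assumes "CARD('n) \<ge> 3"
  shows "lie_density l (contact_field f) g = f * d_x g
    - (1 / 2) *\<^sub>R (\<Sum>i\<in>UNIV. Dbar i (parity_inv f) * Dbar i g) + l *\<^sub>R (d_x f * g)"
  \<comment> \<open>The bound on \<open>n\<close> keeps \<open>superdim + 1 = 2 - n\<close> away
    from 0, so the normalisation of the density action cancels against the divergence.\<close>
  using assms by (simp add: lie_density_def vf_apply_contact_field divergence_contact_field superdim_def)

lemma linear_lie_density: "linear (\<lambda>X. lie_density l X g)"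
  by (rule linearI) (simp_all add: lie_density_def linear_add[OF linear_vf_apply] linear_scale[OF linear_vf_apply]
    linear_add[OF linear_divergence] linear_scale[OF linear_divergence] algebra_simps)

lemma vf_parity_inv_add: "vf_parity_inv (X + Y) = vf_parity_inv X + vf_parity_inv Y"
  by (simp add: vf_parity_inv_def vec_eq_iff)

lemma vf_parity_inv_scaleR: "vf_parity_inv (r *\<^sub>R X) = r *\<^sub>R vf_parity_inv X"
  by (simp add: vf_parity_inv_def vec_eq_iff)

lemma linear_vf_parity_inv: "linear vf_parity_inv"
  by (rule linearI) (simp_all add: vf_parity_inv_add vf_parity_inv_scaleR)

lemma vf_parity_inv_vf_mult: "vf_parity_inv (vf_mult h X) = vf_mult (parity_inv h) (vf_parity_inv X)"
  by (simp add: vf_parity_inv_def vf_mult_def vec_eq_iff parity_inv_mult)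

lemma vf_parity_inv_y_field:
  "vf_parity_inv (y_field None) = y_field None" "vf_parity_inv (y_field (Some i)) = - y_field (Some i)"
  by (simp_all add: vf_parity_inv_def vec_eq_iff axis_def)

lemma vf_mult_neg: "vf_mult (- h) X = - vf_mult h X" "vf_mult h (- X) = - vf_mult h X"
  by (simp_all add: vf_mult_def vec_eq_iff)

lemma vf_parity_inv_contact_field: "vf_parity_inv (contact_field f) = contact_field (parity_inv f)"
proof -
  have "vf_parity_inv (Dbar_field i) = - Dbar_field i" for i :: 'a
    by (simp only: Dbar_field_def linear_diff[OF linear_vf_parity_inv] vf_parity_inv_vf_mult
      vf_parity_inv_y_field parity_inv_theta vf_mult_neg) simp
  then show ?thesis
    by (simp only: contact_field_def linear_diff[OF linear_vf_parity_inv] linear_scale[OF linear_vf_parity_inv]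
      linear_sum[OF linear_vf_parity_inv] vf_parity_inv_vf_mult vf_parity_inv_y_field parity_inv_Dbar vf_mult_neg
      minus_minus)
qed

lemma linear_normal_op_right: "linear (normal_op s)"
  by (rule linearI)
    (simp_all add: normal_op_def case_prod_unfold linear_add[OF linear_Dbar_power] linear_scale[OF linear_Dbar_power]
      funpow_d_x_add funpow_d_x_scaleR algebra_simps sum.distrib scaleR_right.sum)

lemmas normal_op_right_linear = linear_add[OF linear_normal_op_right] linear_diff[OF linear_normal_op_right]
  linear_scale[OF linear_normal_op_right] linear_neg[OF linear_normal_op_right] linear_0[OF linear_normal_op_right]
  linear_sum[OF linear_normal_op_right]

lemma lie_op_even:
  assumes "vf_parity_inv X = X"
  shows "lie_op l m X (normal_op s) g = lie_density m X (normal_op s g) - normal_op s (lie_density l X g)"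
proof -
  have "vf_even X = X" "vf_odd X = 0"
    using assms by (simp_all add: vf_even_def vf_odd_def flip: scaleR_2)
  then show ?thesis
    by (simp add: lie_op_def linear_0[OF linear_lie_density] normal_op_right_linear)
qed

lemma lie_op_odd:
  assumes "vf_parity_inv X = - X"
  shows "lie_op l m X (normal_op s) g = lie_density m X (normal_op s g) - normal_op (symb_parity s) (lie_density l X g)"
proof -
  have "vf_even X = 0" "vf_odd X = X"
    using assms by (simp_all add: vf_even_def vf_odd_def flip: scaleR_2)
  then show ?thesis
    by (simp add: lie_op_def linear_0[OF linear_lie_density] normal_op_right_linear normal_op_symb_parity)
qed

subsection \<open>Projective fields\<close>

lemma vf_mult_one [simp]: "vf_mult 1 X = X"
  by (simp add: vf_mult_def vec_eq_iff)

lemma lie_density_y_field: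
  fixes g :: "'n::{finite,linorder} superfun"
  shows "lie_density l (vf_mult h (y_field None)) g = h * d_x g + (2 * l / (superdim TYPE('n) + 1)) *\<^sub>R (d_x h * g)"
    "lie_density l (vf_mult h (y_field (Some i))) g =
      h * d_theta i g + (2 * l / (superdim TYPE('n) + 1)) *\<^sub>R (d_theta i (parity_inv h) * g)"
  by (simp_all only: lie_density_def vf_apply_vf_mult vf_apply_y_field_None vf_apply_y_field_Some
      divergence_y_field_None divergence_y_field_Some)

text \<open>Two odd factors are composed on the right, so the signs compensate: writing
  \<open>s\<close> as a double \<open>symb_parity\<close> makes the two odd rules applicable in
  succession.\<close>

lemma normal_op_theta_Dbar:
  "normal_op s (theta i * Dbar i g) =
    normal_op (theta_mult i (gamma_mult i s) + gamma_mult i (gamma_diff i s) + zeta_mult (theta_mult i (gamma_diff i s))) g"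
proof -
  have "normal_op s (theta i * Dbar i g) = normal_op (symb_parity (symb_parity s)) (theta i * Dbar i g)" by simp
  also have "\<dots> = - normal_op (symb_parity (theta_mult i s - gamma_diff i s)) (Dbar i g)"
    by (simp only: normal_op_theta_mult) (simp add: symb_op_linear symb_parity_commute normal_op_linear)
  also have "\<dots> = normal_op (theta_mult i (gamma_mult i s) + gamma_mult i (gamma_diff i s)
      + zeta_mult (theta_mult i (gamma_diff i s))) g"
    by (simp add: normal_op_Dbar symb_op_linear symb_commute normal_op_linear)
  finally show ?thesis .
qed

text \<open>Because \<open>theta i\<close> squares to 0, the theta-degree can be expressed through
  \<open>Dbar i\<close>, for which the composition rules are available.\<close>

lemma theta_Dbar_eq: "theta i * Dbar i f = theta i * d_theta i f"
  by (simp add: Dbar_eq right_diff_distrib)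

lemma lie_op_translation: "lie_op l m (y_field None) (normal_op s) = normal_op (coeff_map d_x s)"
proof
  fix g
  have "lie_density l (y_field None) h = d_x h" for l and h :: "'a superfun"
    using lie_density_y_field(1)[of l 1 h] by simp
  then show "lie_op l m (y_field None) (normal_op s) g = normal_op (coeff_map d_x s) g"
    by (simp only: lie_op_even[OF vf_parity_inv_y_field(1)])
      (simp add: d_x_normal_op normal_op_d_x normal_op_linear)
qed

lemma lie_op_theta_d_x:
  "lie_op l m (vf_mult (theta j) (y_field None)) (normal_op s) =
    normal_op (theta_mult j (coeff_map d_x s) + zeta_mult (gamma_diff j s))" (is "?L = normal_op ?s")
proof
  fix g
  have p: "vf_parity_inv (vf_mult (theta j) (y_field None)) = - vf_mult (theta j) (y_field None)"
    by (simp only: vf_parity_inv_vf_mult vf_parity_inv_y_field parity_inv_theta vf_mult_neg)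
  have "lie_density l (vf_mult (theta j) (y_field None)) h = theta j * d_x h" for l h
    by (simp only: lie_density_y_field d_x_theta) simp
  then show "?L g =
      normal_op ?s g"
    by (simp only: lie_op_odd[OF p])
      (simp add: d_x_normal_op normal_op_theta_mult normal_op_d_x normal_op_linear symb_op_linear symb_commute
        distrib_left flip: mult_normal_op)
qed

text \<open>The scalar contributed by the divergence of \<open>x d_x\<close> and, with the opposite
  sign, of \<open>theta i d_theta i\<close>.\<close>

definition density_shift :: "'n::finite itself \<Rightarrow> real \<Rightarrow> real" where
  "density_shift _ d = 2 * d / (superdim TYPE('n) + 1)"

text \<open>The brackets with \<open>d_x\<close> and \<open>Dbar i\<close> are \<open>- d_x\<close>
  and \<open>theta i d_x\<close>. They give the term with \<open>d_zeta\<close> and the sum with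
  \<open>gamma_diff\<close>.\<close>

lemma lie_op_x_d_x:
  fixes s :: "'n::{finite,linorder} symb"
  shows "lie_op l m (vf_mult x_coord (y_field None)) (normal_op s) =
    normal_op (x_mult (coeff_map d_x s) - zeta_mult (d_zeta s)
      + zeta_mult (\<Sum>i\<in>UNIV. theta_mult i (gamma_diff i s)) + density_shift TYPE('n) (m - l) *\<^sub>R s)" (is "?L = normal_op ?s")
proof
  fix g
  have p: "vf_parity_inv (vf_mult x_coord (y_field None)) = vf_mult x_coord (y_field None)"
    by (simp only: vf_parity_inv_vf_mult vf_parity_inv_y_field parity_inv_x)
  have d: "lie_density l (vf_mult x_coord (y_field None)) h = x_coord * d_x h + density_shift TYPE('n) l *\<^sub>R h"
    for l and h :: "'n superfun"
    by (simp only: lie_density_y_field d_x_x density_shift_def) simp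
  have "?L g =
    normal_op (x_mult (coeff_map d_x s + zeta_mult s) + density_shift TYPE('n) m *\<^sub>R s
      - zeta_mult (x_mult s + d_zeta s - (\<Sum>i\<in>UNIV. theta_mult i (gamma_diff i s)))
      - density_shift TYPE('n) l *\<^sub>R s) g"
    by (simp only: lie_op_even[OF p] d normal_op_right_linear normal_op_x_mult normal_op_d_x d_x_normal_op
        mult_normal_op)
      (simp add: normal_op_linear algebra_simps flip: mult_normal_op)
  also have "\<dots> = normal_op ?s g"
    by (rule arg_cong[where f = "\<lambda>s. normal_op s g"])
      (simp add: symb_op_linear symb_coeff_commute density_shift_def algebra_simps diff_divide_distrib)
  finally show "?L g =
    normal_op ?s g" .
qed

text \<open>The bracket with \<open>Dbar i\<close> is \<open>- Dbar i - 2 theta i d_x\<close>,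
  whence the factor 2: gamma_i is not itself an eigenvector of this field.\<close>

lemma lie_op_theta_d_theta:
  fixes s :: "'n::{finite,linorder} symb"
  shows "lie_op l m (vf_mult (theta i) (y_field (Some i))) (normal_op s) =
    normal_op (theta_mult i (Dbar_coeffs i s) - 2 *\<^sub>R zeta_mult (theta_mult i (gamma_diff i s))
      - gamma_mult i (gamma_diff i s) - density_shift TYPE('n) (m - l) *\<^sub>R s)" (is "?L = normal_op ?s")
proof
  fix g
  have p: "vf_parity_inv (vf_mult (theta i) (y_field (Some i))) = vf_mult (theta i) (y_field (Some i))"
    by (simp only: vf_parity_inv_vf_mult vf_parity_inv_y_field parity_inv_theta vf_mult_neg minus_minus)
  have d: "lie_density l (vf_mult (theta i) (y_field (Some i))) h = theta i * Dbar i h - density_shift TYPE('n) l *\<^sub>R h"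
    for l and h :: "'n superfun"
    by (simp only: lie_density_y_field theta_Dbar_eq density_shift_def parity_inv_theta)
      (simp add: linear_neg[OF linear_d_theta] d_theta_theta)
  have "?L g =
    normal_op (theta_mult i (Dbar_coeffs i s + gamma_mult i s - zeta_mult (gamma_diff i s)) - density_shift TYPE('n) m *\<^sub>R s
      - (theta_mult i (gamma_mult i s) + gamma_mult i (gamma_diff i s) + zeta_mult (theta_mult i (gamma_diff i s)))
      + density_shift TYPE('n) l *\<^sub>R s) g"
    by (simp only: lie_op_even[OF p] d normal_op_right_linear normal_op_theta_Dbar Dbar_normal_op
        mult_normal_op)
      (simp add: normal_op_linear algebra_simps flip: mult_normal_op)
  also have "\<dots> = normal_op ?s g"
    by (rule arg_cong[where f = "\<lambda>s. normal_op s g"])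
      (simp add: symb_op_linear symb_coeff_commute density_shift_def algebra_simps diff_divide_distrib scaleR_2)
  finally show "?L g =
    normal_op ?s g" .
qed

subsection \<open>Odd contact fields\<close>

lemma vf_parity_inv_contact_odd: "parity_inv f = - f \<Longrightarrow> vf_parity_inv (contact_field f) = - contact_field f"
proof -
  assume f: "parity_inv f = - f"
  have "contact_field (- f) = - contact_field f"
    by (simp add: contact_field_def vf_mult_neg sum_negf)
  then show ?thesis by (simp add: vf_parity_inv_contact_field f)
qed

text \<open>The field \<open>\<partial>\<^bsub>\<theta>\<^sub>j\<^esub> + \<theta>\<^sub>j \<partial>\<^sub>x\<close>, which anticommutes with all \<^const>\<open>Dbar\<close>.\<close>

definition contact_D :: "'n::{finite,linorder} \<Rightarrow> 'n superfun \<Rightarrow> 'n superfun" where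
  "contact_D j f = Dbar j f + 2 *\<^sub>R (theta j * d_x f)"

definition theta_euler :: "'n::{finite,linorder} superfun \<Rightarrow> 'n superfun" where
  "theta_euler f = (\<Sum>i\<in>UNIV. theta i * Dbar i f)"

abbreviation "X_theta j \<equiv> contact_field (theta j)"
abbreviation "X_x_theta j \<equiv> contact_field (x_coord * theta j)"

lemma lie_density_contact_theta:
  fixes g :: "'n::{finite,linorder} superfun"
  assumes "CARD('n) \<ge> 3"
  shows "lie_density l (X_theta j) g = (1 / 2) *\<^sub>R contact_D j g"
proof -
  have "(\<Sum>i\<in>UNIV. Dbar i (parity_inv (theta j)) * Dbar i g) = - Dbar j g"
    by (simp add: Dbar_theta if_distrib[of uminus] if_distrib[of "\<lambda>z. z * _"] cong: if_cong)
  then show ?thesis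
    by (simp add: lie_density_contact_field[OF assms] contact_D_def algebra_simps)
qed

lemma lie_density_contact_x_theta:
  fixes g :: "'n::{finite,linorder} superfun"
  assumes "CARD('n) \<ge> 3"
  shows "lie_density l (X_x_theta j) g = (1 / 2) *\<^sub>R
    (x_coord * (contact_D j g) + theta j * theta_euler g + (2 * l) *\<^sub>R (theta j * g))"
proof -
  have "Dbar i (parity_inv (x_coord * theta j)) * Dbar i g =
    - (theta j * (theta i * Dbar i g)) - (if i = j then x_coord * Dbar j g else 0)" for i
    by (simp add: parity_inv_mult Dbar_mult Dbar_x Dbar_theta algebra_simps theta_theta_left[of i j])
  then have "(\<Sum>i\<in>UNIV. Dbar i (parity_inv (x_coord * theta j)) * Dbar i g) =
     - (theta j * theta_euler g) - x_coord * Dbar j g"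
    by (simp add: theta_euler_def sum_subtractf sum_negf sum_distrib_left)
  then show ?thesis
    unfolding lie_density_contact_field[OF assms] by (simp add: contact_D_def d_x_mult mult.assoc distrib_left scaleR_add_right scaleR_diff_right)
qed

definition D_coeffs :: "'n::{finite,linorder} \<Rightarrow> 'n symb \<Rightarrow> 'n symb" where
  "D_coeffs j s = Dbar_coeffs j s + 2 *\<^sub>R theta_mult j (coeff_map d_x s)"

lemma normal_op_contact_theta:
  "normal_op (symb_parity s) (contact_D j g) =
    normal_op (gamma_mult j s - zeta_mult (gamma_diff j s) + 2 *\<^sub>R zeta_mult (theta_mult j s)) g"
proof -
  have "normal_op (symb_parity s) (contact_D j g) =
    normal_op (gamma_mult j s + zeta_mult (gamma_diff j s)) g + 2 *\<^sub>R normal_op (zeta_mult (theta_mult j s - gamma_diff j s)) g"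
    by (simp only: contact_D_def normal_op_right_linear normal_op_Dbar normal_op_theta_mult normal_op_d_x)
  also have "\<dots> = normal_op (gamma_mult j s - zeta_mult (gamma_diff j s) + 2 *\<^sub>R zeta_mult (theta_mult j s)) g"
    by (simp add: symb_op_linear normal_op_linear algebra_simps scaleR_2)
  finally show ?thesis .
qed

text \<open>The field supercommutes with \<open>d_x\<close> and with every \<open>Dbar i\<close>.
  Symbols written in powers of these therefore feel it only through their coefficients.\<close>

lemma lie_op_contact_theta:
  fixes s :: "'n::{finite,linorder} symb"
  assumes "CARD('n) \<ge> 3"
  shows "lie_op l m (X_theta j) (normal_op s) = normal_op ((1 / 2) *\<^sub>R D_coeffs j s)"
proof
  fix g
  have p: "vf_parity_inv (X_theta j) = - X_theta j"
    by (rule vf_parity_inv_contact_odd) simp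
  have "lie_op l m (X_theta j) (normal_op s) g = (1/2) *\<^sub>R
     (normal_op (Dbar_coeffs j s + gamma_mult j s - zeta_mult (gamma_diff j s) + 2 *\<^sub>R theta_mult j (coeff_map d_x s + zeta_mult s)) g
     - normal_op (gamma_mult j s - zeta_mult (gamma_diff j s) + 2 *\<^sub>R zeta_mult (theta_mult j s)) g)"
    by (simp only: lie_op_odd[OF p] lie_density_contact_theta[OF assms] linear_scale[OF linear_normal_op_right]
      normal_op_contact_theta contact_D_def[of _ "normal_op s g"] Dbar_normal_op d_x_normal_op scaleR_diff_right)
      (simp add: normal_op_linear flip: mult_normal_op)
  also have "\<dots> = normal_op ((1 / 2) *\<^sub>R D_coeffs j s) g"
    by (simp only: normal_op_diff[symmetric] normal_op_scaleR[symmetric])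
      (simp add: D_coeffs_def symb_op_linear symb_coeff_commute algebra_simps)
  finally show "lie_op l m (X_theta j) (normal_op s) g = normal_op ((1 / 2) *\<^sub>R D_coeffs j s) g" .
qed

text \<open>This operator arises when \<open>x_coord\<close> is moved through an operator, since
  \<open>Dbar i x_coord = - theta i\<close>.\<close>

definition theta_diff :: "'n::{finite,linorder} symb \<Rightarrow> 'n symb" where
  "theta_diff s = (\<Sum>i\<in>UNIV. theta_mult i (gamma_diff i s))"

text \<open>Composed with \<open>d_zeta\<close>, this is the commutator of \<open>Delta\<close> with
  \<open>x_mult\<close>.\<close>

definition theta_gamma :: "'n::{finite,linorder} symb \<Rightarrow> 'n symb" where
  "theta_gamma s = (\<Sum>i\<in>UNIV. theta_mult i (gamma_mult i s))"

text \<open>The Euler operator in the gammas: it multiplies the coefficient at \<open>(c, K)\<close>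
  by \<open>card K\<close>.\<close>

definition gamma_euler :: "'n::{finite,linorder} symb \<Rightarrow> 'n symb" where
  "gamma_euler s = (\<Sum>i\<in>UNIV. gamma_mult i (gamma_diff i s))"

text \<open>By \<open>theta_Dbar_eq\<close> this is the Euler operator in the thetas, acting on the
  coefficients.\<close>

definition theta_Dbar :: "'n::{finite,linorder} symb \<Rightarrow> 'n symb" where
  "theta_Dbar s = (\<Sum>i\<in>UNIV. theta_mult i (Dbar_coeffs i s))"

lemma quadratic_maps: "linear theta_diff" "linear theta_gamma" "linear gamma_euler" "linear theta_Dbar"
  unfolding theta_diff_def theta_gamma_def gamma_euler_def theta_Dbar_def
  by (rule linearI; simp add: symb_op_linear sum.distrib scaleR_right.sum)+

lemmas quadratic_linear = quadratic_maps[THEN linear_add] quadratic_maps[THEN linear_diff]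
  quadratic_maps[THEN linear_scale] quadratic_maps[THEN linear_neg]

lemma theta_diff_theta_mult: "theta_diff (theta_mult j s) = theta_mult j (theta_diff s)"
  by (simp add: theta_diff_def symb_op_linear symb_coeff_commute theta_mult_theta_mult[of _ j] sum_negf)

lemma theta_gamma_theta_mult: "theta_gamma (theta_mult j s) = theta_mult j (theta_gamma s)"
  by (simp add: theta_gamma_def symb_op_linear symb_coeff_commute theta_mult_theta_mult[of _ j] sum_negf)

lemma gamma_euler_theta_mult: "gamma_euler (theta_mult j s) = theta_mult j (gamma_euler s)"
  by (simp add: gamma_euler_def symb_op_linear symb_coeff_commute)

lemma gamma_diff_theta_diff: "gamma_diff j (theta_diff s) = theta_diff (gamma_diff j s)"
  by (simp add: theta_diff_def symb_op_linear symb_coeff_commute gamma_diff_gamma_diff[of j] sum_negf)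

text \<open>The parts of \<open>2 X\<^sub>f\<close>, \<open>f = x \<theta>\<^sub>j\<close>, on symbols: the part preserving the Heisenberg degree, and the
  part lowering the order; the remaining term is \<open>- \<gamma>\<^sub>j \<partial>\<^sub>\<zeta>\<close>.\<close>

definition contact_principal :: "real \<Rightarrow> 'n::{finite,linorder} \<Rightarrow> 'n symb \<Rightarrow> 'n symb" where
  "contact_principal d j s = x_mult (D_coeffs j s) + theta_mult j (theta_Dbar s) + (2 * d) *\<^sub>R theta_mult j s
     - 2 *\<^sub>R theta_mult j (zeta_mult (d_zeta s)) + gamma_mult j (theta_diff s) - theta_mult j (gamma_euler s)
     + theta_gamma (gamma_diff j s)"

definition contact_lower :: "real \<Rightarrow> 'n::{finite,linorder} \<Rightarrow> 'n symb \<Rightarrow> 'n symb" where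
  "contact_lower l j s = (2 * l) *\<^sub>R gamma_diff j s + zeta_mult (gamma_diff j (d_zeta s)) + gamma_euler (gamma_diff j s)"

lemma lie_op_contact_x_theta:
  fixes s :: "'n::{finite,linorder} symb"
  assumes "CARD('n) \<ge> 3"
  shows "lie_op l m (X_x_theta j) (normal_op s) = normal_op ((1 / 2) *\<^sub>R
    (contact_principal (m - l) j s - gamma_mult j (d_zeta s) + contact_lower l j s))" (is "?L = normal_op ?s")
proof
  fix g
  let ?t = "x_mult s + d_zeta s - theta_diff s"
  let ?u = "theta_mult j s - gamma_diff j s"
  let ?left = "x_mult (Dbar_coeffs j s + gamma_mult j s - zeta_mult (gamma_diff j s)
        + 2 *\<^sub>R theta_mult j (coeff_map d_x s + zeta_mult s))
      + theta_mult j (\<Sum>i\<in>UNIV. theta_mult i (Dbar_coeffs i s + gamma_mult i s - zeta_mult (gamma_diff i s)))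
      + (2 * m) *\<^sub>R theta_mult j s"
  let ?right = "gamma_mult j ?t - zeta_mult (gamma_diff j ?t) + 2 *\<^sub>R zeta_mult (theta_mult j ?t)
      + (\<Sum>i\<in>UNIV. theta_mult i (gamma_mult i ?u) + gamma_mult i (gamma_diff i ?u) + zeta_mult (theta_mult i (gamma_diff i ?u)))
      + (2 * l) *\<^sub>R ?u"
  let ?f = "x_coord * (contact_D j g)" and ?h = "theta j * theta_euler g"
  have p: "vf_parity_inv (X_x_theta j) = - X_x_theta j"
    by (rule vf_parity_inv_contact_odd) (simp add: parity_inv_mult)
  have left: "lie_density m (X_x_theta j) (normal_op s g) = (1/2) *\<^sub>R
     normal_op ?left g"
    by (simp only: lie_density_contact_x_theta[OF assms] contact_D_def theta_euler_def Dbar_normal_op d_x_normal_op mult_normal_op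
      normal_op_scaleR[symmetric] normal_op_add[symmetric] normal_op_sum[symmetric])
  \<comment> \<open>The rules for odd right factors expect a \<open>symb_parity\<close>, so the
    symbol obtained after composing with \<open>x_coord\<close> is brought to that form.\<close>
  have x: "normal_op (symb_parity s) (x_coord * h) = normal_op (symb_parity ?t) h" for h
  proof -
    have "x_mult (symb_parity s) + d_zeta (symb_parity s) - (\<Sum>i\<in>UNIV. theta_mult i (gamma_diff i (symb_parity s))) = symb_parity ?t"
      by (simp add: symb_op_linear symb_parity_commute theta_diff_def)
    then show ?thesis by (simp only: normal_op_x_mult)
  qed
  have 1: "normal_op (symb_parity s) ?f =
      normal_op (gamma_mult j ?t - zeta_mult (gamma_diff j ?t) + 2 *\<^sub>R zeta_mult (theta_mult j ?t)) g"
    by (simp only: x normal_op_contact_theta)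
  have 2: "normal_op (symb_parity s) ?h =
      normal_op (\<Sum>i\<in>UNIV. theta_mult i (gamma_mult i ?u) + gamma_mult i (gamma_diff i ?u) + zeta_mult (theta_mult i (gamma_diff i ?u))) g"
    by (simp only: theta_euler_def normal_op_theta_mult linear_sum[OF linear_normal_op_right] normal_op_theta_Dbar normal_op_sum)
  have "normal_op (symb_parity s) (lie_density l (X_x_theta j) g) = (1/2) *\<^sub>R
     normal_op ?right g"
    unfolding lie_density_contact_x_theta[OF assms] linear_scale[OF linear_normal_op_right]
      linear_add[OF linear_normal_op_right, of _ "?f + ?h"]
      linear_add[OF linear_normal_op_right, of _ ?f]
      1 2 normal_op_theta_mult[of s j g] normal_op_scaleR[of "2 * l" ?u, symmetric] normal_op_add[symmetric] ..
  with left have "?L g = normal_op ((1/2) *\<^sub>R (?left - ?right)) g"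
    by (simp only: lie_op_odd[OF p] normal_op_scaleR normal_op_diff scaleR_diff_right)
  \<comment> \<open>Terms that raise the order, such as multiplication by gamma_j or by
    \<open>theta j\<close> times zeta, occur on both sides and cancel.\<close>
  also have "?left - ?right = contact_principal (m - l) j s - gamma_mult j (d_zeta s) + contact_lower l j s"
  proof -
    have 1: "(\<Sum>i\<in>UNIV. theta_mult i (Dbar_coeffs i s + gamma_mult i s - zeta_mult (gamma_diff i s))) =
       theta_Dbar s + theta_gamma s - theta_diff (zeta_mult s)"
      by (simp add: theta_Dbar_def theta_gamma_def theta_diff_def symb_op_linear sum.distrib sum_subtractf gamma_diff_zeta_mult)
    have 2: "(\<Sum>i\<in>UNIV. theta_mult i (gamma_mult i u) + gamma_mult i (gamma_diff i u) + zeta_mult (theta_mult i (gamma_diff i u))) =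
       theta_gamma u + gamma_euler u + theta_diff (zeta_mult u)" for u :: "'n symb"
      by (simp add: gamma_euler_def theta_gamma_def theta_diff_def symb_coeff_commute sum.distrib gamma_diff_zeta_mult)
    have 3: "zeta_mult (theta_diff u) = theta_diff (zeta_mult u)" for u :: "'n symb"
      by (simp add: theta_diff_def symb_op_linear symb_coeff_commute gamma_diff_zeta_mult)
    show ?thesis
      unfolding 1 2
      by (simp add: contact_principal_def contact_lower_def D_coeffs_def symb_op_linear quadratic_linear symb_coeff_commute
         gamma_mult_zeta_mult gamma_diff_zeta_mult theta_mult_x_mult 3
         theta_diff_theta_mult theta_gamma_theta_mult gamma_euler_theta_mult gamma_diff_theta_diff algebra_simps scaleR_2)
  qed
  finally show "?L g = normal_op ?s g" .
qed

subsection \<open>Commutation with \<open>\<Delta>\<close>\<close>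

lemma linear_Delta: "linear Delta"
  by (rule linearI) (simp_all add: Delta_def symb_op_linear sum.distrib scaleR_right.sum)

lemmas Delta_linear = linear_add[OF linear_Delta] linear_diff[OF linear_Delta] linear_scale[OF linear_Delta]
  linear_neg[OF linear_Delta] linear_0[OF linear_Delta] linear_sum[OF linear_Delta]

lemma Delta_x_mult: "Delta (x_mult s) = x_mult (Delta s) + theta_gamma (d_zeta s)"
  by (simp add: Delta_def theta_gamma_def symb_op_linear symb_coeff_commute Dbar_coeffs_x_mult sum.distrib sum_subtractf sum_negf)

lemma Delta_theta_mult: "Delta (theta_mult j s) = gamma_mult j (d_zeta s) + theta_mult j (Delta s)"
  by (simp add: Delta_def symb_op_linear symb_coeff_commute Dbar_coeffs_theta_mult sum.distrib sum_subtractf sum_negf if_distrib[of "gamma_mult _"] cong: if_cong)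

lemma Delta_d_x: "coeff_map d_x (Delta s) = Delta (coeff_map d_x s)"
  by (simp add: Delta_def symb_op_linear symb_coeff_commute Dbar_coeffs_d_x flip: Dbar_coeffs_d_x)

text \<open>Of the anticommutators of \<open>Dbar j\<close> with the \<open>Dbar i\<close> inside
  \<open>Delta\<close> only that with \<open>i = j\<close> is nonzero; its \<open>- 2 d_x\<close>
  changes sign on passing gamma_j.\<close>

lemma Dbar_coeffs_Delta: "Dbar_coeffs j (Delta s) = Delta (Dbar_coeffs j s) + 2 *\<^sub>R gamma_mult j (coeff_map d_x (d_zeta s))"
proof -
  have "Dbar_coeffs j (gamma_mult i t) = - gamma_mult i (Dbar_coeffs j t)" for i t
    by (simp add: symb_coeff_commute)
  then have "Dbar_coeffs j (Delta s) = (\<Sum>i\<in>UNIV. gamma_mult i (Dbar_coeffs i (Dbar_coeffs j (d_zeta s)))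
      + (if j = i then 2 *\<^sub>R gamma_mult j (coeff_map d_x (d_zeta s)) else 0))"
    unfolding Delta_def symb_op_sum
    by (intro sum.cong refl) (simp add: Dbar_coeffs_Dbar_coeffs[of j] symb_op_linear)
  also have "\<dots> = Delta (Dbar_coeffs j s) + 2 *\<^sub>R gamma_mult j (coeff_map d_x (d_zeta s))"
    unfolding sum.distrib Delta_def by (simp add: d_zeta_coeff_map[OF linear_Dbar, folded Dbar_coeffs_eq_coeff_map])
  finally show ?thesis .
qed

lemma gamma_mult_Delta: "Delta (gamma_mult j s) = gamma_mult j (Delta s)"
proof -
  have "Dbar_coeffs i (gamma_mult j t) = - gamma_mult j (Dbar_coeffs i t)" for i t
    by (simp add: symb_coeff_commute)
  then show ?thesis
    by (simp add: Delta_def symb_op_sum symb_op_neg gamma_mult_d_zeta gamma_mult_gamma_mult[of _ j])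
qed

lemma gamma_diff_Delta: "gamma_diff j (Delta s) = Dbar_coeffs j (d_zeta s) + Delta (gamma_diff j s)"
proof -
  have "Dbar_coeffs i (gamma_diff j t) = - gamma_diff j (Dbar_coeffs i t)" for i t
    by (simp add: symb_coeff_commute)
  then show ?thesis
    by (simp add: Delta_def symb_op_sum symb_op_neg gamma_diff_d_zeta gamma_diff_gamma_mult sum_subtractf sum_negf)
qed

lemma d_zeta_Delta: "d_zeta (Delta s) = Delta (d_zeta s)"
  by (simp add: Delta_def symb_op_sum gamma_mult_d_zeta d_zeta_coeff_map[OF linear_Dbar, folded Dbar_coeffs_eq_coeff_map])

lemma zeta_euler_Delta: "zeta_mult (d_zeta (Delta s)) = Delta (zeta_mult (d_zeta s)) - Delta s"
proof -
  have "zeta_mult (Dbar_coeffs i t) = Dbar_coeffs i (zeta_mult t)" for i and t :: "'a symb"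
    by (simp add: symb_coeff_commute)
  then show ?thesis
    unfolding d_zeta_Delta
    by (simp add: Delta_def symb_op_sum gamma_mult_zeta_mult d_zeta_zeta_mult symb_op_add sum.distrib)
qed

lemma theta_gamma_Delta: "Delta (theta_gamma s) = theta_gamma (Delta s)"
  by (simp add: theta_gamma_def Delta_linear Delta_theta_mult gamma_mult_d_zeta gamma_mult_Delta)

lemma gamma_euler_Delta: "gamma_euler (Delta s) = Delta s + Delta (gamma_euler s)"
  by (simp add: gamma_euler_def gamma_diff_Delta symb_op_add sum.distrib Delta_linear gamma_mult_Delta)
    (simp add: Delta_def)

lemma theta_Dbar_Delta:
  "theta_Dbar (Delta s) = Delta (theta_Dbar s) - Delta s + 2 *\<^sub>R theta_gamma (coeff_map d_x (d_zeta s))"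
proof -
  have "Delta (theta_Dbar s) = Delta s + (\<Sum>i\<in>UNIV. theta_mult i (Delta (Dbar_coeffs i s)))"
    by (simp add: theta_Dbar_def Delta_linear Delta_theta_mult sum.distrib)
      (simp add: Delta_def symb_coeff_commute)
  then show ?thesis
    by (simp add: theta_Dbar_def[of "Delta s"] Dbar_coeffs_Delta symb_op_linear sum.distrib theta_gamma_def scaleR_right.sum)
qed

lemma theta_diff_Delta:
  "theta_diff (Delta s) = Delta (theta_diff s) + theta_Dbar (d_zeta s) - gamma_euler (d_zeta s)"
proof -
  have "Delta (theta_diff s) = gamma_euler (d_zeta s) + (\<Sum>i\<in>UNIV. theta_mult i (Delta (gamma_diff i s)))"
    by (simp add: theta_diff_def gamma_euler_def Delta_linear Delta_theta_mult sum.distrib gamma_diff_d_zeta)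
  then show ?thesis
    by (simp add: theta_diff_def[of "Delta s"] gamma_diff_Delta symb_op_linear sum.distrib theta_Dbar_def)
qed

text \<open>\<open>contact_D j\<close> anticommutes with the \<open>Dbar i\<close> and with the
  gammas. Concretely, the two terms of \<open>D_coeffs\<close> produce opposite multiples of gamma_j
  d_x d_zeta.\<close>

lemma D_coeffs_Delta: "D_coeffs j (Delta s) = Delta (D_coeffs j s)"
  by (simp add: D_coeffs_def Dbar_coeffs_Delta Delta_linear Delta_theta_mult Delta_d_x symb_coeff_commute scaleR_add_right)

text \<open>Moving \<open>theta_mult j\<close> past \<open>Delta\<close> leaves gamma_j d_zeta. The
  resulting terms with \<open>theta_Dbar\<close> and \<open>gamma_euler\<close> are cancelled by
  those from \<open>theta_diff\<close>, and the terms with \<open>theta_gamma\<close> cancel among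
  themselves; only the Euler operator in zeta and the scalar \<open>d\<close> survive. The factor 2
  is that of \<open>2 X\<^sub>f\<close>.\<close>

lemma contact_principal_Delta:
  "contact_principal d j (Delta s) = Delta (contact_principal d j s)
    + 2 *\<^sub>R gamma_mult j (d_zeta (zeta_mult (d_zeta s) - d *\<^sub>R s))"
proof -
  have 1: "d_zeta (theta_Dbar s) = theta_Dbar (d_zeta s)"
    by (simp add: theta_Dbar_def symb_op_sum symb_coeff_commute)
  have 2: "d_zeta (gamma_euler s) = gamma_euler (d_zeta s)"
    by (simp add: gamma_euler_def symb_op_sum gamma_mult_d_zeta gamma_diff_d_zeta)
  have 3: "d_zeta (D_coeffs j s) = D_coeffs j (d_zeta s)"
    by (simp add: D_coeffs_def symb_op_linear symb_coeff_commute)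
  show ?thesis
    unfolding contact_principal_def D_coeffs_Delta zeta_euler_Delta theta_Dbar_Delta theta_diff_Delta gamma_euler_Delta
      gamma_diff_Delta Delta_linear Delta_x_mult Delta_theta_mult theta_gamma_Delta gamma_mult_Delta
      symb_op_linear 1 2 3
    by (simp add: quadratic_linear D_coeffs_def theta_gamma_theta_mult algebra_simps scaleR_2 symb_op_linear)
qed

section \<open>Gradings of the symbol space\<close>

text \<open>Comparing keys avoids assigning a degree to inhomogeneous symbols or to 0; one predicate
  serves for preserving and for lowering degrees.\<close>

definition moves_degree :: "('d \<Rightarrow> 'd \<Rightarrow> bool) \<Rightarrow> (nat \<times> 'n set \<Rightarrow> 'd) \<Rightarrow> ('n symb \<Rightarrow> 'n symb) \<Rightarrow> bool" where
  "moves_degree R deg F \<longleftrightarrow> (\<forall>s. \<forall>u\<in>keys (F s). \<exists>v\<in>keys s. R (deg u) (deg v))"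

abbreviation lowers_degree :: "(nat \<times> 'n set \<Rightarrow> 'd::linorder) \<Rightarrow> ('n symb \<Rightarrow> 'n symb) \<Rightarrow> bool" where
  "lowers_degree \<equiv> moves_degree (<)"

abbreviation preserves_degree :: "(nat \<times> 'n set \<Rightarrow> 'd::linorder) \<Rightarrow> ('n symb \<Rightarrow> 'n symb) \<Rightarrow> bool" where
  "preserves_degree \<equiv> moves_degree (=)"

text \<open>\<open>F0\<close> is the graded part of \<open>F\<close>. One action on full symbols
  will be used with two such parts, one for the order and one for the Heisenberg degree.\<close>

definition filtered_with_symbol ::
  "(nat \<times> 'n set \<Rightarrow> 'd::linorder) \<Rightarrow> ('n symb \<Rightarrow> 'n symb) \<Rightarrow> ('n symb \<Rightarrow> 'n symb) \<Rightarrow> bool" where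
  "filtered_with_symbol deg F F0 \<longleftrightarrow> linear F \<and> linear F0 \<and> preserves_degree deg F0 \<and> lowers_degree deg (\<lambda>s. F s - F0 s)"

lemma keys_scaleR_subset: "keys (r *\<^sub>R s) \<subseteq> keys s"
  by (auto simp: in_keys_iff)

lemma keys_sum_subset: "keys (\<Sum>a\<in>A. f a) \<subseteq> (\<Union>a\<in>A. keys (f a))"
proof
  fix u assume "u \<in> keys (\<Sum>a\<in>A. f a)"
  then have "(\<Sum>a\<in>A. lookup (f a) u) \<noteq> 0" by (simp add: in_keys_iff lookup_sum)
  then obtain a where "a \<in> A" "lookup (f a) u \<noteq> 0" by (rule sum.not_neutral_contains_not_neutral)
  then show "u \<in> (\<Union>a\<in>A. keys (f a))" by (auto simp: in_keys_iff)
qed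

lemma moves_degree_add: "moves_degree R deg F \<Longrightarrow> moves_degree R deg G \<Longrightarrow> moves_degree R deg (\<lambda>s. F s + G s)"
  unfolding moves_degree_def by (blast dest: subsetD[OF Poly_Mapping.keys_add])

lemma moves_degree_scaleR: "moves_degree R deg F \<Longrightarrow> moves_degree R deg (\<lambda>s. r *\<^sub>R F s)"
  unfolding moves_degree_def by (blast dest: subsetD[OF keys_scaleR_subset])

lemma moves_degree_compose:
  assumes "moves_degree R deg F" "moves_degree R' deg G" "\<And>x y z. R x y \<Longrightarrow> R' y z \<Longrightarrow> R'' x z"
  shows "moves_degree R'' deg (\<lambda>s. F (G s))"
  unfolding moves_degree_def
proof (intro allI ballI)
  fix s u assume "u \<in> keys (F (G s))"
  then obtain v where v: "v \<in> keys (G s)" "R (deg u) (deg v)"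
    using assms(1) unfolding moves_degree_def by blast
  then obtain w where "w \<in> keys s" "R' (deg v) (deg w)"
    using assms(2) unfolding moves_degree_def by blast
  then show "\<exists>w\<in>keys s. R'' (deg u) (deg w)" using v assms(3) by blast
qed

lemma preserves_degree_id: "preserves_degree deg (\<lambda>s. s)"
  unfolding moves_degree_def by blast

lemma filtered_with_symbol_id: "filtered_with_symbol deg (\<lambda>s. s) (\<lambda>s. s)"
  by (auto simp: filtered_with_symbol_def moves_degree_def linear_iff)

lemma filtered_with_symbol_add:
  assumes "filtered_with_symbol deg F F0" "filtered_with_symbol deg G G0"
  shows "filtered_with_symbol deg (\<lambda>s. F s + G s) (\<lambda>s. F0 s + G0 s)"
proof -
  have "(\<lambda>s. (F s - F0 s) + (G s - G0 s)) = (\<lambda>s. F s + G s - (F0 s + G0 s))" by (simp add: fun_eq_iff)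
  then show ?thesis
    using assms moves_degree_add[of "(<)" deg "\<lambda>s. F s - F0 s" "\<lambda>s. G s - G0 s"]
    unfolding filtered_with_symbol_def by (simp add: linear_compose_add moves_degree_add)
qed

lemma filtered_with_symbol_scaleR:
  assumes "filtered_with_symbol deg F F0"
  shows "filtered_with_symbol deg (\<lambda>s. r *\<^sub>R F s) (\<lambda>s. r *\<^sub>R F0 s)"
  using assms moves_degree_scaleR[of "(<)" deg "\<lambda>s. F s - F0 s" r]
  unfolding filtered_with_symbol_def
  by (simp add: linear_compose_scale_right moves_degree_scaleR scaleR_diff_right)

lemma filtered_with_symbol_compose:
  assumes "filtered_with_symbol deg F F0" "filtered_with_symbol deg G G0"
  shows "filtered_with_symbol deg (\<lambda>s. F (G s)) (\<lambda>s. F0 (G0 s))"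
proof -
  have lin: "linear F" "linear F0" "linear G" "linear G0" using assms by (simp_all add: filtered_with_symbol_def)
  let ?F = "\<lambda>s. F s - F0 s" and ?G = "\<lambda>s. G s - G0 s"
  have "(\<lambda>s. F0 (?G s) + ?F (G0 s) + ?F (?G s)) = (\<lambda>s. F (G s) - F0 (G0 s))"
    by (simp add: fun_eq_iff linear_diff[OF lin(1)] linear_diff[OF lin(2)])
  moreover have "lowers_degree deg (\<lambda>s. F0 (?G s) + ?F (G0 s) + ?F (?G s))"
    using assms unfolding filtered_with_symbol_def
    by (intro moves_degree_add moves_degree_compose[of "(=)" deg F0 "(<)" ?G] moves_degree_compose[of "(<)" deg ?F "(=)" G0]
        moves_degree_compose[of "(<)" deg ?F "(<)" ?G]) auto
  moreover have "linear (\<lambda>s. F (G s))" "linear (\<lambda>s. F0 (G0 s))"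
    using linear_compose[OF lin(3,1)] linear_compose[OF lin(4,2)] by (simp_all add: o_def)
  ultimately show ?thesis
    using assms moves_degree_compose[of "(=)" deg F0 "(=)" G0 "(=)"] unfolding filtered_with_symbol_def by simp
qed

lemma filtered_with_symbol_on_singles:
  assumes "linear F"
    and "\<And>c K A u. u \<in> keys (F (single (c, K) A) - single (c, K) A) \<Longrightarrow> deg u < deg (c, K)"
  shows "filtered_with_symbol deg F (\<lambda>s. s)"
  unfolding filtered_with_symbol_def
proof (intro conjI assms(1) preserves_degree_id)
  show "linear (\<lambda>s :: 'a symb. s)" by (simp add: linear_iff)
  show "lowers_degree deg (\<lambda>s. F s - s)"
    unfolding moves_degree_def
  proof (intro allI ballI)
    fix s u assume u: "u \<in> keys (F s - s)"
    have "F s - s = (\<Sum>v\<in>keys s. F (single v (lookup s v)) - single v (lookup s v))"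
      unfolding sum_subtractf linear_sum[OF assms(1), symmetric] sum_single_lookup ..
    then obtain v where "v \<in> keys s"
       "u \<in> keys (F (single v (lookup s v)) - single v (lookup s v))"
      using u keys_sum_subset by fastforce
    then show "\<exists>v\<in>keys s. deg u < deg v"
      using assms(2)[of u "fst v" "snd v"] by auto
  qed
qed

lemma lookup_homog_part: "lookup (homog_part deg d s) u = (if deg u = d then lookup s u else 0)"
proof -
  have "lookup (homog_part deg d s) u =
    (\<Sum>v | v \<in> keys s \<and> deg v = d. if v = u then lookup s v else 0)"
    by (simp add: homog_part_def lookup_sum lookup_single when_def)
  then show ?thesis by (simp add: in_keys_iff)
qed

lemma linear_homog_part: "linear (homog_part deg d)"
  by (rule linearI; rule poly_mapping_eqI) (simp_all add: lookup_homog_part lookup_add)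

lemma homog_part_in_homog: "homog_part deg d s \<in> homog deg d"
  by (auto simp: homog_def in_keys_iff lookup_homog_part split: if_splits)

lemma homog_part_of_homog: "s \<in> homog deg d \<Longrightarrow> homog_part deg d s = s"
  by (rule poly_mapping_eqI) (auto simp: lookup_homog_part homog_def in_keys_iff)

lemma sum_homog_part:
  assumes "finite C" "deg ` keys s \<subseteq> C"
  shows "(\<Sum>d\<in>C. homog_part deg d s) = s"
proof (rule poly_mapping_eqI)
  fix u
  have "(\<Sum>d\<in>C. if deg u = d then lookup s u else 0) = lookup s u"
  proof (cases "u \<in> keys s")
    case True
    then have "deg u \<in> C" using assms(2) by blast
    then show ?thesis using assms(1) by simp
  qed (auto simp: in_keys_iff intro!: sum.neutral)
  then show "lookup (\<Sum>d\<in>C. homog_part deg d s) u = lookup s u"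
    by (simp add: lookup_sum lookup_homog_part)
qed

lemma filtered_with_symbol_homog_part:
  assumes "filtered_with_symbol deg F F0" "s \<in> homog deg d"
  shows "homog_part deg d (F s) = F0 s"
proof (rule poly_mapping_eqI)
  fix u
  have "lookup (F s - F0 s) u = 0" if "deg u = d"
  proof (rule ccontr)
    assume "lookup (F s - F0 s) u \<noteq> 0"
    then have "u \<in> keys (F s - F0 s)" by (simp only: in_keys_iff not_False_eq_True)
    moreover have "lowers_degree deg (\<lambda>s. F s - F0 s)" using assms(1) by (simp add: filtered_with_symbol_def)
    ultimately obtain v where "v \<in> keys s" "deg u < deg v"
      unfolding moves_degree_def by blast
    then show False using that assms(2) by (auto simp: homog_def)
  qed
  moreover have "lookup (F0 s) u = 0" if "deg u \<noteq> d"
  proof (rule ccontr)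
    assume "lookup (F0 s) u \<noteq> 0"
    then have "u \<in> keys (F0 s)" by (simp add: in_keys_iff)
    then obtain v where "v \<in> keys s" "deg u = deg v"
      using assms(1) unfolding filtered_with_symbol_def moves_degree_def by blast
    then show False using that assms(2) by (auto simp: homog_def)
  qed
  ultimately show "lookup (homog_part deg d (F s)) u = lookup (F0 s) u"
    by (auto simp: lookup_homog_part lookup_minus)
qed

text \<open>The left side is what \<open>lie_S\<close> and \<open>lie_P\<close> become when
  operators are replaced by their full symbols.\<close>

lemma filtered_with_symbol_sum:
  assumes "filtered_with_symbol deg F F0"
  shows "(\<Sum>d\<in>deg ` keys s. homog_part deg d (F (homog_part deg d s))) = F0 s"
proof -
  have "linear F0" using assms by (simp add: filtered_with_symbol_def)
  from linear_sum[OF this, of "\<lambda>d. homog_part deg d s" "deg ` keys s", symmetric]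
  show ?thesis
    by (simp add: filtered_with_symbol_homog_part[OF assms homog_part_in_homog] sum_homog_part)
qed

lemma lie_S_eq:
  assumes "filtered_with_symbol ord_deg F F0" "\<And>s. lie_op l m X (normal_op s) = normal_op (F s)"
  shows "lie_S l m X s = F0 s"
  by (simp add: lie_S_def sigma_def assms(2) filtered_with_symbol_sum[OF assms(1)])

lemma lie_P_eq:
  assumes "filtered_with_symbol heis_deg F F0" "\<And>s. lie_op l m X (normal_op s) = normal_op (F s)"
  shows "lie_P l m X s = F0 s"
  by (simp add: lie_P_def hsigma_def assms(2) filtered_with_symbol_sum[OF assms(1)])

text \<open>\<open>F\<close> is unipotent: a monomial of top degree cannot be cancelled, and
  preimages are found by successive correction. The values of \<open>f\<close> are natural numbers,
  which gives the well-founded induction that real-valued degrees lack.\<close>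

lemma filtered_with_symbol_id_bij:
  fixes f :: "nat \<times> 'n set \<Rightarrow> nat"
  assumes F: "filtered_with_symbol deg F (\<lambda>s. s)" and f: "\<And>u v. deg u < deg v \<Longrightarrow> f u < f v"
  shows "bij F"
proof -
  have lin: "linear F" and low: "lowers_degree deg (\<lambda>s. F s - s)"
    using F by (simp_all add: filtered_with_symbol_def)
  have "inj F"
    unfolding linear_injective_0[OF lin]
  proof (intro allI impI, rule ccontr)
    fix s assume s: "F s = 0" "s \<noteq> 0"
    let ?N = "Max (f ` keys s)"
    have "?N \<in> f ` keys s" using s(2) by (intro Max_in) auto
    then obtain u where u: "u \<in> keys s" "f u = ?N" by auto
    then have "u \<in> keys (F s - s)" using s(1) by (simp add: in_keys_iff lookup_minus)
    then obtain v where "v \<in> keys s" "deg u < deg v"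
      using low unfolding moves_degree_def by blast
    then have "f v \<le> ?N" "f u < f v" using f by auto
    then show False using u by simp
  qed
  moreover have "\<exists>s. F s = t" for t
  proof -
    have "\<exists>s. F s = t" if "\<And>u. u \<in> keys t \<Longrightarrow> f u < N" for N and t :: "'n symb"
      using that
    proof (induction N arbitrary: t)
      case 0
      then have "keys t = {}" by blast
      then have "t = 0" by simp
      then show ?case using linear_0[OF lin] by blast
    next
      case (Suc N)
      \<comment> \<open>The error of taking \<open>t\<close> itself as preimage has lower degree, so
        a correction exists by induction.\<close>
      have "\<exists>s. F s = t - F t"
      proof (rule Suc(1))
        fix u assume "u \<in> keys (t - F t)"
        then have "u \<in> keys (F t - t)" by (simp add: in_keys_iff lookup_minus)
        then obtain v where "v \<in> keys t" "deg u < deg v"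
          using low unfolding moves_degree_def by blast
        then show "f u < N" using Suc(2)[of v] f[of u v] by simp
      qed
      then obtain s where "F s = t - F t" by blast
      then have "F (t + s) = t" by (simp add: linear_add[OF lin])
      then show ?case by blast
    qed
    moreover have "f u < Suc (Max (f ` keys t))" if "u \<in> keys t" for u
      using that by (simp add: less_Suc_eq_le)
    ultimately show ?thesis by blast
  qed
  ultimately show ?thesis unfolding bij_def surj_def by metis
qed

section \<open>Weights of the symbol operators\<close>

text \<open>\<open>e\<close> is the degree of \<open>F\<close> for the grading in which \<open>\<zeta>\<close> has weight \<open>a\<close> and the \<open>\<gamma>\<^sub>i\<close> have weight \<open>b\<close>.\<close>

definition has_weight :: "real \<Rightarrow> real \<Rightarrow> real \<Rightarrow> ('n symb \<Rightarrow> 'n symb) \<Rightarrow> bool" where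
  "has_weight a b e F \<longleftrightarrow> (\<forall>s c K. lookup (F s) (c, K) \<noteq> 0 \<longrightarrow>
     (\<exists>c' K'. lookup s (c', K') \<noteq> 0 \<and>
        a * real c + b * real (card K) = a * real c' + b * real (card K') + e))"

lemma has_weightI:
  "(\<And>s c K. lookup (F s) (c, K) \<noteq> 0 \<Longrightarrow> \<exists>c' K'. lookup s (c', K') \<noteq> 0 \<and>
     a * real c + b * real (card K) = a * real c' + b * real (card K') + e) \<Longrightarrow> has_weight a b e F"
  unfolding has_weight_def by blast

lemma has_weight_coeff_map:
  assumes "F 0 = 0"
  shows "has_weight a b 0 (coeff_map F)"
proof (rule has_weightI, goal_cases)
  case (1 s c K)
  then have "lookup s (c, K) \<noteq> 0" using assms by (auto simp: lookup_coeff_map)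
  then show ?case
    by (intro exI[of _ c] exI[of _ K]) simp
qed

lemma has_weight_Dbar_coeffs: "has_weight a b 0 (Dbar_coeffs i)"
  by (simp add: Dbar_coeffs_eq_coeff_map has_weight_coeff_map)

lemma has_weight_zeta_mult: "has_weight a b a zeta_mult"
proof (rule has_weightI, goal_cases)
  case (1 s c K)
  then obtain c' where c: "c = Suc c'" by (cases c) (simp_all add: lookup_zeta_mult)
  then have "lookup s (c', K) \<noteq> 0" using 1 by (simp add: lookup_zeta_mult)
  moreover have "a * real c + b * real (card K) = a * real c' + b * real (card K) + a"
    unfolding c by (simp add: distrib_left)
  ultimately show ?case by blast
qed

lemma has_weight_d_zeta: "has_weight a b (- a) d_zeta"
proof (rule has_weightI, goal_cases)
  case (1 s c K)
  then have "lookup s (Suc c, K) \<noteq> 0" by (simp add: lookup_d_zeta)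
  moreover have "a * real c + b * real (card K) = a * real (Suc c) + b * real (card K) + - a"
    by (simp add: distrib_left)
  ultimately show ?case by blast
qed

lemma has_weight_gamma_mult: "has_weight a b b (gamma_mult i)"
proof (rule has_weightI, goal_cases)
  case (1 s c K)
  then have i: "i \<in> K" by (simp add: lookup_gamma_mult split: if_splits)
  with 1 have "lookup s (c, K - {i}) \<noteq> 0" by (auto simp: lookup_gamma_mult)
  moreover have "real (card K) = real (card (K - {i})) + 1"
    using i by (metis Suc_eq_plus1 card.remove finite of_nat_Suc add.commute)
  then have "a * real c + b * real (card K) = a * real c + b * real (card (K - {i})) + b"
    by (simp only: distrib_left mult_1_right add.assoc)
  ultimately show ?case by blast
qed

lemma has_weight_gamma_diff: "has_weight a b (- b) (gamma_diff i)"
proof (rule has_weightI, goal_cases)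
  case (1 s c K)
  then have i: "i \<notin> K" by (simp add: lookup_gamma_diff split: if_splits)
  with 1 have "lookup s (c, insert i K) \<noteq> 0" by (auto simp: lookup_gamma_diff)
  moreover have "a * real c + b * real (card K) = a * real c + b * real (card (insert i K)) + - b"
    using i by (simp add: distrib_left)
  ultimately show ?case by blast
qed

lemma has_weight_compose:
  assumes "has_weight a b e F" "has_weight a b e' G" "e'' = e + e'"
  shows "has_weight a b e'' (\<lambda>s. F (G s))"
proof (rule has_weightI, goal_cases)
  case (1 s c K)
  then obtain c' K' where 1: "lookup (G s) (c', K') \<noteq> 0"
    "a * real c + b * real (card K) = a * real c' + b * real (card K') + e"
    using assms(1) unfolding has_weight_def by blast
  then obtain c'' K'' where "lookup s (c'', K'') \<noteq> 0"
    "a * real c' + b * real (card K') = a * real c'' + b * real (card K'') + e'"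
    using assms(2) unfolding has_weight_def by blast
  then show ?case
    using 1 assms(3) by (intro exI[of _ c''] exI[of _ K'']) simp
qed

lemma has_weight_add:
  assumes "has_weight a b e F" "has_weight a b e G"
  shows "has_weight a b e (\<lambda>s. F s + G s)"
proof (rule has_weightI, goal_cases)
  case (1 s c K)
  then have "lookup (F s) (c, K) \<noteq> 0 \<or> lookup (G s) (c, K) \<noteq> 0" by (auto simp: lookup_add)
  then show ?case
    using assms unfolding has_weight_def by blast
qed

lemma has_weight_scaleR: "has_weight a b e F \<Longrightarrow> has_weight a b e (\<lambda>s. r *\<^sub>R F s)"
  unfolding has_weight_def by simp

lemma has_weight_diff:
  assumes "has_weight a b e F" "has_weight a b e G"
  shows "has_weight a b e (\<lambda>s. F s - G s)"
  using has_weight_add[OF assms(1) has_weight_scaleR[OF assms(2), of "-1"]] by simp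

lemma has_weight_sum:
  fixes F :: "'i \<Rightarrow> 'n symb \<Rightarrow> 'n symb"
  assumes "\<And>i. has_weight a b e (F i)"
  shows "has_weight a b e (\<lambda>s. \<Sum>i\<in>A. F i s)"
proof (rule has_weightI, goal_cases)
  case (1 s c K)
  then have "(\<Sum>i\<in>A. lookup (F i s) (c, K)) \<noteq> 0" by (simp add: lookup_sum)
  then obtain i where "lookup (F i s) (c, K) \<noteq> 0" by (rule sum.not_neutral_contains_not_neutral)
  then show ?case
    using assms[of i] unfolding has_weight_def by blast
qed

lemma has_weight_Delta: "has_weight a b (b - a) Delta"
  unfolding Delta_def
  by (intro has_weight_sum has_weight_compose[OF has_weight_gamma_mult]
      has_weight_compose[OF has_weight_Dbar_coeffs has_weight_d_zeta]) simp_all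

lemma has_weight_Delta_funpow: "has_weight a b (real n * (b - a)) (Delta ^^ n)"
proof (induction n)
  case 0
  show ?case unfolding has_weight_def by auto
next
  case (Suc n)
  have "has_weight a b (real (Suc n) * (b - a)) (\<lambda>s :: 'a symb. Delta ((Delta ^^ n) s))"
    by (rule has_weight_compose[OF has_weight_Delta Suc]) (simp add: algebra_simps)
  then show ?case by (simp add: o_def)
qed

lemma has_weight_D_coeffs: "has_weight a b 0 (D_coeffs j)"
  unfolding D_coeffs_def
  by (intro has_weight_add has_weight_diff has_weight_scaleR has_weight_Dbar_coeffs
      has_weight_compose[OF has_weight_coeff_map has_weight_coeff_map]) simp_all

lemma has_weight_quadratic:
  "has_weight a b (- b) theta_diff" "has_weight a b b theta_gamma" "has_weight a b 0 gamma_euler" "has_weight a b 0 theta_Dbar"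
  unfolding theta_diff_def theta_gamma_def gamma_euler_def theta_Dbar_def
  by (intro has_weight_sum has_weight_compose[OF has_weight_coeff_map has_weight_gamma_diff]
      has_weight_compose[OF has_weight_coeff_map has_weight_gamma_mult]
      has_weight_compose[OF has_weight_coeff_map has_weight_Dbar_coeffs]
      has_weight_compose[OF has_weight_gamma_mult has_weight_gamma_diff]; simp)+

text \<open>Having weight 0 for all \<open>a\<close> and \<open>b\<close> covers the order
  \<open>(1, 1)\<close>, the Heisenberg degree \<open>(1, 1/2)\<close> and the zeta-degree
  \<open>(1, 0)\<close> at once.\<close>

lemma has_weight_contact_principal: "has_weight a b 0 (contact_principal d j)"
  unfolding contact_principal_def
  by (intro has_weight_add has_weight_diff has_weight_scaleR has_weight_coeff_map
      has_weight_compose[OF has_weight_coeff_map has_weight_D_coeffs]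
      has_weight_compose[OF has_weight_coeff_map has_weight_quadratic(4)]
      has_weight_compose[OF has_weight_coeff_map has_weight_compose[OF has_weight_zeta_mult has_weight_d_zeta]]
      has_weight_compose[OF has_weight_gamma_mult has_weight_quadratic(1)]
      has_weight_compose[OF has_weight_coeff_map has_weight_quadratic(3)]
      has_weight_compose[OF has_weight_quadratic(2) has_weight_gamma_diff]; (rule refl)?) simp_all

lemma has_weight_contact_lower: "has_weight a b (- b) (contact_lower l j)"
  unfolding contact_lower_def
  by (intro has_weight_add has_weight_diff has_weight_scaleR has_weight_gamma_diff
      has_weight_compose[OF has_weight_zeta_mult has_weight_compose[OF has_weight_gamma_diff has_weight_d_zeta]]
      has_weight_compose[OF has_weight_quadratic(3) has_weight_gamma_diff]; (rule refl)?) simp_all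

lemma has_weight_gamma_d_zeta: "has_weight a b (b - a) (\<lambda>s. gamma_mult j (d_zeta s))"
  by (rule has_weight_compose[OF has_weight_gamma_mult has_weight_d_zeta]) simp

lemma moves_degreeI:
  fixes w :: "nat \<times> 'n set \<Rightarrow> real"
  assumes "\<And>s u. lookup (F s) u \<noteq> 0 \<Longrightarrow> \<exists>v. lookup s v \<noteq> 0 \<and> w u = w v + e"
    and "\<And>u v. w u = w v + e \<Longrightarrow> R (deg u) (deg v)"
  shows "moves_degree R deg F"
  unfolding moves_degree_def
proof (intro allI ballI)
  fix s u assume "u \<in> keys (F s)"
  then have "lookup (F s) u \<noteq> 0" by (simp add: in_keys_iff)
  from assms(1)[OF this] obtain v where "lookup s v \<noteq> 0" "w u = w v + e" by blast
  then show "\<exists>v\<in>keys s. R (deg u) (deg v)" using assms(2) by (intro bexI[of _ v]) (auto simp: in_keys_iff)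
qed

lemma has_weight_heis:
  assumes "has_weight 1 (1/2) e F"
  shows "e = 0 \<Longrightarrow> preserves_degree heis_deg F" "e < 0 \<Longrightarrow> lowers_degree heis_deg F"
proof -
  have "\<exists>v. lookup s v \<noteq> 0 \<and> heis_deg u = heis_deg v + e" if "lookup (F s) u \<noteq> 0" for s u
    using assms that unfolding has_weight_def heis_deg_def by (cases u) fastforce
  note * = moves_degreeI[where w = heis_deg and e = e, OF this]
  show "e = 0 \<Longrightarrow> preserves_degree heis_deg F" "e < 0 \<Longrightarrow> lowers_degree heis_deg F"
    by (rule *; simp)+
qed

lemma has_weight_ord:
  assumes "has_weight 1 1 e F"
  shows "e = 0 \<Longrightarrow> preserves_degree ord_deg F" "e < 0 \<Longrightarrow> lowers_degree ord_deg F"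
proof -
  have "\<exists>v. lookup s v \<noteq> 0 \<and> real (ord_deg u) = real (ord_deg v) + e" if "lookup (F s) u \<noteq> 0" for s u
    using assms that unfolding has_weight_def ord_deg_def by (cases u) fastforce
  note * = moves_degreeI[where w = "\<lambda>u. real (ord_deg u)" and e = e, OF this]
  show "e = 0 \<Longrightarrow> preserves_degree ord_deg F" "e < 0 \<Longrightarrow> lowers_degree ord_deg F"
    by (rule *; simp)+
qed

lemma has_weight_zeta:
  assumes "has_weight 1 0 e F" "s \<in> homog fst c" "lookup (F s) (c', K) \<noteq> 0"
  shows "real c' = real c + e"
proof -
  obtain c'' K'' where *: "lookup s (c'', K'') \<noteq> 0"
    "1 * real c' + 0 * real (card K) = 1 * real c'' + 0 * real (card K'') + e"
    using assms(1,3) unfolding has_weight_def by blast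
  then have "(c'', K'') \<in> keys s" by (simp add: in_keys_iff)
  then have "c'' = c" using assms(2) by (auto simp: homog_def)
  with * show ?thesis by simp
qed

section \<open>The map from fine symbols to symbols\<close>

text \<open>\<open>Delta\<close> lowers the zeta-degree by exactly 1. After \<open>a\<close>
  applications the degree is \<open>c - a\<close>, which cannot be negative.\<close>

lemma Delta_funpow_homog:
  assumes "s \<in> homog fst c"
  shows "zeta_mult (d_zeta ((Delta ^^ a) s)) = (real c - real a) *\<^sub>R (Delta ^^ a) s"
    and "c < a \<Longrightarrow> (Delta ^^ a) s = 0"
proof -
  have *: "real c' = real c - real a" if "lookup ((Delta ^^ a) s) (c', K) \<noteq> 0" for c' K
    using has_weight_zeta[OF has_weight_Delta_funpow assms that] by simp
  show "zeta_mult (d_zeta ((Delta ^^ a) s)) = (real c - real a) *\<^sub>R (Delta ^^ a) s"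
  proof (rule poly_mapping_eqI, unfold split_paired_all)
    fix c' :: nat and K :: "'a set"
    show "lookup (zeta_mult (d_zeta ((Delta ^^ a) s))) (c', K) =
       lookup ((real c - real a) *\<^sub>R (Delta ^^ a) s) (c', K)"
      using *[of c' K] by (cases "lookup ((Delta ^^ a) s) (c', K) = 0"; cases c') (auto simp: lookups)
  qed
  show "(Delta ^^ a) s = 0" if "c < a"
  proof (rule poly_mapping_eqI, unfold split_paired_all)
    fix c' :: nat and K :: "'a set"
    show "lookup ((Delta ^^ a) s) (c', K) = lookup 0 (c', K)"
      using *[of c' K] that by (cases "lookup ((Delta ^^ a) s) (c', K) = 0") auto
  qed
qed

lemma linear_Delta_funpow: "linear (Delta ^^ a)"
proof (induction a)
  case (Suc a)
  then show ?case using linear_compose[OF Suc linear_Delta] by (simp add: comp_def)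
qed (simp add: linear_iff)

text \<open>These are the numbers with value 1 at \<open>a = 0\<close> that satisfy the recursion
  \<open>k\<close> in \<open>SQ_contact_principal\<close>.\<close>

definition SQ_coeff :: "real \<Rightarrow> nat \<Rightarrow> nat \<Rightarrow> real" where
  "SQ_coeff \<delta> c a = 1 / (2 ^ a * fact a) * (\<Prod>j<a. 1 / (real c - \<delta> - real j / 2))"

text \<open>On zeta-degree \<open>c\<close> the series stops at \<open>a = c\<close>. Letting the
  index set \<open>C\<close> be larger than the support allows sums of symbols to be compared over a
  common set.\<close>

lemma SQ_superset:
  assumes "finite C" "fst ` keys s \<subseteq> C"
  shows "SQ \<delta> s = (\<Sum>c\<in>C. \<Sum>a\<le>c. SQ_coeff \<delta> c a *\<^sub>R (Delta ^^ a) (homog_part fst c s))"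
proof -
  have 1: "Sum_any (\<lambda>a. (1 / (2 ^ a * fact a) * (\<Prod>j<a. 1 / (real c - \<delta> - real j / 2))) *\<^sub>R (Delta ^^ a) (homog_part fst c s)) =
     (\<Sum>a\<le>c. SQ_coeff \<delta> c a *\<^sub>R (Delta ^^ a) (homog_part fst c s))" for c
    unfolding SQ_coeff_def[symmetric]
  proof (rule Sum_any.expand_superset)
    show "{a. SQ_coeff \<delta> c a *\<^sub>R (Delta ^^ a) (homog_part fst c s) \<noteq> 0} \<subseteq> {..c}"
    proof
      fix a assume "a \<in> {a. SQ_coeff \<delta> c a *\<^sub>R (Delta ^^ a) (homog_part fst c s) \<noteq> 0}"
      then have "(Delta ^^ a) (homog_part fst c s) \<noteq> 0" by auto
      then show "a \<in> {..c}"
        using Delta_funpow_homog(2)[OF homog_part_in_homog, of c a s] by (meson atMost_iff not_less)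
    qed
  qed simp
  have 2: "homog_part fst c s = 0" if "c \<notin> fst ` keys s" for c
    using that by (intro poly_mapping_eqI) (auto simp: lookup_homog_part in_keys_iff)
  show ?thesis
    unfolding SQ_def 1
    by (rule sum.mono_neutral_left[OF assms]) (simp add: 2 linear_0[OF linear_Delta_funpow])
qed

lemma linear_SQ: "linear (SQ \<delta>)"
proof (rule linearI)
  fix s t :: "'a symb" and r :: real
  let ?C = "fst ` keys s \<union> fst ` keys t"
  have "fst ` keys (s + t) \<subseteq> ?C" using Poly_Mapping.keys_add[of s t] by blast
  then show "SQ \<delta> (s + t) = SQ \<delta> s + SQ \<delta> t"
    by (simp add: SQ_superset[of ?C] linear_add[OF linear_homog_part] linear_add[OF linear_Delta_funpow]
      scaleR_add_right sum.distrib)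
  have "fst ` keys (r *\<^sub>R s) \<subseteq> fst ` keys s" using keys_scaleR_subset[of r s] by blast
  then show "SQ \<delta> (r *\<^sub>R s) = r *\<^sub>R SQ \<delta> s"
    by (simp add: SQ_superset[of "fst ` keys s"] linear_scale[OF linear_homog_part]
      linear_scale[OF linear_Delta_funpow] scaleR_right.sum scaleR_left_commute[of _ r] mult.commute)
qed

lemma SQ_homog:
  assumes "s \<in> homog fst c"
  shows "SQ \<delta> s = (\<Sum>a\<le>c. SQ_coeff \<delta> c a *\<^sub>R (Delta ^^ a) s)"
  using SQ_superset[of "{c}" s \<delta>] assms homog_part_of_homog[OF assms] by (force simp: homog_def)

text \<open>Each \<open>Delta\<close> trades a zeta for a gamma and so costs 1/2 in Heisenberg
  degree; only the term \<open>a = 0\<close> keeps the degree.\<close>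

lemma SQ_filtered: "filtered_with_symbol heis_deg (SQ \<delta>) (\<lambda>s. s)"
proof (rule filtered_with_symbol_on_singles[OF linear_SQ])
  fix c :: nat and K :: "'a set" and A :: "'a superfun" and u
  let ?s = "single (c, K) A"
  assume u: "u \<in> keys (SQ \<delta> ?s - ?s)"
  have "?s \<in> homog fst c" by (simp add: homog_def)
  then have "SQ \<delta> ?s = (\<Sum>a\<le>c. SQ_coeff \<delta> c a *\<^sub>R (Delta ^^ a) ?s)" by (rule SQ_homog)
  also have "\<dots> = ?s + (\<Sum>a\<in>{1..c}. SQ_coeff \<delta> c a *\<^sub>R (Delta ^^ a) ?s)"
    by (simp add: sum.atMost_shift SQ_coeff_def sum.atLeast1_atMost_eq)
  finally have "SQ \<delta> ?s - ?s = (\<Sum>a\<in>{1..c}. SQ_coeff \<delta> c a *\<^sub>R (Delta ^^ a) ?s)" by simp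
  then obtain a where a: "a \<in> {1..c}" "u \<in> keys (SQ_coeff \<delta> c a *\<^sub>R (Delta ^^ a) ?s)"
    using u keys_sum_subset by fastforce
  then have "lookup ((Delta ^^ a) ?s) u \<noteq> 0" by (auto simp: in_keys_iff)
  then obtain c' K' where "lookup ?s (c', K') \<noteq> 0"
    "heis_deg u = real c' + real (card K') / 2 - real a / 2"
    using has_weight_Delta_funpow[of 1 "1/2" a] unfolding has_weight_def heis_deg_def
    by (cases u) (fastforce simp: algebra_simps)
  then show "heis_deg u < heis_deg (c, K)"
    using a(1) by (auto simp: heis_deg_def lookup_single when_def split: if_splits)
qed

lemma linear_contact_principal: "linear (contact_principal d j)"
  by (rule linearI)
    (simp_all add: contact_principal_def D_coeffs_def symb_op_linear quadratic_linear algebra_simps)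

text \<open>The commutator with the factor applied after \<open>i\<close> others contributes
  \<open>2 * (c - i - d)\<close>, and summing over \<open>i < a\<close> gives the coefficient. At
  \<open>a = 0\<close> this coefficient vanishes, which makes the truncated exponent
  harmless.\<close>

lemma contact_principal_Delta_funpow:
  assumes "s \<in> homog fst c"
  shows "contact_principal d j ((Delta ^^ a) s) = (Delta ^^ a) (contact_principal d j s)
    + (2 * real a * (real c - d - (real a - 1) / 2)) *\<^sub>R gamma_mult j (d_zeta ((Delta ^^ (a - 1)) s))"
proof (induction a)
  case (Suc a)
  have 1: "Delta (gamma_mult j (d_zeta t)) = gamma_mult j (d_zeta (Delta t))" for t
    by (simp add: gamma_mult_Delta d_zeta_Delta)
  have 2: "real a *\<^sub>R gamma_mult j (d_zeta (Delta ((Delta ^^ (a - 1)) s))) = real a *\<^sub>R gamma_mult j (d_zeta ((Delta ^^ a) s))"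
    by (cases a) simp_all
  have "contact_principal d j ((Delta ^^ Suc a) s) = Delta (contact_principal d j ((Delta ^^ a) s))
      + (2 * (real c - real a - d)) *\<^sub>R gamma_mult j (d_zeta ((Delta ^^ a) s))"
    by (simp add: contact_principal_Delta Delta_funpow_homog(1)[OF assms] symb_op_linear algebra_simps)
  also have "\<dots> = (Delta ^^ Suc a) (contact_principal d j s)
      + (2 * (real c - d - (real a - 1) / 2)) *\<^sub>R (real a *\<^sub>R gamma_mult j (d_zeta (Delta ((Delta ^^ (a - 1)) s))))
      + (2 * (real c - real a - d)) *\<^sub>R gamma_mult j (d_zeta ((Delta ^^ a) s))"
    by (simp add: Suc Delta_linear 1 mult.commute mult.left_commute)
  also have "\<dots> = (Delta ^^ Suc a) (contact_principal d j s)
     + (2 * (real c - d - (real a - 1) / 2) * real a + 2 * (real c - real a - d)) *\<^sub>R gamma_mult j (d_zeta ((Delta ^^ a) s))"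
    unfolding 2 by (simp add: scaleR_add_left)
  also have "2 * (real c - d - (real a - 1) / 2) * real a + 2 * (real c - real a - d) =
     2 * real (Suc a) * (real c - d - (real (Suc a) - 1) / 2)"
    by (simp add: field_simps)
  finally show ?case by simp
qed simp

text \<open>The commutators produce the sum of the \<open>g (a - 1)\<close>, while gamma_j d_zeta
  applied to \<open>SQ\<close> gives the sum of the \<open>g a\<close>. By the recursion
  \<open>k\<close> they are the same sum shifted by one index.\<close>

lemma SQ_contact_principal:
  assumes nz: "\<And>z :: int. \<delta> \<noteq> of_int z / 2"
  shows "contact_principal \<delta> j (SQ \<delta> s) - gamma_mult j (d_zeta (SQ \<delta> s)) = SQ \<delta> (contact_principal \<delta> j s)" (is "?L s = ?R s")
proof (rule linear_eq_on_singles[of ?L ?R])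
  show "linear ?L"
    "linear ?R"
    by (rule linearI; simp add: linear_add[OF linear_SQ] linear_scale[OF linear_SQ] linear_add[OF linear_contact_principal]
       linear_scale[OF linear_contact_principal] symb_op_linear algebra_simps)+
  fix c :: nat and K :: "'a set" and A :: "'a superfun"
  let ?s = "single (c, K) A"
  have s: "?s \<in> homog fst c" by (simp add: homog_def)
  have Ls: "contact_principal \<delta> j ?s \<in> homog fst c"
  proof -
    have "real c' = real c" if "lookup (contact_principal \<delta> j ?s) (c', L) \<noteq> 0" for c' L
      using has_weight_zeta[OF has_weight_contact_principal s that] by simp
    then show ?thesis by (auto simp: homog_def in_keys_iff)
  qed
  define g where "g a = SQ_coeff \<delta> c a *\<^sub>R gamma_mult j (d_zeta ((Delta ^^ a) ?s))" for a
  have k: "SQ_coeff \<delta> c (Suc a) * (2 * real (Suc a) * (real c - \<delta> - (real (Suc a) - 1) / 2)) = SQ_coeff \<delta> c a" for a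
  proof -
    have "real c - \<delta> - real a / 2 \<noteq> 0"
    proof
      assume "real c - \<delta> - real a / 2 = 0"
      then have "\<delta> = of_int (2 * int c - int a) / 2" by simp
      then show False using nz by blast
    qed
    moreover have "SQ_coeff \<delta> c (Suc a) = SQ_coeff \<delta> c a * (1 / (2 * real (Suc a) * (real c - \<delta> - real a / 2)))"
      by (simp add: SQ_coeff_def)
    ultimately show ?thesis by simp
  qed
  \<comment> \<open>The shifted sum lacks only this top term, and there the zeta-degree has already
    dropped to 0.\<close>
  have last: "g c = 0"
  proof -
    have "d_zeta ((Delta ^^ c) ?s) = 0"
    proof (rule poly_mapping_eqI, unfold split_paired_all)
      fix c' :: nat and K' :: "'a set"
      have "lookup ((Delta ^^ c) ?s) (Suc c', K') = 0"
      proof (rule ccontr)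
        assume "lookup ((Delta ^^ c) ?s) (Suc c', K') \<noteq> 0"
        from has_weight_zeta[OF has_weight_Delta_funpow s this] show False by simp
      qed
      then show "lookup (d_zeta ((Delta ^^ c) ?s)) (c', K') = lookup 0 (c', K')"
        by (simp add: lookups)
    qed
    then show ?thesis by (simp add: g_def symb_op_zero)
  qed
  have g: "gamma_mult j (d_zeta (SQ \<delta> ?s)) = (\<Sum>a\<le>c. g a)"
    by (simp add: SQ_homog[OF s] symb_op_linear g_def)
  have h: "SQ_coeff \<delta> c a *\<^sub>R ((2 * real a * (real c - \<delta> - (real a - 1) / 2)) *\<^sub>R gamma_mult j (d_zeta ((Delta ^^ (a - 1)) ?s)))
     = (if a = 0 then 0 else g (a - 1))" for a
    using k[of "a - 1"] by (cases a) (simp_all add: g_def)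
  have "contact_principal \<delta> j (SQ \<delta> ?s) = (\<Sum>a\<le>c. SQ_coeff \<delta> c a *\<^sub>R (Delta ^^ a) (contact_principal \<delta> j ?s))
     + (\<Sum>a\<le>c. if a = 0 then 0 else g (a - 1))"
    unfolding SQ_homog[OF s] linear_sum[OF linear_contact_principal] linear_scale[OF linear_contact_principal]
      contact_principal_Delta_funpow[OF s] scaleR_add_right h sum.distrib ..
  also have "(\<Sum>a\<le>c. if a = 0 then 0 else g (a - 1)) = (\<Sum>a<c. g a)"
    by (simp add: sum.atMost_shift)
  also have "\<dots> = (\<Sum>a\<le>c. g a)"
    by (simp add: last flip: lessThan_Suc_atMost)
  finally show "?L ?s = ?R ?s"
    by (simp add: g SQ_homog[OF Ls])
qed

lemma D_coeffs_Delta_funpow: "D_coeffs j ((Delta ^^ a) s) = (Delta ^^ a) (D_coeffs j s)"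
  by (induction a) (simp_all add: D_coeffs_Delta)

lemma linear_D_coeffs: "linear (D_coeffs j)"
  by (rule linearI) (simp_all add: D_coeffs_def symb_op_linear algebra_simps)

lemma SQ_D_coeffs: "D_coeffs j (SQ \<delta> s) = SQ \<delta> (D_coeffs j s)"
proof -
  have 1: "homog_part fst c (D_coeffs j s) = D_coeffs j (homog_part fst c s)" for c
    by (rule poly_mapping_eqI) (simp add: lookup_homog_part D_coeffs_def lookups)
  have "fst ` keys (D_coeffs j s) \<subseteq> fst ` keys s"
    by (rule image_mono) (auto simp: in_keys_iff D_coeffs_def lookups)
  then show ?thesis
    by (simp add: SQ_superset[of "fst ` keys s"] 1 linear_sum[OF linear_D_coeffs]
      linear_scale[OF linear_D_coeffs] D_coeffs_Delta_funpow)
qed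

lemma not_half_integer:
  assumes "\<delta> \<notin> I_crit"
  shows "\<delta> \<noteq> of_int z / 2"
proof
  assume d: "\<delta> = of_int z / 2"
  \<comment> \<open>The bound \<open>N\<close> is at least 1, so \<open>j = 1\<close> is admissible.
    For \<open>z \<ge> 0\<close> the choice of \<open>c\<close> is \<open>z/2\<close> rounded up,
    which makes \<open>j\<close> equal to 0 or 1; a negative \<open>z\<close> is reached with
    \<open>c = 0\<close>.\<close>
  define N where "N = nat \<bar>z\<bar> + 1"
  have "\<exists>c j. z = 2 * c - j \<and> 0 \<le> j \<and> j \<le> 2 * int N - 1 \<and> 0 \<le> c \<and> c \<le> int N"
  proof (cases "z \<ge> 0")
    case True
    then show ?thesis
      by (intro exI[of _ "(z + 1) div 2"] exI[of _ "2 * ((z + 1) div 2) - z"]) (simp add: N_def; presburger)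
  next
    case False
    then show ?thesis by (intro exI[of _ 0] exI[of _ "- z"]) (simp add: N_def)
  qed
  then have "\<delta> \<in> I_crit" unfolding I_crit_def d by blast
  then show False using assms by simp
qed

section \<open>Affinely equivariant maps\<close>

lemma smooth_real_differentiable: "smooth_real f \<Longrightarrow> f differentiable (at x)"
  using smooth_real_unfold by blast

lemma smooth_real_DERIV: "smooth_real f \<Longrightarrow> (f has_field_derivative deriv f x) (at x)"
  by (intro differentiable_imp_deriv smooth_real_differentiable)

lemma smooth_real_continuous_on: "smooth_real f \<Longrightarrow> continuous_on S f"
  by (meson smooth_real_DERIV DERIV_continuous continuous_at_imp_continuous_on)

text \<open>For \<open>n = 0\<close> and \<open>deriv f\<close> in place of \<open>f\<close> this is
  the difference quotient at \<open>a\<close>, with the right value at \<open>x = a\<close>. The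
  weight \<open>t ^ n\<close> makes the family closed under differentiation, hence smooth.\<close>

definition averaged :: "nat \<Rightarrow> real \<Rightarrow> (real \<Rightarrow> real) \<Rightarrow> real \<Rightarrow> real" where
  "averaged n a f x = integral {0..1} (\<lambda>t. t ^ n * f (a + t * (x - a)))"

lemma averaged_DERIV:
  assumes "smooth_real f"
  shows "(averaged n a f has_field_derivative averaged (Suc n) a (deriv f) x) (at x)"
proof -
  have d: "((\<lambda>x. t ^ n * f (a + t * (x - a))) has_field_derivative t ^ Suc n * deriv f (a + t * (x - a))) (at x within UNIV)"
    for x t
  proof -
    have "((\<lambda>x. a + t * (x - a)) has_field_derivative t) (at x)"
      by (auto intro!: derivative_eq_intros)
    from DERIV_cmult[OF DERIV_chain2[OF smooth_real_DERIV[OF assms] this], of "t ^ n"]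
    show ?thesis by (simp add: mult_ac)
  qed
  have "((\<lambda>x. integral (cbox 0 1) (\<lambda>t. t ^ n * f (a + t * (x - a)))) has_field_derivative
      integral (cbox 0 1) (\<lambda>t. t ^ Suc n * deriv f (a + t * (x - a)))) (at x within UNIV)"
  proof (rule leibniz_rule_field_derivative[where U = UNIV, OF d])
    show "(\<lambda>t. t ^ n * f (a + t * (x - a))) integrable_on cbox 0 1" for x
      by (intro integrable_continuous continuous_intros continuous_on_compose2[OF smooth_real_continuous_on[OF assms]]) auto
    show "continuous_on (UNIV \<times> cbox 0 1) (\<lambda>(x, t). t ^ Suc n * deriv f (a + t * (x - a)))"
      unfolding case_prod_unfold
      by (intro continuous_intros continuous_on_compose2[OF smooth_real_continuous_on[OF smooth_real_deriv[OF assms]]]) auto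
  qed auto
  then show ?thesis by (simp add: averaged_def[abs_def])
qed

lemma smooth_real_averaged:
  assumes "smooth_real f"
  shows "smooth_real (averaged n a f)"
proof (rule smooth_real_coinduct[where P = "\<lambda>h. \<exists>n f. smooth_real f \<and> h = averaged n a f"])
  fix h assume "\<exists>n f. smooth_real f \<and> h = averaged n a f"
  then obtain n f where f: "smooth_real f" and h: "h = averaged n a f" by blast
  show "h differentiable (at x)" for x
    using averaged_DERIV[OF f] unfolding h real_differentiable_def by blast
  have "deriv h = averaged (Suc n) a (deriv f)"
    unfolding h using averaged_DERIV[OF f] by (intro ext DERIV_imp_deriv)
  then show "\<exists>n f. smooth_real f \<and> deriv h = averaged n a f"
    using smooth_real_deriv[OF f] by blast
qed (use assms in blast)

lemma hadamard_factor:
  assumes "smooth_real f"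
  obtains g where "smooth_real g" "\<And>x. f x = f a + (x - a) * g x"
proof
  show "smooth_real (averaged 0 a (deriv f))"
    by (intro smooth_real_averaged smooth_real_deriv assms)
  fix x
  have "((\<lambda>t. deriv f (a + t * (x - a)) * (x - a)) has_integral f (a + 1 * (x - a)) - f (a + 0 * (x - a))) {0..1}"
  proof (rule fundamental_theorem_of_calculus)
    show "((\<lambda>t. f (a + t * (x - a))) has_vector_derivative deriv f (a + t * (x - a)) * (x - a)) (at t within {0..1})" for t
    proof -
      have "((\<lambda>t. a + t * (x - a)) has_field_derivative (x - a)) (at t)"
        by (auto intro!: derivative_eq_intros)
      from DERIV_chain2[OF smooth_real_DERIV[OF assms] this]
      show ?thesis
        unfolding has_real_derivative_iff_has_vector_derivative[symmetric] by (rule has_field_derivative_at_within)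
    qed
  qed simp
  then show "f x = f a + (x - a) * averaged 0 a (deriv f) x"
    by (simp add: averaged_def integral_unique mult.commute flip: integral_mult_right)
qed

lemma smooth_real_antiderivative:
  assumes "smooth_real f"
  obtains F where "smooth_real F" "deriv F = f"
proof
  \<comment> \<open>This is the integral of \<open>f\<close> from 0 to \<open>x\<close>, rescaled to
    the unit interval so that smoothness follows from that of \<open>averaged\<close>.\<close>
  let ?F = "\<lambda>x. x * averaged 0 0 f x"
  show "smooth_real ?F"
    by (intro smooth_real_mult smooth_real_averaged assms) simp
  show "deriv ?F = f"
  proof
    fix x
    \<comment> \<open>Integrating the derivative of \<open>t * f (t * x)\<close> over the unit
      interval expresses \<open>f x\<close> by the two averages in the derivative of
      \<open>?F\<close>.\<close>
    have "((\<lambda>t. f (t * x) + t * (deriv f (t * x) * x)) has_integral 1 * f (1 * x) - 0 * f (0 * x)) {0..1}"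
    proof (rule fundamental_theorem_of_calculus)
      show "((\<lambda>t. t * f (t * x)) has_vector_derivative f (t * x) + t * (deriv f (t * x) * x)) (at t within {0..1})" for t
      proof -
        have "((\<lambda>t. t * x) has_field_derivative x) (at t)"
          by (auto intro!: derivative_eq_intros)
        from DERIV_mult[OF DERIV_ident DERIV_chain2[OF smooth_real_DERIV[OF assms] this]]
        have "((\<lambda>t. t * f (t * x)) has_field_derivative f (t * x) + t * (deriv f (t * x) * x)) (at t)"
          by (simp add: mult.commute)
        then show ?thesis
          unfolding has_real_derivative_iff_has_vector_derivative[symmetric] by (rule has_field_derivative_at_within)
      qed
    qed simp
    then have "f x = integral {0..1} (\<lambda>t. f (t * x) + x * (t * deriv f (t * x)))"
      by (simp add: integral_unique algebra_simps)
    also have "\<dots> = integral {0..1} (\<lambda>t. f (t * x)) + integral {0..1} (\<lambda>t. x * (t * deriv f (t * x)))"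
      by (intro Henstock_Kurzweil_Integration.integral_add integrable_continuous_interval continuous_intros
          continuous_on_compose2[OF smooth_real_continuous_on[OF assms]]
          continuous_on_compose2[OF smooth_real_continuous_on[OF smooth_real_deriv[OF assms]]]) auto
    also have "\<dots> = averaged 0 0 f x + x * averaged (Suc 0) 0 (deriv f) x"
      by (simp add: averaged_def)
    finally have "f x = averaged 0 0 f x + x * averaged (Suc 0) 0 (deriv f) x" .
    moreover have "(?F has_field_derivative 1 * averaged 0 0 f x + averaged (Suc 0) 0 (deriv f) x * x) (at x)"
      by (rule DERIV_mult[OF DERIV_ident averaged_DERIV[OF assms]])
    ultimately have "(?F has_field_derivative f x) (at x)" by (simp add: mult.commute)
    then show "deriv ?F x = f x" by (rule DERIV_imp_deriv)
  qed
qed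

lemma smooth_real_funpow_deriv: "smooth_real f \<Longrightarrow> smooth_real ((deriv ^^ k) f)"
  by (induction k) (simp_all add: smooth_real_deriv)

lemma funpow_deriv_surj: "smooth_real f \<Longrightarrow> \<exists>F. smooth_real F \<and> (deriv ^^ k) F = f"
proof (induction k arbitrary: f)
  case (Suc k)
  obtain F where F: "smooth_real F" "deriv F = f" using smooth_real_antiderivative[OF Suc(2)] by blast
  then obtain G where "smooth_real G" "(deriv ^^ k) G = F" using Suc(1) by blast
  with F show ?case by (intro exI[of _ G]) simp
qed auto

lemma deriv_x_mult: "smooth_real f \<Longrightarrow> deriv (\<lambda>x. x * f x) = (\<lambda>x. x * deriv f x + f x)"
  by (intro ext DERIV_imp_deriv) (auto intro!: derivative_eq_intros smooth_real_DERIV)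

lemma funpow_deriv_x_mult:
  "smooth_real f \<Longrightarrow> (deriv ^^ Suc k) (\<lambda>x. x * f x) = (\<lambda>x. x * (deriv ^^ Suc k) f x + real (Suc k) * (deriv ^^ k) f x)"
proof (induction k)
  case 0
  then show ?case by (simp add: deriv_x_mult)
next
  case (Suc k)
  let ?f = "(deriv ^^ Suc k) f"
  have s: "smooth_real ?f" "smooth_real ((deriv ^^ k) f)" using Suc(2) by (rule smooth_real_funpow_deriv)+
  have "(deriv ^^ Suc (Suc k)) (\<lambda>x. x * f x) = deriv (\<lambda>x. x * ?f x + real (Suc k) * (deriv ^^ k) f x)"
    using Suc by simp
  also have "\<dots> = (\<lambda>x. (1 * ?f x + deriv ?f x * x) + real (Suc k) * deriv ((deriv ^^ k) f) x)"
    by (intro ext DERIV_imp_deriv DERIV_add DERIV_cmult DERIV_mult DERIV_ident smooth_real_DERIV s)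
  finally show ?case by (simp add: fun_eq_iff algebra_simps)
qed

text \<open>The relations say that \<open>\<phi>\<close> commutes with \<open>\<partial>\<close> and has positive weight for \<open>x \<partial>\<close>, so that
  \<open>\<phi> \<circ> \<partial>\<^sup>w\<close> commutes with \<open>x\<close>; by Hadamard's lemma it is a multiplication, which kills constants.\<close>

lemma positive_weight_operator_eq_0:
  fixes \<phi> :: "(real \<Rightarrow> real) \<Rightarrow> real \<Rightarrow> real"
  assumes add: "\<And>f g. smooth_real f \<Longrightarrow> smooth_real g \<Longrightarrow> \<phi> (\<lambda>x. f x + g x) = (\<lambda>x. \<phi> f x + \<phi> g x)"
    and scale: "\<And>f r. smooth_real f \<Longrightarrow> \<phi> (\<lambda>x. r * f x) = (\<lambda>x. r * \<phi> f x)"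
    and d: "\<And>f. smooth_real f \<Longrightarrow> \<phi> (deriv f) = deriv (\<phi> f)"
    and xd: "\<And>f x. smooth_real f \<Longrightarrow> \<phi> (\<lambda>x. x * deriv f x) x = x * deriv (\<phi> f) x - real w * \<phi> f x"
    and "w > 0" "smooth_real f"
  shows "\<phi> f x = 0"
proof -
  obtain k where k: "w = Suc k" using \<open>w > 0\<close> by (cases w) auto
  define \<psi> where "\<psi> f = \<phi> ((deriv ^^ w) f)" for f
  have psi_x: "\<psi> (\<lambda>x. x * f x) x = x * \<psi> f x" if f: "smooth_real f" for f x
  proof -
    let ?h = "(deriv ^^ k) f"
    have h: "smooth_real ?h" using f by (rule smooth_real_funpow_deriv)
    have "\<psi> (\<lambda>x. x * f x) = \<phi> (\<lambda>x. x * deriv ?h x + real w * ?h x)"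
      unfolding \<psi>_def k funpow_deriv_x_mult[OF f] by simp
    also have "\<dots> = (\<lambda>x. \<phi> (\<lambda>x. x * deriv ?h x) x + real w * \<phi> ?h x)"
      by (subst add) (simp_all add: smooth_real_mult smooth_real_deriv h scale)
    finally have "\<psi> (\<lambda>x. x * f x) x = x * deriv (\<phi> ?h) x" using xd[OF h] by simp
    also have "\<dots> = x * \<psi> f x" using d[OF h] by (simp add: \<psi>_def k)
    finally show ?thesis .
  qed
  have psi_add: "\<psi> (\<lambda>x. f x + g x) = (\<lambda>x. \<psi> f x + \<psi> g x)" if "smooth_real f" "smooth_real g" for f g
  proof -
    have "(deriv ^^ j) (\<lambda>x. f x + g x) = (\<lambda>x. (deriv ^^ j) f x + (deriv ^^ j) g x)" for j
    proof (induction j)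
      case (Suc j)
      then show ?case
        by (simp, intro ext DERIV_imp_deriv DERIV_add smooth_real_DERIV smooth_real_funpow_deriv that)
    qed simp
    then show ?thesis by (simp add: \<psi>_def add smooth_real_funpow_deriv that)
  qed
  have psi_scale: "\<psi> (\<lambda>x. r * f x) = (\<lambda>x. r * \<psi> f x)" if "smooth_real f" for r f
  proof -
    have "(deriv ^^ j) (\<lambda>x. r * f x) = (\<lambda>x. r * (deriv ^^ j) f x)" for j
    proof (induction j)
      case (Suc j)
      then show ?case
        by (simp, intro ext DERIV_imp_deriv DERIV_cmult smooth_real_DERIV smooth_real_funpow_deriv that)
    qed simp
    then show ?thesis by (simp add: \<psi>_def scale smooth_real_funpow_deriv that)
  qed
  have zero: "\<phi> (\<lambda>x. 0) = (\<lambda>x. 0)" using scale[of "\<lambda>x. 0" 0] by simp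
  have psi_const: "\<psi> (\<lambda>x. r) = (\<lambda>x. 0)" for r
  proof -
    have "(deriv ^^ Suc j) (\<lambda>x. r) = (\<lambda>x. 0)" for j
      by (induction j) simp_all
    then show ?thesis by (simp only: \<psi>_def k zero)
  qed
  have "\<psi> f a = 0" if f: "smooth_real f" for f a
  proof -
    \<comment> \<open>The value at \<open>a\<close> sees only the constant \<open>f a\<close>, since
      \<open>\<psi>\<close> commutes with \<open>x\<close> and so sends \<open>(x - a) * g\<close>
      to a function vanishing at \<open>a\<close>.\<close>
    obtain g where g: "smooth_real g" "\<And>x. f x = f a + (x - a) * g x" using hadamard_factor[OF f] by blast
    have xg: "smooth_real (\<lambda>x. x * g x)" by (intro smooth_real_mult g) simp
    have ag: "smooth_real (\<lambda>x. (- a) * g x)" by (intro smooth_real_mult g) simp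
    have "f = (\<lambda>x. f a + (x * g x + (- a) * g x))" using g(2) by (auto simp: fun_eq_iff algebra_simps)
    then have "\<psi> f = \<psi> (\<lambda>x. f a + (x * g x + (- a) * g x))" by simp
    also have "\<dots> = (\<lambda>x. \<psi> (\<lambda>x. f a) x + (\<psi> (\<lambda>x. x * g x) x + \<psi> (\<lambda>x. (- a) * g x) x))"
      using psi_add[OF smooth_real_const smooth_real_add[OF xg ag]] psi_add[OF xg ag] by simp
    finally have "\<psi> f a = \<psi> (\<lambda>x. f a) a + (\<psi> (\<lambda>x. x * g x) a + \<psi> (\<lambda>x. (- a) * g x) a)" by (rule fun_cong)
    also have "\<dots> = 0" by (simp only: psi_x[OF g(1)] psi_scale[OF g(1)] psi_const)
    finally show ?thesis .
  qed
  \<comment> \<open>Every smooth function is a \<open>w\<close>-th derivative, so vanishing of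
    \<open>\<psi>\<close> gives vanishing of \<open>\<phi>\<close>.\<close>
  moreover obtain F where "smooth_real F" "(deriv ^^ w) F = f" using funpow_deriv_surj[OF \<open>smooth_real f\<close>] by blast
  ultimately show ?thesis unfolding \<psi>_def by metis
qed

text \<open>The smoothness test makes the lift total: a function that is not smooth is sent to
  0.\<close>

lift_definition theta_part :: "'n set \<Rightarrow> (real \<Rightarrow> real) \<Rightarrow> 'n superfun"
  is "\<lambda>I f J x. if smooth_real f \<and> J = I then f x else 0"
  subgoal for I f J by (cases "smooth_real f"; cases "J = I") simp_all
  done

lemma coeff_theta_part: "smooth_real f \<Longrightarrow> coeff (theta_part I f) J x = (if J = I then f x else 0)"
  by (simp add: theta_part.rep_eq)

lemma sum_theta_part: "(\<Sum>I\<in>UNIV. theta_part I (coeff A I)) = A" for A :: "'n::finite superfun"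
  by (rule superfun_eqI) (simp add: coeff_sum coeff_theta_part smooth_coeff)

lemma d_x_theta_part: "smooth_real f \<Longrightarrow> d_x (theta_part I f) = theta_part I (deriv f)"
proof (rule superfun_eqI)
  fix J x assume f: "smooth_real f"
  have "coeff (theta_part I f) J = (if J = I then f else (\<lambda>x. 0))" using f by (auto simp: coeff_theta_part fun_eq_iff)
  then show "coeff (d_x (theta_part I f)) J x = coeff (theta_part I (deriv f)) J x"
    using f by (simp add: coeff_d_x coeff_theta_part smooth_real_deriv)
qed

section \<open>Affine fields on symbols, and symbols at theta = 0\<close>

definition x_field_action :: "'n::{finite,linorder} symb \<Rightarrow> 'n symb" where
  "x_field_action s = x_mult (coeff_map d_x s) - zeta_mult (d_zeta s) + zeta_mult (theta_diff s)"

text \<open>Like \<open>x_field_action\<close>, this omits the multiple of the identity given by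
  \<open>density_shift\<close>, which commutes with every linear map.\<close>

definition theta_field_action :: "'n::{finite,linorder} \<Rightarrow> 'n symb \<Rightarrow> 'n symb" where
  "theta_field_action i s = theta_mult i (Dbar_coeffs i s) - 2 *\<^sub>R zeta_mult (theta_mult i (gamma_diff i s))
     - gamma_mult i (gamma_diff i s)"

definition theta_d_x_action :: "'n::{finite,linorder} \<Rightarrow> 'n symb \<Rightarrow> 'n symb" where
  "theta_d_x_action j s = theta_mult j (coeff_map d_x s) + zeta_mult (gamma_diff j s)"

text \<open>The gamma-free coefficient of zeta^c at theta = 0. On this component
  \<open>theta_field_action\<close> vanishes and \<open>x_field_action\<close> becomes x d/dx - c,
  so weights can be compared.\<close>

definition body :: "nat \<Rightarrow> 'n symb \<Rightarrow> real \<Rightarrow> real" where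
  "body c s = coeff (lookup s (c, {})) {}"

lemma body_add: "body c (s + t) x = body c s x + body c t x"
  by (simp add: body_def lookup_add)

lemma body_diff: "body c (s - t) x = body c s x - body c t x"
  by (simp add: body_def lookup_minus)

lemma body_scaleR: "body c (r *\<^sub>R s) x = r * body c s x"
  by (simp add: body_def)

lemma body_minus: "body c (- s) x = - body c s x"
  by (simp add: body_def)

lemma body_sum: "body c (\<Sum>a\<in>A. f a) x = (\<Sum>a\<in>A. body c (f a) x)"
  by (simp add: body_def lookup_sum coeff_sum)

lemma body_d_x: "body c (coeff_map d_x s) = deriv (body c s)"
  by (simp add: body_def lookups coeff_d_x)

lemma body_theta_mult: "body c (theta_mult i s) x = 0"
  by (simp add: body_def lookups coeff_theta_mult)

lemma body_zeta_mult: "body c (zeta_mult s) x = (if c = 0 then 0 else body (c - 1) s x)"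
  by (simp add: body_def lookups)

lemma body_theta_field_action: "body c (theta_field_action i s) x = 0"
proof -
  have "body c (gamma_mult i t) x = 0" for t by (simp add: body_def lookups)
  then show ?thesis by (simp add: theta_field_action_def body_diff body_scaleR body_zeta_mult body_theta_mult)
qed

lemma body_x_field_action: "body c (x_field_action s) x = x * deriv (body c s) x - real c * body c s x"
proof -
  have "body c (x_mult t) x = x * body c t x" for t :: "'a symb"
    by (simp add: body_def lookups coeff_x_mult)
  moreover have "body c (zeta_mult (d_zeta s)) x = real c * body c s x"
    by (cases c) (simp_all add: body_def lookups)
  moreover have "body c (zeta_mult (theta_diff s)) x = 0"
    by (simp add: theta_diff_def body_zeta_mult body_sum body_theta_mult)
  ultimately show ?thesis by (simp add: x_field_action_def body_add body_diff body_d_x)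
qed

text \<open>The map to have in mind is \<open>T\<close> with
  \<open>Qsl = normal_op \<circ> T\<close>: the commutation rules express equivariance under affine
  projective fields, and \<open>diagonal\<close> comes from the normalisation of the principal
  symbol.\<close>

locale affine_equivariant =
  fixes T :: "'n::{finite,linorder} symb \<Rightarrow> 'n symb"
  assumes linear: "linear T"
    and d_x: "T (coeff_map d_x s) = coeff_map d_x (T s)"
    and D_coeffs: "T (D_coeffs j s) = D_coeffs j (T s)"
    and theta_d_x: "T (theta_d_x_action j s) = theta_d_x_action j (T s)"
    and x_field: "T (x_field_action s) = x_field_action (T s)"
    and theta_field: "T (theta_field_action i s) = theta_field_action i (T s)"
    and diagonal: "lookup (T (single u A)) u = A"
begin

text \<open>The hypothesis on \<open>A\<close> says that \<open>A\<close> is divisible by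
  \<open>theta i\<close>. The monomial then has eigenvalue 1 for
  \<open>theta_field_action i\<close>, whereas every body has eigenvalue 0.\<close>

lemma body_weight_theta:
  assumes "i \<notin> K" "theta i * Dbar i A = A"
  shows "body c' (T (single (c, K) A)) x = 0"
proof -
  have "theta_field_action i (single (c, K) A) = single (c, K) A"
    using assms by (simp add: theta_field_action_def symb_single symb_op_zero)
  then show ?thesis using theta_field[of i "single (c, K) A"] body_theta_field_action by metis
qed

text \<open>Here \<open>A\<close> is free of \<open>theta i\<close> and gamma_i contributes the
  eigenvalue -1. The monomial is an eigenvector only up to \<open>?w\<close>, whose coefficient is
  divisible by \<open>theta i\<close> and whose gammas omit gamma_i; that term is covered by
  \<open>body_weight_theta\<close>.\<close>

lemma body_weight_gamma:
  assumes "i \<in> K" "theta i * Dbar i A = 0"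
  shows "body c' (T (single (c, K) A)) x = 0"
proof -
  let ?v = "single (c, K) A"
  let ?w = "single (Suc c, K - {i}) (koszul {i} K *\<^sub>R (theta i * parity_inv A))"
  have "theta_field_action i ?v = - 2 *\<^sub>R ?w - ?v"
    using assms by (simp add: theta_field_action_def symb_single symb_op_zero insert_absorb)
  then have "theta_field_action i (T ?v) = - 2 *\<^sub>R T ?w - T ?v"
    by (simp only: linear_diff[OF linear] linear_scale[OF linear] flip: theta_field)
  then have "body c' (- 2 *\<^sub>R T ?w - T ?v) x = 0" using body_theta_field_action by metis
  moreover have "body c' (T ?w) x = 0"
    by (rule body_weight_theta[of i]) (simp_all add: Dbar_mult Dbar_theta right_diff_distrib)
  ultimately show ?thesis by (simp add: body_diff body_scaleR body_minus)
qed

text \<open>When thetas and gammas have the same indices, their weights balance and only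
  \<open>x d_x\<close> can separate. As a map of the function \<open>f\<close>, the body has weight
  \<open>c' - c > 0\<close>, so \<open>positive_weight_operator_eq_0\<close> applies.\<close>

lemma body_weight_zero:
  assumes "c < c'" "smooth_real f"
  shows "body c' (T (single (c, K) (theta_part K f))) x = 0"
proof (rule positive_weight_operator_eq_0[where \<phi> = "\<lambda>f. body c' (T (single (c, K) (theta_part K f)))" and w = "c' - c"])
  fix f g :: "real \<Rightarrow> real" and r :: real and x
  let ?v = "\<lambda>f. single (c, K) (theta_part K f)"
  assume f: "smooth_real f"
  have add: "?v (\<lambda>x. f x + g x) = ?v f + ?v g" if "smooth_real f" "smooth_real g" for f g
  proof -
    have "theta_part K (\<lambda>x. f x + g x) = theta_part K f + theta_part K g"
      by (rule superfun_eqI) (simp add: coeff_theta_part smooth_real_add that)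
    then show ?thesis by (simp add: single_add)
  qed
  have scale: "?v (\<lambda>x. r * f x) = r *\<^sub>R ?v f" if "smooth_real f" for f r
  proof -
    have "theta_part K (\<lambda>x. r * f x) = r *\<^sub>R theta_part K f"
      by (rule superfun_eqI) (simp add: coeff_theta_part smooth_real_mult that)
    then show ?thesis by (simp add: poly_mapping_eq_iff fun_eq_iff lookup_single when_def)
  qed
  show "body c' (T (?v (\<lambda>x. f x + g x))) = (\<lambda>x. body c' (T (?v f)) x + body c' (T (?v g)) x)" if "smooth_real g"
    by (simp add: add[OF f that] linear_add[OF linear] body_add fun_eq_iff)
  show "body c' (T (?v (\<lambda>x. r * f x))) = (\<lambda>x. r * body c' (T (?v f)) x)"
    by (simp add: scale[OF f] linear_scale[OF linear] body_scaleR fun_eq_iff)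
  have dv: "?v (deriv f) = coeff_map d_x (?v f)"
    by (simp add: symb_single d_x_theta_part f)
  show "body c' (T (?v (deriv f))) = deriv (body c' (T (?v f)))"
    by (simp add: dv d_x body_d_x)
  \<comment> \<open>For \<open>i \<in> K\<close> the coefficient already contains
    \<open>theta i\<close>, so the off-diagonal part \<open>theta_diff\<close> of
    \<open>x_field_action\<close> disappears.\<close>
  have "theta i * parity_inv (theta_part K f) = 0" if "i \<in> K" for i
    by (rule superfun_eqI) (use that f in \<open>auto simp: coeff_theta_mult coeff_theta_part\<close>)
  then have "theta_diff (?v f) = 0"
    by (auto simp: theta_diff_def symb_single symb_op_zero intro!: sum.neutral)
  moreover have "x_coord * theta_part K (deriv f) = theta_part K (\<lambda>x. x * deriv f x)"
    by (rule superfun_eqI) (simp add: coeff_x_mult coeff_theta_part smooth_real_mult smooth_real_deriv f)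
  moreover have "zeta_mult (d_zeta (?v f)) = real c *\<^sub>R ?v f"
    by (cases c) (simp_all add: symb_single symb_op_zero poly_mapping_eq_iff fun_eq_iff lookup_single when_def)
  ultimately have "x_field_action (?v f) = ?v (\<lambda>x. x * deriv f x) - real c *\<^sub>R ?v f"
    by (simp add: x_field_action_def symb_single d_x_theta_part f symb_op_zero)
  then have "x_field_action (T (?v f)) = T (?v (\<lambda>x. x * deriv f x)) - real c *\<^sub>R T (?v f)"
    by (simp only: linear_diff[OF linear] linear_scale[OF linear] flip: x_field)
  from arg_cong[OF this, of "\<lambda>s. body c' s x"]
  show "body c' (T (?v (\<lambda>x. x * deriv f x))) x = x * deriv (body c' (T (?v f))) x - real (c' - c) * body c' (T (?v f)) x"
    using assms(1) by (simp add: body_x_field_action body_diff body_scaleR of_nat_diff algebra_simps)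
qed (use assms in auto)

text \<open>For \<open>I \<noteq> K\<close> some index \<open>i\<close> occurs among the thetas or
  the gammas but not both, and its weight is nonzero; the case \<open>I = K\<close> is
  \<open>body_weight_zero\<close>.\<close>

lemma body_eq_0:
  assumes "c < c'"
  shows "body c' (T (single (c, K) A)) x = 0"
proof -
  have "body c' (T (single (c, K) (theta_part I f))) x = 0" if f: "smooth_real f" for I f
  proof (cases "I = K")
    case False
    then consider i where "i \<in> I" "i \<notin> K" | i where "i \<in> K" "i \<notin> I" by blast
    then show ?thesis
    proof cases
      case 1
      have "theta i * Dbar i (theta_part I f) = theta_part I f"
        by (rule superfun_eqI)
          (use 1 f in \<open>auto simp: theta_Dbar_eq coeff_theta_mult coeff_d_theta coeff_theta_part insert_absorb\<close>)
      then show ?thesis using 1 by (intro body_weight_theta)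
    next
      case 2
      have "theta i * Dbar i (theta_part I f) = 0"
        by (rule superfun_eqI)
          (use 2 f in \<open>auto simp: theta_Dbar_eq coeff_theta_mult coeff_d_theta coeff_theta_part insert_absorb\<close>)
      then show ?thesis using 2 by (intro body_weight_gamma)
    qed
  qed (use body_weight_zero[OF assms f] in simp)
  moreover have "single (c, K) A = (\<Sum>I\<in>UNIV. single (c, K) (theta_part I (coeff A I)))"
    by (rule poly_mapping_eqI) (simp add: lookup_sum lookup_single when_def sum_theta_part)
  ultimately show ?thesis
    by (simp add: linear_sum[OF linear] body_sum smooth_coeff)
qed

text \<open>On coefficients \<open>D_coeffs j\<close> is \<open>d_theta j + theta j d_x\<close>; at
  an index set \<open>I\<close> without \<open>j\<close> it reads off, up to sign, the coefficient
  at \<open>insert j I\<close>. So all coefficients are reached from the body. Here \<open>A\<close>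
  changes along the induction and has to be arbitrary.\<close>

lemma gamma_free_part_eq_0:
  assumes "c < c'"
  shows "lookup (T (single (c, K) A)) (c', {}) = 0"
proof -
  have "coeff (lookup (T (single (c, K) A)) (c', {})) I x = 0" for I x
    using finite[of I]
  proof (induction I arbitrary: A x rule: finite_induct)
    case empty
    show ?case using body_eq_0[OF assms, of K A x] by (simp add: body_def)
  next
    case (insert j I)
    let ?B = "lookup (T (single (c, K) A)) (c', {})"
    have "D_coeffs j (single (c, K) A) = single (c, K) (Dbar j A + 2 *\<^sub>R (theta j * d_x A))"
      by (simp add: D_coeffs_def symb_single poly_mapping_eq_iff fun_eq_iff lookup_single lookup_add when_def)
    then have "lookup (T (single (c, K) (Dbar j A + 2 *\<^sub>R (theta j * d_x A)))) (c', {}) =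
        Dbar j ?B + 2 *\<^sub>R (theta j * d_x ?B)"
      using D_coeffs[of j "single (c, K) A"] by (simp add: D_coeffs_def lookups)
    then have "coeff (Dbar j ?B + 2 *\<^sub>R (theta j * d_x ?B)) I x = 0"
      using insert.IH by metis
    then have "koszul {j} I * coeff ?B (insert j I) x = 0"
      using insert.hyps by (simp add: Dbar_eq coeff_theta_mult coeff_d_theta)
    then show ?case using koszul_singleton_cases[of j I] by auto
  qed
  then show ?thesis by (intro superfun_eqI) simp
qed

text \<open>In \<open>theta_d_x_action j\<close> the part zeta d_gamma_j carries the coefficient at
  \<open>(c', insert j L)\<close> to \<open>(Suc c', L)\<close>, which has one gamma less and a
  Heisenberg degree larger by 1/2. All other terms of the equivariance relation at that place vanish
  by induction.\<close>

lemma lookup_eq_0: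
  assumes "heis_deg (c, K) \<le> heis_deg (c', K')" "(c', K') \<noteq> (c, K)"
  shows "lookup (T (single (c, K) A)) (c', K') = 0"
  using finite[of K'] assms
proof (induction K' arbitrary: c K A c' rule: finite_induct)
  case empty
  have "c < c'"
  proof (cases "K = {}")
    case True
    then show ?thesis using empty by (simp add: heis_deg_def)
  next
    case False
    then have "real (card K) > 0" by (simp add: card_gt_0_iff)
    then show ?thesis using empty by (simp add: heis_deg_def)
  qed
  then show ?case by (rule gamma_free_part_eq_0)
next
  case (insert j L)
  let ?v = "single (c, K) A"
  have cL: "real (card (insert j L)) = real (card L) + 1" using insert.hyps by simp
  have prem: "real c + real (card K) / 2 \<le> real c' + (real (card L) + 1) / 2"
    using insert.prems(1) unfolding heis_deg_def case_prod_conv cL .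
  have up: "heis_deg (c, K) < heis_deg (Suc c', L)"
    using prem by (simp add: heis_deg_def add_divide_distrib)
  have 1: "lookup (T (single (c, K) B)) (Suc c', L) = 0" for B
    by (rule insert.IH) (use up in auto)
  \<comment> \<open>This monomial has also gained 1/2 in Heisenberg degree, so the inequality is
    kept; the two places are distinct because the original ones were.\<close>
  have 2: "lookup (T (zeta_mult (gamma_diff j ?v))) (Suc c', L) = 0"
  proof (cases "j \<in> K")
    case True
    have "real (card K) = real (card (K - {j})) + 1"
      using True by (metis Suc_eq_plus1 card.remove finite of_nat_Suc add.commute)
    then have "heis_deg (Suc c, K - {j}) \<le> heis_deg (Suc c', L)"
      using prem unfolding heis_deg_def case_prod_conv of_nat_Suc by (simp add: add_divide_distrib del: card_Diff_singleton card_Diff_singleton_if)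
    moreover have "(Suc c', L) \<noteq> (Suc c, K - {j})"
      using insert.prems(2) True by (auto simp: insert_absorb)
    ultimately show ?thesis using True by (simp add: symb_single insert.IH)
  qed (simp add: symb_single symb_op_zero linear_0[OF linear])
  have "theta_d_x_action j ?v = single (c, K) (theta j * d_x A) + zeta_mult (gamma_diff j ?v)"
    by (simp add: theta_d_x_action_def symb_single)
  then have "theta_d_x_action j (T ?v) = T (single (c, K) (theta j * d_x A)) + T (zeta_mult (gamma_diff j ?v))"
    using theta_d_x[of j ?v] by (simp add: linear_add[OF linear])
  from arg_cong[OF this, of "\<lambda>s. lookup s (Suc c', L)"]
  have "lookup (theta_d_x_action j (T ?v)) (Suc c', L) = 0"
    by (simp add: lookup_add 1 2)
  then have "koszul {j} L *\<^sub>R parity_inv (lookup (T ?v) (c', insert j L)) = 0"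
    using insert.hyps by (simp add: theta_d_x_action_def lookups 1)
  then show ?case using koszul_singleton_cases[of j L] by auto
qed

lemma filtered: "filtered_with_symbol heis_deg T (\<lambda>s. s)"
proof (rule filtered_with_symbol_on_singles[OF linear])
  fix c K A u
  assume u: "u \<in> keys (T (single (c, K) A) - single (c, K) A)"
  then have ne: "u \<noteq> (c, K)" using diagonal[of "(c, K)" A] by (auto simp: in_keys_iff lookup_minus)
  show "heis_deg u < heis_deg (c, K)"
  proof (rule ccontr)
    assume "\<not> heis_deg u < heis_deg (c, K)"
    then have "lookup (T (single (c, K) A)) u = 0"
      using lookup_eq_0[of c K "fst u" "snd u" A] ne by simp
    then show False using u ne by (simp add: in_keys_iff lookup_minus lookup_single_not_eq)
  qed
qed

end

section \<open>Brackets of odd contact fields\<close>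

declare y_field.simps [simp del]

lemma contact_D_linear:
  "contact_D j (f + g) = contact_D j f + contact_D j g" "contact_D j (r *\<^sub>R f) = r *\<^sub>R contact_D j f"
  "contact_D j (- f) = - contact_D j f" "contact_D j (f - g) = contact_D j f - contact_D j g"
  "contact_D j (\<Sum>a\<in>A. h a) = (\<Sum>a\<in>A. contact_D j (h a))"
  by (simp_all add: contact_D_def algebra_simps Dbar_sum d_x_sum sum.distrib sum_distrib_left scaleR_right.sum)

lemma theta_euler_linear:
  "theta_euler (f + g) = theta_euler f + theta_euler g" "theta_euler (r *\<^sub>R f) = r *\<^sub>R theta_euler f"
  by (simp_all add: theta_euler_def algebra_simps sum.distrib scaleR_right.sum)

lemma contact_D_theta_mult: "contact_D i (theta j * f) = (if i = j then f else 0) - theta j * contact_D i f"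
  by (simp add: contact_D_def Dbar_mult Dbar_theta d_x_mult theta_theta_left[of i j] algebra_simps)

lemma contact_D_x_mult: "contact_D i (x_coord * f) = x_coord * contact_D i f + theta i * f"
  by (simp add: contact_D_def Dbar_mult Dbar_x d_x_mult theta_x algebra_simps scaleR_2)

lemma contact_D_Dbar: "contact_D j (Dbar i f) = - Dbar i (contact_D j f)"
  by (cases "i = j")
    (simp_all add: contact_D_def Dbar_mult Dbar_theta d_x_Dbar Dbar_Dbar_same Dbar_Dbar[of j i] scaleR_2 algebra_simps)

lemma contact_D_contact_D:
  "contact_D i (contact_D j f) = (if i = j then 2 *\<^sub>R d_x f else 0) - contact_D j (contact_D i f)"
proof -
  have *: "contact_D i (contact_D j f) = Dbar i (Dbar j f) + (if i = j then 2 *\<^sub>R d_x f else 0)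
      - 2 *\<^sub>R (theta j * Dbar i (d_x f)) + 2 *\<^sub>R (theta i * Dbar j (d_x f)) + 4 *\<^sub>R (theta i * (theta j * d_x (d_x f)))" for i j
    by (simp add: contact_D_def Dbar_mult Dbar_theta d_x_mult d_x_Dbar algebra_simps)
  show ?thesis
    unfolding *[of i j] *[of j i]
    by (cases "i = j")
      (simp_all add: Dbar_Dbar_same Dbar_Dbar[of i j] theta_theta_left[of i j] scaleR_2 algebra_simps)
qed

lemma theta_euler_theta_mult: "theta_euler (theta j * f) = theta j * f + theta j * theta_euler f"
proof -
  have "theta i * Dbar i (theta j * f) = (if i = j then theta j * f else 0) + theta j * (theta i * Dbar i f)" for i
    by (simp add: Dbar_mult Dbar_theta theta_theta_left[of i j] algebra_simps)
  then show ?thesis by (simp add: theta_euler_def sum.distrib sum_distrib_left)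
qed

lemma theta_euler_x_mult: "theta_euler (x_coord * f) = x_coord * theta_euler f"
proof -
  have "theta i * Dbar i (x_coord * f) = x_coord * (theta i * Dbar i f)" for i
    by (simp add: Dbar_mult Dbar_x theta_x algebra_simps)
  then show ?thesis by (simp add: theta_euler_def sum_distrib_left)
qed

lemma contact_D_theta_euler: "contact_D j (theta_euler f) = theta_euler (contact_D j f) + Dbar j f"
  by (simp add: theta_euler_def contact_D_linear contact_D_theta_mult contact_D_Dbar sum.distrib)

abbreviation lie_anticommutator ::
  "real \<Rightarrow> 'n::{finite,linorder} vfield \<Rightarrow> 'n vfield \<Rightarrow> 'n superfun \<Rightarrow> 'n superfun" where
  "lie_anticommutator l X Y g \<equiv> lie_density l X (lie_density l Y g) + lie_density l Y (lie_density l X g)"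

text \<open>The action of \<open>X_theta j\<close> is half of \<open>contact_D j\<close>, whose
  square is \<open>d_x\<close>; hence the anticommutator is half of \<open>d_x\<close>, and the
  factor 2 restores it.\<close>

lemma anticommutator_theta_theta:
  fixes g :: "'n::{finite,linorder} superfun"
  assumes "CARD('n) \<ge> 3"
  shows "lie_density l (contact_field 1) g = 2 *\<^sub>R
    lie_anticommutator l (X_theta j) (X_theta j) g"
proof -
  have "contact_D j (contact_D j g) + contact_D j (contact_D j g) = 2 *\<^sub>R d_x g"
    using contact_D_contact_D[of j j g] by (simp add: eq_diff_eq)
  then have 1: "contact_D j (contact_D j g) = d_x g" by (simp flip: scaleR_2)
  have 2: "lie_density l (contact_field 1) g = d_x g"
    by (simp add: lie_density_contact_field[OF assms] Dbar_eq)
  show ?thesis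
    unfolding 2 lie_density_contact_theta[OF assms] by (simp add: contact_D_linear 1 flip: scaleR_2)
qed

text \<open>One computation for two brackets: \<open>i = j\<close> yields the field of
  \<open>x_coord\<close>, distinct indices that of \<open>theta i * theta j\<close>. It is stated
  after unfolding the density actions, ready for rewriting.\<close>

lemma anticommutator_x_theta_theta:
  "2 *\<^sub>R ((1 / 2) *\<^sub>R (x_coord * contact_D j ((1 / 2) *\<^sub>R contact_D i g) + theta j * theta_euler ((1 / 2) *\<^sub>R contact_D i g)
      + (2 * l) *\<^sub>R (theta j * ((1 / 2) *\<^sub>R contact_D i g)))
    + (1 / 2) *\<^sub>R contact_D i ((1 / 2) *\<^sub>R (x_coord * contact_D j g + theta j * theta_euler g + (2 * l) *\<^sub>R (theta j * g)))) =
   (if i = j then x_coord * d_x g + (1 / 2) *\<^sub>R theta_euler g + l *\<^sub>R g else 0)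
    + (1 / 2) *\<^sub>R (theta i * contact_D j g - theta j * Dbar i g)"
proof -
  have "x_coord * contact_D j (contact_D i g) + x_coord * contact_D i (contact_D j g) =
      (if i = j then 2 *\<^sub>R (x_coord * d_x g) else 0)"
    using contact_D_contact_D[of j i g] by (simp add: distrib_left[symmetric])
  then have *: "x_coord * contact_D j (contact_D i g) =
      (if i = j then 2 *\<^sub>R (x_coord * d_x g) else 0) - x_coord * contact_D i (contact_D j g)"
    by (simp add: eq_diff_eq)
  show ?thesis
    by (simp add: contact_D_linear theta_euler_linear contact_D_x_mult contact_D_theta_mult contact_D_theta_euler *
        algebra_simps)
qed

lemma anticommutator_x:
  fixes g :: "'n::{finite,linorder} superfun"
  assumes "CARD('n) \<ge> 3"
  shows "lie_density l (contact_field x_coord) g = 2 *\<^sub>R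
    lie_anticommutator l (X_x_theta j) (X_theta j) g"
proof -
  have "lie_density l (contact_field x_coord) g = x_coord * d_x g + (1 / 2) *\<^sub>R theta_euler g + l *\<^sub>R g"
    by (simp add: lie_density_contact_field[OF assms] Dbar_x theta_euler_def sum_negf)
  moreover have "theta j * contact_D j g - theta j * Dbar j g = 0"
    by (simp add: contact_D_def algebra_simps)
  ultimately show ?thesis
    unfolding lie_density_contact_theta[OF assms] lie_density_contact_x_theta[OF assms] anticommutator_x_theta_theta by simp
qed

lemma anticommutator_theta_theta_distinct:
  fixes g :: "'n::{finite,linorder} superfun"
  assumes "CARD('n) \<ge> 3" "i \<noteq> j"
  shows "lie_density l (contact_field (theta i * theta j)) g = 2 *\<^sub>R
    lie_anticommutator l (X_x_theta j) (X_theta i) g"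
proof -
  have "Dbar k (parity_inv (theta i * theta j)) * Dbar k g =
     (if k = i then theta j * Dbar i g else 0) - (if k = j then theta i * Dbar j g else 0)" for k
    using assms(2) by (simp add: parity_inv_mult Dbar_mult Dbar_theta)
  then have "(\<Sum>k\<in>UNIV. Dbar k (parity_inv (theta i * theta j)) * Dbar k g) = theta j * Dbar i g - theta i * Dbar j g"
    by (simp add: sum_subtractf)
  then have "lie_density l (contact_field (theta i * theta j)) g =
     theta i * (theta j * d_x g) - (1 / 2) *\<^sub>R (theta j * Dbar i g - theta i * Dbar j g)"
    by (simp add: lie_density_contact_field[OF assms(1)] d_x_mult mult.assoc)
  also have "\<dots> = (1 / 2) *\<^sub>R (theta i * contact_D j g - theta j * Dbar i g)"
    by (simp add: contact_D_def algebra_simps)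
  finally show ?thesis
    unfolding lie_density_contact_theta[OF assms(1)] lie_density_contact_x_theta[OF assms(1)] anticommutator_x_theta_theta
    using assms(2) by simp
qed

lemma anticommutator_x_theta_x_theta:
  fixes g :: "'n::{finite,linorder} superfun"
  assumes "CARD('n) \<ge> 3"
  shows "lie_density l (contact_field (x_coord * x_coord)) g = 2 *\<^sub>R
    lie_anticommutator l (X_x_theta j) (X_x_theta j) g"
proof -
  let ?h = "x_coord * contact_D j g + theta j * theta_euler g + (2 * l) *\<^sub>R (theta j * g)"
  have "Dbar i (parity_inv (x_coord * x_coord)) * Dbar i g = -2 *\<^sub>R (x_coord * (theta i * Dbar i g))" for i
    by (simp add: parity_inv_mult Dbar_mult Dbar_x x_commute[of "theta i"] mult.assoc scaleR_2 algebra_simps theta_x)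
  then have sum: "(\<Sum>i\<in>UNIV. Dbar i (parity_inv (x_coord * x_coord)) * Dbar i g) = -2 *\<^sub>R (x_coord * theta_euler g)"
    unfolding theta_euler_def sum_distrib_left scaleR_right.sum by (intro sum.cong refl)
  have dx: "d_x (x_coord * x_coord) * h = 2 *\<^sub>R (x_coord * h)" for h :: "'n superfun"
    by (simp add: d_x_mult distrib_right scaleR_2)
  have 1: "lie_density l (contact_field (x_coord * x_coord)) g =
      x_coord * (x_coord * d_x g) + x_coord * theta_euler g + (2 * l) *\<^sub>R (x_coord * g)"
    unfolding lie_density_contact_field[OF assms] sum dx by (simp add: mult.assoc mult.commute[of l])
  have "contact_D j (contact_D j g) + contact_D j (contact_D j g) = 2 *\<^sub>R d_x g"
    using contact_D_contact_D[of j j g] by (simp add: eq_diff_eq)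
  then have D: "contact_D j (contact_D j g) = d_x g" by (simp flip: scaleR_2)
  have T: "theta j * contact_D j g = theta j * Dbar j g"
    by (simp add: contact_D_def algebra_simps)
  \<comment> \<open>\<open>?h\<close> is twice the action of \<open>X_x_theta j\<close> on
    \<open>g\<close>, so the left side is four times the square of that action, that is, twice the
    anticommutator.\<close>
  have 2: "x_coord * contact_D j ?h + theta j * theta_euler ?h + (2 * l) *\<^sub>R (theta j * ?h) =
      x_coord * (x_coord * d_x g) + x_coord * theta_euler g + (2 * l) *\<^sub>R (x_coord * g)"
    by (simp add: contact_D_linear theta_euler_linear contact_D_x_mult contact_D_theta_mult contact_D_theta_euler
        theta_euler_x_mult theta_euler_theta_mult D T theta_x algebra_simps)
  have "2 *\<^sub>R ((1/2) *\<^sub>R (x_coord * contact_D j ((1/2) *\<^sub>R ?h) + theta j * theta_euler ((1/2) *\<^sub>R ?h) + (2 * l) *\<^sub>R (theta j * ((1/2) *\<^sub>R ?h)))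
     + (1/2) *\<^sub>R (x_coord * contact_D j ((1/2) *\<^sub>R ?h) + theta j * theta_euler ((1/2) *\<^sub>R ?h) + (2 * l) *\<^sub>R (theta j * ((1/2) *\<^sub>R ?h))))
     = x_coord * contact_D j ?h + theta j * theta_euler ?h + (2 * l) *\<^sub>R (theta j * ?h)"
    by (simp only: contact_D_linear(2) theta_euler_linear(2) mult_scaleR_right scaleR_add_right[symmetric] scaleR_left_commute[of "2 * l"])
       (simp flip: scaleR_2)
  then show ?thesis
    unfolding lie_density_contact_x_theta[OF assms] 1 2 by simp
qed

section \<open>Equivariance\<close>

lemma linear_lie_density_right: "linear (lie_density l X)"
  by (rule linearI)
    (simp_all add: lie_density_def vf_apply_def linear_add[OF linear_d_theta] linear_scale[OF linear_d_theta]
      algebra_simps sum.distrib scaleR_right.sum)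

lemma lie_op_add:
  "lie_op l m (X + Y) (normal_op s) g = lie_op l m X (normal_op s) g + lie_op l m Y (normal_op s) g"
proof -
  have "vf_even (X + Y) = vf_even X + vf_even Y" "vf_odd (X + Y) = vf_odd X + vf_odd Y"
    by (simp_all add: vf_even_def vf_odd_def vf_parity_inv_add algebra_simps)
  then show ?thesis
    by (simp add: lie_op_def linear_add[OF linear_lie_density] normal_op_right_linear)
qed

lemma lie_op_scaleR: "lie_op l m (r *\<^sub>R X) (normal_op s) g = r *\<^sub>R lie_op l m X (normal_op s) g"
proof -
  have "vf_even (r *\<^sub>R X) = r *\<^sub>R vf_even X" "vf_odd (r *\<^sub>R X) = r *\<^sub>R vf_odd X"
    by (simp_all add: vf_even_def vf_odd_def vf_parity_inv_scaleR scaleR_add_right scaleR_diff_right)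
  then show ?thesis
    by (simp add: lie_op_def linear_scale[OF linear_lie_density] normal_op_right_linear scaleR_diff_right)
qed

text \<open>\<open>X\<close> acts on full symbols by a filtered operator whose leading part \<open>F\<^sub>0\<close> is the action on
  fine symbols, and \<open>normal_op \<circ> T\<close> intertwines the two.\<close>

definition equivariant_along ::
  "real \<Rightarrow> real \<Rightarrow> ('n::{finite,linorder} symb \<Rightarrow> 'n symb) \<Rightarrow> 'n vfield \<Rightarrow> bool" where
  "equivariant_along l m T X \<longleftrightarrow> (\<exists>F F0. filtered_with_symbol heis_deg F F0 \<and>
     (\<forall>s. lie_op l m X (normal_op s) = normal_op (F s)) \<and> (\<forall>s. F (T s) = T (F0 s)))"

lemma equivariant_alongI:
  "filtered_with_symbol heis_deg F F0 \<Longrightarrow> (\<And>s. lie_op l m X (normal_op s) = normal_op (F s)) \<Longrightarrow>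
    (\<And>s. F (T s) = T (F0 s)) \<Longrightarrow> equivariant_along l m T X"
  unfolding equivariant_along_def by blast

lemma equivariant_along_lie_P:
  assumes "equivariant_along l m T X"
  shows "lie_op l m X (normal_op (T s)) = normal_op (T (lie_P l m X s))"
proof -
  obtain F F0 where F: "filtered_with_symbol heis_deg F F0" "\<And>s. lie_op l m X (normal_op s) = normal_op (F s)"
    "\<And>s. F (T s) = T (F0 s)"
    using assms unfolding equivariant_along_def by auto
  show ?thesis unfolding lie_P_eq[OF F(1,2)] F(2,3) ..
qed

lemma subspace_equivariant_along:
  assumes "linear T"
  shows "subspace {X. equivariant_along l m T X}" (is "subspace ?E")
proof (rule subspaceI)
  have "filtered_with_symbol heis_deg (\<lambda>s. 0 *\<^sub>R s) (\<lambda>s. 0 *\<^sub>R s)"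
    by (rule filtered_with_symbol_scaleR[OF filtered_with_symbol_id])
  moreover have "lie_op l m 0 (normal_op s) = normal_op (0 *\<^sub>R s)" for s :: "'a symb"
    using lie_op_scaleR[of l m 0 0 s] by (simp add: fun_eq_iff normal_op_zero)
  ultimately have "equivariant_along l m T 0"
    by (rule equivariant_alongI) (simp add: linear_0[OF assms])
  then show "0 \<in> ?E" by simp
next
  fix X Y assume "X \<in> ?E" "Y \<in> ?E"
  then obtain F F0 G G0 where
    F: "filtered_with_symbol heis_deg F F0" "\<And>s. lie_op l m X (normal_op s) = normal_op (F s)" "\<And>s. F (T s) = T (F0 s)" and
    G: "filtered_with_symbol heis_deg G G0" "\<And>s. lie_op l m Y (normal_op s) = normal_op (G s)" "\<And>s. G (T s) = T (G0 s)"
    unfolding equivariant_along_def by auto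
  have "lie_op l m (X + Y) (normal_op s) = normal_op (F s + G s)" for s
    by (simp add: fun_eq_iff lie_op_add F(2) G(2) normal_op_add)
  from equivariant_alongI[OF filtered_with_symbol_add[OF F(1) G(1)] this]
  show "X + Y \<in> ?E" by (simp add: F(3) G(3) linear_add[OF assms])
next
  fix r :: real and X assume "X \<in> ?E"
  then obtain F F0 where
    F: "filtered_with_symbol heis_deg F F0" "\<And>s. lie_op l m X (normal_op s) = normal_op (F s)" "\<And>s. F (T s) = T (F0 s)"
    unfolding equivariant_along_def by auto
  have "lie_op l m (r *\<^sub>R X) (normal_op s) = normal_op (r *\<^sub>R F s)" for s
    by (simp add: fun_eq_iff lie_op_scaleR F(2) normal_op_scaleR)
  from equivariant_alongI[OF filtered_with_symbol_scaleR[OF F(1)] this]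
  show "r *\<^sub>R X \<in> ?E" by (simp add: F(3) linear_scale[OF assms])
qed

text \<open>When two odd actions on operators are composed, the terms with one field on each side of
  the operator have opposite signs in the two orders. They cancel in
  \<open>F (G s) + G (F s)\<close>, which leaves the anticommutators on either side; the parity
  hypotheses say that the density actions are odd.\<close>

lemma equivariant_along_anticommutator:
  assumes T: "linear T"
    and X: "equivariant_along l m T X" "vf_parity_inv X = - X"
      "\<And>l g. lie_density l X (parity_inv g) = - parity_inv (lie_density l X g)"
    and Y: "equivariant_along l m T Y" "vf_parity_inv Y = - Y"
      "\<And>l g. lie_density l Y (parity_inv g) = - parity_inv (lie_density l Y g)"
    and Z: "vf_parity_inv Z = Z"
      "\<And>l g. lie_density l Z g = r *\<^sub>R lie_anticommutator l X Y g"
  shows "equivariant_along l m T Z"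
proof -
  obtain F F0 G G0 where
    F: "filtered_with_symbol heis_deg F F0" "\<And>s. lie_op l m X (normal_op s) = normal_op (F s)" "\<And>s. F (T s) = T (F0 s)" and
    G: "filtered_with_symbol heis_deg G G0" "\<And>s. lie_op l m Y (normal_op s) = normal_op (G s)" "\<And>s. G (T s) = T (G0 s)"
    using X(1) Y(1) unfolding equivariant_along_def by auto
  have FX: "normal_op (F s) g = lie_density m X (normal_op s g) - parity_inv (normal_op s (parity_inv (lie_density l X g)))" for s g
    using lie_op_odd[OF X(2), of l m s g] by (simp add: F(2) normal_op_symb_parity)
  have GY: "normal_op (G s) g = lie_density m Y (normal_op s g) - parity_inv (normal_op s (parity_inv (lie_density l Y g)))" for s g
    using lie_op_odd[OF Y(2), of l m s g] by (simp add: G(2) normal_op_symb_parity)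
  have FG: "normal_op (F (G s)) g = lie_density m X (lie_density m Y (normal_op s g))
      - lie_density m X (parity_inv (normal_op s (parity_inv (lie_density l Y g))))
      + lie_density m Y (parity_inv (normal_op s (parity_inv (lie_density l X g))))
      - normal_op s (lie_density l Y (lie_density l X g))" for s g
    unfolding FX GY linear_diff[OF linear_lie_density_right] by (simp add: X(3) Y(3) normal_op_right_linear)
  have GF: "normal_op (G (F s)) g = lie_density m Y (lie_density m X (normal_op s g))
      - lie_density m Y (parity_inv (normal_op s (parity_inv (lie_density l X g))))
      + lie_density m X (parity_inv (normal_op s (parity_inv (lie_density l Y g))))
      - normal_op s (lie_density l X (lie_density l Y g))" for s g
    unfolding FX GY linear_diff[OF linear_lie_density_right] by (simp add: X(3) Y(3) normal_op_right_linear)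
  have act: "lie_op l m Z (normal_op s) = normal_op (r *\<^sub>R (F (G s) + G (F s)))" for s
  proof
    fix g
    show "lie_op l m Z (normal_op s) g = normal_op (r *\<^sub>R (F (G s) + G (F s))) g"
      unfolding lie_op_even[OF Z(1)] Z(2) normal_op_scaleR normal_op_add FG GF linear_scale[OF linear_normal_op_right]
      linear_add[OF linear_normal_op_right] scaleR_diff_right[symmetric]
    by (rule arg_cong[where f = "scaleR r"]) simp
  qed
  have "filtered_with_symbol heis_deg (\<lambda>s. r *\<^sub>R (F (G s) + G (F s))) (\<lambda>s. r *\<^sub>R (F0 (G0 s) + G0 (F0 s)))"
    by (rule filtered_with_symbol_scaleR[OF filtered_with_symbol_add[OF
          filtered_with_symbol_compose[OF F(1) G(1)] filtered_with_symbol_compose[OF G(1) F(1)]]])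
  then show ?thesis
    by (rule equivariant_alongI[OF _ act]) (simp add: F(3) G(3) linear_add[OF T] linear_scale[OF T])
qed

lemma filtered_with_symbol_exact:
  "linear F \<Longrightarrow> preserves_degree deg F \<Longrightarrow> filtered_with_symbol deg F F"
  by (simp add: filtered_with_symbol_def moves_degree_def)

lemma lie_density_contact_parity:
  fixes g :: "'n::{finite,linorder} superfun"
  assumes "CARD('n) \<ge> 3"
  shows "lie_density l (X_theta j) (parity_inv g) = - parity_inv (lie_density l (X_theta j) g)"
    and "lie_density l (X_x_theta j) (parity_inv g) =
      - parity_inv (lie_density l (X_x_theta j) g)"
  by (simp_all add: lie_density_contact_theta[OF assms] lie_density_contact_x_theta[OF assms] contact_D_def theta_euler_def
    parity_inv_mult parity_inv_Dbar parity_inv_d_x parity_inv_sum sum_negf algebra_simps)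

lemma vf_parity_inv_contact_even: "parity_inv f = f \<Longrightarrow> vf_parity_inv (contact_field f) = contact_field f"
  by (simp add: vf_parity_inv_contact_field)

lemma spo_equivariant_along:
  fixes T :: "'n::{finite,linorder} symb \<Rightarrow> 'n symb"
  assumes n: "CARD('n) \<ge> 3" and T: "linear T"
    and theta: "\<And>j. equivariant_along l m T (X_theta j)"
    and x_theta: "\<And>j. equivariant_along l m T (X_x_theta j)"
    and "X \<in> spo"
  shows "equivariant_along l m T X"
proof -
  have odd: "vf_parity_inv (X_theta j) = - X_theta j"
    "vf_parity_inv (X_x_theta j) = - X_x_theta j" for j :: 'n
    by (rule vf_parity_inv_contact_odd; simp add: parity_inv_mult)+
  note br = equivariant_along_anticommutator[OF T]
  note th = theta odd(1) lie_density_contact_parity(1)[OF n]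
  note xth = x_theta odd(2) lie_density_contact_parity(2)[OF n]
  have "equivariant_along l m T (contact_field f)"
    if f: "f \<in> {1, x_coord, x_coord * x_coord} \<union> range theta \<union> {x_coord * theta i | i. True} \<union> {theta i * theta j | i j. i < j}" for f
  proof -
    consider "f = 1" | "f = x_coord" | "f = x_coord * x_coord" | j where "f = theta j"
      | j where "f = x_coord * theta j" | i j where "f = theta i * theta j" "i < j"
      using f by blast
    then show ?thesis
    proof cases
      case 1
      show ?thesis unfolding 1
        by (rule br[OF th th vf_parity_inv_contact_even anticommutator_theta_theta[OF n]]) simp
    next
      case 2
      show ?thesis unfolding 2
        by (rule br[OF xth th vf_parity_inv_contact_even anticommutator_x[OF n]]) simp
    next
      case 3
      show ?thesis unfolding 3
        by (rule br[OF xth xth vf_parity_inv_contact_even anticommutator_x_theta_x_theta[OF n]]) (simp add: parity_inv_mult)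
    next
      case (6 i j)
      then have "i \<noteq> j" by simp
      show ?thesis unfolding 6
        by (rule br[OF xth th vf_parity_inv_contact_even anticommutator_theta_theta_distinct[OF n \<open>i \<noteq> j\<close>]])
          (simp add: parity_inv_mult)
    qed (simp_all add: theta x_theta)
  qed
  then have "spo \<subseteq> {X. equivariant_along l m T X}"
    unfolding spo_def by (intro span_minimal subspace_equivariant_along[OF T]) blast
  then show ?thesis using \<open>X \<in> spo\<close> by blast
qed

section \<open>The odd contact fields as projective fields\<close>

lemma vf_mult_left_linear:
  "vf_mult (f + g) X = vf_mult f X + vf_mult g X" "vf_mult (f - g) X = vf_mult f X - vf_mult g X" "vf_mult 0 X = 0"
  by (simp_all add: vf_mult_def vec_eq_iff algebra_simps zero_prod_def)

lemma pgl_generators: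
  "y_field j \<in> pgl" "vf_mult (y_coord i) (y_field j) \<in> pgl" "vf_mult (y_coord i) euler_field \<in> pgl"
proof -
  show "y_field j \<in> pgl" unfolding pgl_def
    by (rule span_base, rule UnI1, rule UnI1, rule rangeI)
  show "vf_mult (y_coord i) (y_field j) \<in> pgl" unfolding pgl_def
    by (rule span_base, rule UnI1, rule UnI2, rule CollectI, intro exI conjI, rule refl, rule TrueI)
  show "vf_mult (y_coord i) euler_field \<in> pgl" unfolding pgl_def
    by (rule span_base, rule UnI2, rule CollectI, intro exI conjI, rule refl, rule TrueI)
qed

lemma subspace_pgl: "subspace pgl"
  unfolding pgl_def by (rule subspace_span)

lemma euler_field_eq: "euler_field = vf_mult x_coord (y_field None) + (\<Sum>i\<in>UNIV. vf_mult (theta i) (y_field (Some i)))"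
  by (simp add: euler_field_def UNIV_option_conv sum.reindex)

lemma contact_theta_in_pgl: "X_theta j \<in> pgl"
proof -
  have "vf_mult (Dbar i (parity_inv (theta j))) (Dbar_field i) = (if i = j then - Dbar_field j else 0)" for i
    by (simp add: Dbar_theta vf_mult_neg vf_mult_left_linear)
  then have "X_theta j = vf_mult (y_coord (Some j)) (y_field None)
      + (1 / 2) *\<^sub>R (y_field (Some j) - vf_mult (y_coord (Some j)) (y_field None))"
    by (simp add: contact_field_def Dbar_field_def[of j] scaleR_diff_right)
  then show ?thesis
    by (simp only:) (intro subspace_add subspace_scale subspace_diff subspace_pgl pgl_generators)
qed

text \<open>This field equals half of \<open>x d_theta j + theta j E\<close> with the Euler field
  \<open>E\<close>: its quadratic terms collect into one of the special quadratic generators of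
  \<open>pgl\<close>.\<close>

lemma contact_x_theta_in_pgl: "X_x_theta j \<in> pgl"
proof -
  have "vf_mult (Dbar i (parity_inv (x_coord * theta j))) (Dbar_field i) =
     (if i = j then vf_mult (x_coord * theta j) (y_field None) - vf_mult x_coord (y_field (Some j)) else 0)
      - vf_mult (theta j * theta i) (y_field (Some i))" for i
  proof -
    have 1: "Dbar i (parity_inv (x_coord * theta j)) = - (theta j * theta i) - (if i = j then x_coord else 0)"
      using theta_theta[of i j] by (simp add: parity_inv_mult Dbar_mult Dbar_x Dbar_theta)
    have 2: "theta j * theta i * theta i = 0" by (simp add: mult.assoc)
    show ?thesis unfolding vf_mult_Dbar_field 1
      by (simp add: vf_mult_left_linear vf_mult_neg left_diff_distrib 2)
  qed
  then have "X_x_theta j = vf_mult (x_coord * theta j) (y_field None)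
     - (1 / 2) *\<^sub>R (vf_mult (x_coord * theta j) (y_field None) - vf_mult x_coord (y_field (Some j))
      - (\<Sum>i\<in>UNIV. vf_mult (theta j * theta i) (y_field (Some i))))"
    by (simp add: contact_field_def sum_subtractf)
  also have "\<dots> = (1 / 2) *\<^sub>R (vf_mult x_coord (y_field (Some j)) +
      (vf_mult (x_coord * theta j) (y_field None) + (\<Sum>i\<in>UNIV. vf_mult (theta j * theta i) (y_field (Some i)))))"
  proof -
    have "a - (1 / 2) *\<^sub>R (a - b - c) = (1 / 2) *\<^sub>R (b + (a + c))" for a b c :: "'a vfield"
    proof -
      have "a - (1 / 2) *\<^sub>R (a - b - c) = (1 / 2) *\<^sub>R (a + a) - (1 / 2) *\<^sub>R (a - b - c)"
        by (simp only: scaleR_half_double)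
      also have "\<dots> = (1 / 2) *\<^sub>R (b + (a + c))"
        unfolding scaleR_diff_right[symmetric] by (rule arg_cong[where f = "scaleR (1/2)"]) simp
      finally show ?thesis .
    qed
    then show ?thesis .
  qed
  also have "vf_mult (x_coord * theta j) (y_field None) + (\<Sum>i\<in>UNIV. vf_mult (theta j * theta i) (y_field (Some i))) =
     vf_mult (theta j) euler_field"
  proof -
    have "vf_mult h (\<Sum>i\<in>A. V i) = (\<Sum>i\<in>A. vf_mult h (V i))" for h :: "'a superfun" and A :: "'a set" and V
      by (induction A rule: infinite_finite_induct)
        (simp_all add: vf_mult_add, simp_all add: vf_mult_def vec_eq_iff zero_prod_def)
    then show ?thesis by (simp add: euler_field_eq vf_mult_add vf_mult_vf_mult theta_x)
  qed
  finally have "X_x_theta j = (1 / 2) *\<^sub>R (vf_mult (y_coord None) (y_field (Some j))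
      + vf_mult (y_coord (Some j)) euler_field)" by simp
  then show ?thesis
    by (simp only:) (intro subspace_add subspace_scale subspace_pgl pgl_generators)
qed

lemma linear_field_actions:
  "linear x_field_action" "linear (theta_field_action i)" "linear (theta_d_x_action i)"
  by (rule linearI; simp add: x_field_action_def theta_field_action_def theta_d_x_action_def symb_op_linear
      quadratic_linear algebra_simps)+

text \<open>Affine fields preserve the order exactly, so on S_delta they act by the same formula as
  on full symbols.\<close>

lemma has_weight_field_actions:
  "has_weight 1 1 0 x_field_action" "has_weight 1 1 0 (theta_field_action i)" "has_weight 1 1 0 (theta_d_x_action i)"
  unfolding x_field_action_def theta_field_action_def theta_d_x_action_def
  by (intro has_weight_add has_weight_diff has_weight_scaleR
      has_weight_compose[OF has_weight_coeff_map has_weight_coeff_map]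
      has_weight_compose[OF has_weight_coeff_map has_weight_Dbar_coeffs]
      has_weight_compose[OF has_weight_zeta_mult has_weight_d_zeta]
      has_weight_compose[OF has_weight_zeta_mult has_weight_gamma_diff]
      has_weight_compose[OF has_weight_gamma_mult has_weight_gamma_diff]
      has_weight_compose[OF has_weight_zeta_mult has_weight_quadratic(1)]
      has_weight_compose[OF has_weight_zeta_mult has_weight_compose[OF has_weight_coeff_map has_weight_gamma_diff]];
      (rule refl)?; simp)+

text \<open>\<open>F\<close> describes the action on operators, its order-preserving part
  \<open>F0\<close> the action on S_delta; injectivity of \<open>normal_op\<close> transfers
  equivariance to \<open>T\<close>.\<close>

lemma pgl_quantization_intertwines:
  assumes Q: "pgl_equivariant_quantization l m Q" and T: "\<And>s. Q s = normal_op (T s)"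
    and "X \<in> pgl" "filtered_with_symbol ord_deg F F0" "\<And>s. lie_op l m X (normal_op s) = normal_op (F s)"
  shows "F (T s) = T (F0 s)"
proof -
  have "lie_op l m X (Q s) = Q (lie_S l m X s)"
    using Q \<open>X \<in> pgl\<close> unfolding pgl_equivariant_quantization_def by blast
  then have "normal_op (F (T s)) = normal_op (T (F0 s))"
    by (simp add: T assms(5) lie_S_eq[OF assms(4,5)])
  then show ?thesis by (simp add: normal_op_inject)
qed

theorem theorem3p9:
  fixes lam mu \<delta> :: real
    and Qsl :: "'n::{finite,linorder} symb \<Rightarrow> 'n operator"
  assumes "CARD('n) \<ge> 3"
    and "\<delta> = mu - lam"
    and "\<delta> \<notin> I_crit \<union> C_crit (superdim TYPE('n))"
    and "pgl_equivariant_quantization lam mu Qsl"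
  shows "fine_spo_equivariant_quantization lam mu (Qsl \<circ> SQ \<delta>)"
proof -
  let ?Q = "Qsl \<circ> SQ \<delta>"
  define T where "T s = full_symbol (Qsl s)" for s
  have T: "Qsl s = normal_op (T s)" for s
  proof -
    have "Qsl s \<in> range normal_op"
      using assms(4) unfolding pgl_equivariant_quantization_def diff_ops_def by blast
    then show ?thesis by (auto simp: T_def)
  qed
  have lin_Q: "linear (\<lambda>s. Qsl s g)" for g
    using assms(4) unfolding pgl_equivariant_quantization_def linear_to_ops_def by blast
  have lin_T: "linear T"
  proof (rule linearI)
    show "T (s + t) = T s + T t" for s t
      using linear_add[OF lin_Q, of s t] unfolding T
      by (simp add: fun_eq_iff normal_op_add flip: normal_op_inject)
    show "T (r *\<^sub>R s) = r *\<^sub>R T s" for r s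
      using linear_scale[OF lin_Q, of r s] unfolding T
      by (simp add: fun_eq_iff normal_op_scaleR flip: normal_op_inject)
  qed
  note tw = pgl_quantization_intertwines[OF assms(4) T]
  have exact: "filtered_with_symbol ord_deg F F" if "linear F" "has_weight 1 1 0 F" for F :: "'n symb \<Rightarrow> 'n symb"
    using that has_weight_ord(1) by (intro filtered_with_symbol_exact) auto
  have shift: "linear (\<lambda>s. F s + r *\<^sub>R s)" "has_weight 1 1 0 (\<lambda>s. F s + r *\<^sub>R s)"
    if "linear F" "has_weight 1 1 0 F" for F :: "'n symb \<Rightarrow> 'n symb" and r
  proof -
    show "linear (\<lambda>s. F s + r *\<^sub>R s)"
      using that(1) by (intro linearI) (simp_all add: linear_add linear_scale algebra_simps)
    have "has_weight 1 1 0 (\<lambda>s :: 'n symb. s)" by (auto simp: has_weight_def)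
    then show "has_weight 1 1 0 (\<lambda>s. F s + r *\<^sub>R s)"
      using that(2) by (intro has_weight_add has_weight_scaleR)
  qed
  let ?k = "density_shift TYPE('n) (mu - lam)"
  interpret affine_equivariant T
  proof (rule affine_equivariant.intro)
    show "linear T" by (rule lin_T)
    show "T (coeff_map d_x s) = coeff_map d_x (T s)" for s
      by (rule tw[symmetric, OF pgl_generators(1) exact lie_op_translation])
        (auto intro: linear_coeff_map linear_d_x has_weight_coeff_map)
    have "(1 / 2) *\<^sub>R D_coeffs j (T s) = T ((1 / 2) *\<^sub>R D_coeffs j s)" for j s
      by (rule tw[OF contact_theta_in_pgl exact lie_op_contact_theta[OF assms(1)]])
        (auto intro: has_weight_scaleR has_weight_D_coeffs linear_compose_scale_right linear_D_coeffs)
    then show "T (D_coeffs j s) = D_coeffs j (T s)" for j s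
      by (simp add: linear_scale[OF lin_T])
    have 1: "vf_mult (theta j) (y_field None) \<in> pgl" "vf_mult x_coord (y_field None) \<in> pgl"
      "vf_mult (theta j) (y_field (Some j)) \<in> pgl" for j :: 'n
      using pgl_generators(2)[of "Some j" None] pgl_generators(2)[of None None] pgl_generators(2)[of "Some j" "Some j"]
      by simp_all
    show "T (theta_d_x_action j s) = theta_d_x_action j (T s)" for j s
      by (rule tw[symmetric, OF 1(1) exact[OF linear_field_actions(3) has_weight_field_actions(3)]
          lie_op_theta_d_x[folded theta_d_x_action_def]])
    \<comment> \<open>The density terms, \<open>?k\<close> here and \<open>- ?k\<close> below, are
      scalars and drop out by linearity of \<open>T\<close>.\<close>
    have "x_field_action (T s) + ?k *\<^sub>R T s =
        T (x_field_action s + ?k *\<^sub>R s)" for s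
      by (rule tw[OF 1(2) exact[OF shift[OF linear_field_actions(1) has_weight_field_actions(1)]]
          lie_op_x_d_x[folded theta_diff_def x_field_action_def]])
    then show "T (x_field_action s) = x_field_action (T s)" for s
      by (simp add: linear_add[OF lin_T] linear_scale[OF lin_T])
    have "theta_field_action i (T s) + (- ?k) *\<^sub>R T s =
        T (theta_field_action i s + (- ?k) *\<^sub>R s)" for i s
    proof (rule tw[OF 1(3) exact[OF shift[OF linear_field_actions(2) has_weight_field_actions(2)]]])
      show "lie_op lam mu (vf_mult (theta i) (y_field (Some i))) (normal_op s) =
          normal_op (theta_field_action i s + - ?k *\<^sub>R s)" for s
        by (simp add: lie_op_theta_d_theta theta_field_action_def)
    qed
    then show "T (theta_field_action i s) = theta_field_action i (T s)" for i s
      by (simp add: linear_add[OF lin_T] linear_diff[OF lin_T] linear_scale[OF lin_T])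
    show "lookup (T (single u A)) u = A" for u A
    proof -
      have "single u A \<in> S_comp (ord_deg u)" by (simp add: homog_def)
      then have "sigma (ord_deg u) (Qsl (single u A)) = single u A"
        using assms(4) unfolding pgl_equivariant_quantization_def by blast
      from arg_cong[OF this, of "\<lambda>s. lookup s u"]
      show ?thesis by (simp add: sigma_def T lookup_homog_part)
    qed
  qed
  let ?T = "\<lambda>s. T (SQ \<delta> s)"
  have Q: "?Q s = normal_op (?T s)" for s by (simp add: T)
  have filt: "filtered_with_symbol heis_deg ?T (\<lambda>s. s)"
    using filtered_with_symbol_compose[OF filtered SQ_filtered] .
  then have lin: "linear ?T" by (simp add: filtered_with_symbol_def)
  have half: "\<delta> \<noteq> of_int z / 2" for z using not_half_integer assms(3) by blast
  have "equivariant_along lam mu ?T (X_theta j)" for j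
    unfolding equivariant_along_def
  proof (intro exI conjI allI)
    show "filtered_with_symbol heis_deg (\<lambda>s. (1/2) *\<^sub>R D_coeffs j s) (\<lambda>s. (1/2) *\<^sub>R D_coeffs j s)"
      by (intro filtered_with_symbol_scaleR filtered_with_symbol_exact linear_D_coeffs has_weight_heis(1)[OF has_weight_D_coeffs] refl)
    show "lie_op lam mu (X_theta j) (normal_op s) = normal_op ((1/2) *\<^sub>R D_coeffs j s)" for s :: "'n symb"
      by (rule lie_op_contact_theta[OF assms(1)])
    show "(1/2) *\<^sub>R D_coeffs j (?T s) = ?T ((1/2) *\<^sub>R D_coeffs j s)" for s
      by (simp add: linear_scale[OF lin] D_coeffs[symmetric] SQ_D_coeffs)
  qed
  moreover have "equivariant_along lam mu ?T (X_x_theta j)" for j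
    unfolding equivariant_along_def
  proof (intro exI conjI allI)
    \<comment> \<open>One action, two leading parts: gamma_j d_zeta keeps the order but lowers the
      Heisenberg degree, so it stays in \<open>?order\<close> and is absent from
      \<open>?fine\<close>; \<open>contact_lower\<close> is lost in both.\<close>
    let ?full = "\<lambda>s. (1/2) *\<^sub>R (contact_principal \<delta> j s - gamma_mult j (d_zeta s) + contact_lower lam j s)"
    let ?fine = "\<lambda>s. (1/2) *\<^sub>R contact_principal \<delta> j s"
    let ?order = "\<lambda>s. (1/2) *\<^sub>R (contact_principal \<delta> j s - gamma_mult j (d_zeta s))"
    have lins: "linear ?full" "linear ?fine" "linear ?order"
      by (rule linearI; simp add: linear_add[OF linear_contact_principal] linear_scale[OF linear_contact_principal]
         contact_lower_def symb_op_linear quadratic_linear algebra_simps)+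
    have "has_weight 1 (1/2) (- 1/2) (\<lambda>s. (1/2) *\<^sub>R (contact_lower lam j s - gamma_mult j (d_zeta s)))"
      using has_weight_contact_lower[of 1 "1/2"] has_weight_gamma_d_zeta[of 1 "1/2"]
      by (intro has_weight_scaleR has_weight_diff) simp_all
    then have "lowers_degree heis_deg (\<lambda>s. (1/2) *\<^sub>R (contact_lower lam j s - gamma_mult j (d_zeta s)))"
      by (rule has_weight_heis(2)) simp
    moreover have "(\<lambda>s. (1/2) *\<^sub>R (contact_lower lam j s - gamma_mult j (d_zeta s))) = (\<lambda>s. ?full s - ?fine s)"
      unfolding scaleR_diff_right[symmetric] by simp
    moreover have "preserves_degree heis_deg ?fine"
      by (rule has_weight_heis(1)[OF has_weight_scaleR[OF has_weight_contact_principal]]) simp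
    ultimately show "filtered_with_symbol heis_deg ?full ?fine"
      using lins unfolding filtered_with_symbol_def by simp
    show lie: "lie_op lam mu (X_x_theta j) (normal_op s) = normal_op (?full s)" for s
      unfolding assms(2) by (rule lie_op_contact_x_theta[OF assms(1)])
    have "has_weight 1 1 (- 1) (\<lambda>s. (1/2) *\<^sub>R contact_lower lam j s)"
      by (intro has_weight_scaleR has_weight_contact_lower)
    then have "lowers_degree ord_deg (\<lambda>s. (1/2) *\<^sub>R contact_lower lam j s)"
      by (rule has_weight_ord(2)) simp
    moreover have "(\<lambda>s. (1/2) *\<^sub>R contact_lower lam j s) = (\<lambda>s. ?full s - ?order s)"
      unfolding scaleR_diff_right[symmetric] by simp
    moreover have "has_weight 1 1 0 ?order"
      using has_weight_gamma_d_zeta[of 1 1]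
      by (intro has_weight_scaleR has_weight_diff has_weight_contact_principal) simp
    then have "preserves_degree ord_deg ?order" by (rule has_weight_ord(1)) simp
    ultimately have "filtered_with_symbol ord_deg ?full ?order"
      using lins unfolding filtered_with_symbol_def by simp
    \<comment> \<open>\<open>T\<close> turns the action on operators into \<open>?order\<close>, and
      \<open>SQ\<close> turns \<open>?order\<close> into \<open>?fine\<close>.\<close>
    then have "?full (T s) = T (?order s)" for s
      by (rule tw[OF contact_x_theta_in_pgl _ lie])
    then show "?full (?T s) = ?T (?fine s)" for s
      by (simp only: SQ_contact_principal[OF half] linear_scale[OF linear_SQ])
  qed
  ultimately have spo: "equivariant_along lam mu ?T X" if "X \<in> spo" for X
    using spo_equivariant_along[OF assms(1) lin _ _ that] by blast
  have "bij ?T"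
  \<comment> \<open>Twice the Heisenberg degree is a natural number.\<close>
  proof (rule filtered_with_symbol_id_bij[OF filt, where f = "\<lambda>(c, K). 2 * c + card K"])
    show "(case u of (c, K) \<Rightarrow> 2 * c + card K) < (case v of (c, K) \<Rightarrow> 2 * c + card K)" if "heis_deg u < heis_deg v" for u v :: "nat \<times> 'n set"
      using that by (cases u; cases v) (simp add: heis_deg_def)
  qed
  moreover have "bij_betw normal_op UNIV (diff_ops :: 'n operator set)"
    by (simp add: bij_betw_def diff_ops_def inj_def normal_op_inject)
  ultimately have "bij_betw (normal_op \<circ> ?T) UNIV (diff_ops :: 'n operator set)"
    by (rule bij_betw_trans)
  moreover have "normal_op \<circ> ?T = ?Q" by (simp add: fun_eq_iff T)
  ultimately have bij: "bij_betw ?Q UNIV diff_ops" by simp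
  have "?Q S \<in> ops_heis d" "hsigma d (?Q S) = S" if S: "S \<in> P_comp d" for S d
  proof -
    show "hsigma d (?Q S) = S"
      unfolding Q by (simp add: hsigma_def filtered_with_symbol_homog_part[OF filt S])
    have "heis_deg u \<le> d" if u: "u \<in> keys (?T S)" for u
    proof (cases "u \<in> keys S")
      case True
      then show ?thesis using S by (simp add: homog_def)
    next
      case False
      then have "u \<in> keys (?T S - S)" using u by (simp add: in_keys_iff lookup_minus)
      then obtain v where "v \<in> keys S" "heis_deg u < heis_deg v"
        using filt unfolding filtered_with_symbol_def moves_degree_def by blast
      then show ?thesis using S by (auto simp: homog_def)
    qed
    then show "?Q S \<in> ops_heis d" unfolding Q ops_heis_def by blast
  qed
  moreover have "linear (\<lambda>s. ?Q s g)" for g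
    using linear_compose[OF linear_SQ lin_Q] by (simp add: o_def)
  moreover have "lie_op lam mu X (?Q S) = ?Q (lie_P lam mu X S)" if "X \<in> spo" for X S
    unfolding Q by (rule equivariant_along_lie_P[OF spo[OF that]])
  ultimately show ?thesis
    unfolding fine_spo_equivariant_quantization_def linear_to_ops_def using bij by blast
qed

end
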